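(* Let $A$ be a unital $C^*$-algebra and $S$ an abelian semigroup with identity $0$. Suppose that $\beta, L:S\to \operatorname{End}(A)$ are actions such that, for all $s\in S$, $\beta_s(1)=1$, $L_s$ is a transfer operator for $\beta_s$, and $\beta_s\circ L_s=\operatorname{id}$ (so that in particular $\beta_s$ is trivially a transfer operator for $L_s$, for all $s\in S$). Then the map $(\pi, V)\mapsto (\pi, V^* )$, where $(V^* )_s:=V_s^*$, is a bijective correspondence between the Toeplitz covariant representations $(\pi,V)$ of $(A, S, L, \beta)$ which satisfy $$V_s\pi(a)V_s^*=\pi(L_s(a))\quad\text{for all } s\in S,\ a\in A,$$ and the Toeplitz covariant representations $(\pi,V^* )$ of $(A, S, \beta, L)$ such that $$\pi(a)=\pi(a)V_s^*V_s\quad\text{for all } s\in S,\ a\in A,$$ and hence induces an isomorphism of $A\rtimes_{L, \beta}S$ onto $A\rtimes_{\beta, L}S$.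
   Context: $\operatorname{End}(A)$ is the set of $*$-endomorphisms of $A$ (not necessarily unital). The semigroup $S$ is written additively; an action $\alpha$ of $S$ is a semigroup homomorphism $s\mapsto \alpha_s$ ($\alpha_{s+t}=\alpha_s\circ\alpha_t$, $\alpha_0=\operatorname{id}$). For an endomorphism $\alpha_s$ of the unital $C^*$-algebra $A$, a transfer operator for $\alpha_s$ is a continuous linear positive map $T_s:A\to A$ with $T_s(\alpha_s(a)b)=aT_s(b)$ for all $a,b\in A$. In what follows $(A,S,\alpha,T)$ is a system consisting of an action $\alpha:S\to\operatorname{End}(A)$ and an action $T$ of $S$ by transfer operators $T_s$ for $\alpha_s$. (In the claim this is used with $(\alpha,T)=(\beta,L)$ and with $(\alpha,T)=(L,\beta)$.) A representation of $S$ in a $C^*$-algebra $B$ is a map $V:S\to M(B)$ (the multiplier algebra) with $V_{s+t}=V_sV_t$ and $V_0=1$; a representation of $S$ on a Hilbert space $H$ is a map $V:S\to B(H)$ with the same properties. A Toeplitz covariant representation of $(A,S,\alpha,T)$ is a pair $(\pi,V)$ of a non-degenerate representation $\pi:A\to B(H)$ and a representation $V:S\to B(H)$ with (TC1) $V_s\pi(a)=\pi(\alpha_s(a))V_s$ and (TC2) $V_s^*\pi(a)V_s=\pi(T_s(a))$ for all $a\in A$, $s\in S$. A Toeplitz crossed product for $(A,S,\alpha,T)$ is a triple $(B,i_A,i_S)$, where $i_A:A\to B$ is a non-degenerate homomorphism and $i_S:S\to M(B)$ is a representation, such that (i) if $\sigma$ is a non-degenerate representation of $B$, then $(\sigma\circ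 i_A,\overline{\sigma}\circ i_S)$ is a Toeplitz covariant representation ($\overline\sigma$ being the extension to $M(B)$); (ii) for every Toeplitz covariant representation $(\pi,V)$ there is a representation $\pi\times V$ of $B$ with $(\pi\times V)\circ i_A=\pi$ and $\overline{\pi\times V}\circ i_S=V$; (iii) $B$ is generated as a $C^*$-algebra by $\{i_A(a)i_S(s): a\in A,s\in S\}$. Such a triple exists and is unique up to canonical isomorphism; $B$ is denoted $\mathcal{T}(A,S,\alpha,T)$. For a subset $E$ of a $C^*$-algebra, $\overline{E}$ denotes the closed linear span of $E$. A redundancy is a pair $(a,k)$ with $a\in i_A(A)$ and $k\in\overline{i_A(A)i_S(s)i_S(s)^*i_A(A)}$ for some $s\in S$ such that $a\,i_A(b)i_S(s)=k\,i_A(b)i_S(s)$ for all $b\in A$. Let $I$ be the closed two-sided ideal of $\mathcal{T}(A,S,\alpha,T)$ generated by all differences $a-k$, where $(a,k)\in\overline{i_A(A\alpha_s(A)A)}\times\overline{i_A(A)i_S(s)i_S(s)^*i_A(A)}$ is a redundancy (for some $s\in S$). The crossed product is $A\rtimes_{\alpha,T}S:=\mathcal{T}(A,S,\alpha,T)/I$. *)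

theory Defs
  imports "HOL-Analysis.Analysis"
begin

section \<open>C*-algebras\<close>

class star =
  fixes star :: "'a \<Rightarrow> 'a"

text \<open>
  Not necessarily unital. Unital C*-algebras are the types of sort
  \<open>{cstar_algebra, monoid_mult}\<close>; in contrast to \<open>real_normed_algebra_1\<close>, this sort does not
  exclude the zero algebra.
\<close>

class cstar_algebra = real_normed_algebra + banach + star +
  fixes scaleC :: "complex \<Rightarrow> 'a \<Rightarrow> 'a" (infixr "*\<^sub>C" 75)
  assumes scaleC_of_real: "complex_of_real r *\<^sub>C x = r *\<^sub>R x"
    and scaleC_add_right: "c *\<^sub>C (x + y) = c *\<^sub>C x + c *\<^sub>C y"
    and scaleC_add_left: "(c + d) *\<^sub>C x = c *\<^sub>C x + d *\<^sub>C x"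
    and scaleC_scaleC: "c *\<^sub>C d *\<^sub>C x = (c * d) *\<^sub>C x"
    and mult_scaleC_left: "(c *\<^sub>C x) * y = c *\<^sub>C (x * y)"
    and mult_scaleC_right: "x * (c *\<^sub>C y) = c *\<^sub>C (x * y)"
    and norm_scaleC: "norm (c *\<^sub>C x) = cmod c * norm x"
    and star_star: "star (star x) = x"
    and star_add: "star (x + y) = star x + star y"
    and star_scaleC: "star (c *\<^sub>C x) = cnj c *\<^sub>C star x"
    and star_mult: "star (x * y) = star y * star x"
    and cstar_identity: "norm (star x * x) = norm x ^ 2"

lemma scaleC_one: "1 *\<^sub>C x = (x :: 'a::cstar_algebra)"
  using scaleC_of_real[of 1 x] by simp

global_interpretation complex_vector:
  vector_space "scaleC :: complex \<Rightarrow> 'a \<Rightarrow> 'a::cstar_algebra"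
  defines csubspace = complex_vector.subspace
    and cspan = complex_vector.span
  by standard (simp_all add: scaleC_add_right scaleC_add_left scaleC_scaleC scaleC_one)

lemma norm_star: "norm (star x) = norm (x :: 'a::cstar_algebra)"
proof -
  have le: "norm y \<le> norm (star y)" for y :: 'a
  proof (cases "norm y = 0")
    case False
    have "norm y * norm y \<le> norm (star y) * norm y"
      using norm_mult_ineq[of "star y" y] by (simp add: cstar_identity power2_eq_square)
    with False show ?thesis
      by simp
  qed simp
  show ?thesis
    using le[of x] le[of "star x"] by (simp add: star_star)
qed

lemma star_scaleR: "star (r *\<^sub>R x) = r *\<^sub>R star (x :: 'a::cstar_algebra)"
  by (metis complex_cnj_complex_of_real scaleC_of_real star_scaleC)

lemma bounded_linear_star: "bounded_linear (star :: 'a \<Rightarrow> 'a::cstar_algebra)"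
  by (rule bounded_linear_intro[where K = 1]) (simp_all add: star_add star_scaleR norm_star)

definition closed_cspan :: "'a set \<Rightarrow> 'a::cstar_algebra set" where
  "closed_cspan X = closure (cspan X)"

definition bounded_clinear :: "('a::cstar_algebra \<Rightarrow> 'b::cstar_algebra) \<Rightarrow> bool" where
  "bounded_clinear f \<longleftrightarrow> bounded_linear f \<and> (\<forall>c x. f (c *\<^sub>C x) = c *\<^sub>C f x)"

definition star_hom :: "('a::cstar_algebra \<Rightarrow> 'b::cstar_algebra) \<Rightarrow> bool" where
  "star_hom f \<longleftrightarrow>
     (\<forall>x y. f (x + y) = f x + f y) \<and>
     (\<forall>c x. f (c *\<^sub>C x) = c *\<^sub>C f x) \<and>
     (\<forall>x y. f (x * y) = f x * f y) \<and>
     (\<forall>x. f (star x) = star (f x))"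

definition positive_elem :: "'a::cstar_algebra \<Rightarrow> bool" where
  "positive_elem x \<longleftrightarrow> (\<exists>y. x = star y * y)"

definition cstar_subalgebra :: "'a::cstar_algebra set \<Rightarrow> bool" where
  "cstar_subalgebra C \<longleftrightarrow>
     csubspace C \<and> closed C \<and> (\<forall>x\<in>C. \<forall>y\<in>C. x * y \<in> C) \<and> (\<forall>x\<in>C. star x \<in> C)"

definition generated_cstar_subalgebra :: "'a::cstar_algebra set \<Rightarrow> 'a set" where
  "generated_cstar_subalgebra X = \<Inter> {C. cstar_subalgebra C \<and> X \<subseteq> C}"

definition closed_ideal :: "'a::cstar_algebra set \<Rightarrow> bool" where
  "closed_ideal I \<longleftrightarrow>
     csubspace I \<and> closed I \<and> (\<forall>x\<in>I. \<forall>y. x * y \<in> I \<and> y * x \<in> I)"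

definition generated_closed_ideal :: "'a::cstar_algebra set \<Rightarrow> 'a set" where
  "generated_closed_ideal X = \<Inter> {I. closed_ideal I \<and> X \<subseteq> I}"


section \<open>Multiplier algebras\<close>

text \<open>
  \<open>M(B)\<close> is realised by double centralisers: a multiplier \<open>m\<close> is the pair of maps
  \<open>x \<mapsto> m x\<close> and \<open>x \<mapsto> x m\<close>. Only its structure as a monoid with involution is needed.
\<close>

definition double_centraliser ::
    "('b::cstar_algebra \<Rightarrow> 'b) \<Rightarrow> ('b \<Rightarrow> 'b) \<Rightarrow> bool" where
  "double_centraliser l r \<longleftrightarrow> bounded_clinear l \<and> bounded_clinear r \<and>
     (\<forall>x y. l (x * y) = l x * y) \<and> (\<forall>x y. r (x * y) = x * r y) \<and>
     (\<forall>x y. r x * y = x * l y)"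

typedef (overloaded) 'b multiplier =
  "{(l, r :: 'b \<Rightarrow> 'b::cstar_algebra). double_centraliser l r}"
  by (rule exI[of _ "(id, id)"])
    (simp add: double_centraliser_def bounded_clinear_def id_def)

setup_lifting type_definition_multiplier

lift_definition mult_left :: "'b::cstar_algebra multiplier \<Rightarrow> 'b \<Rightarrow> 'b" is fst .

text \<open>\<open>mult_right m x\<close> is the product \<open>x m\<close>.\<close>

lift_definition mult_right :: "'b::cstar_algebra multiplier \<Rightarrow> 'b \<Rightarrow> 'b" is snd .

instantiation multiplier :: (cstar_algebra) "{monoid_mult, star}"
begin

lift_definition one_multiplier :: "'a multiplier" is "(id, id)"
  by (simp add: double_centraliser_def bounded_clinear_def id_def)

lift_definition times_multiplier :: "'a multiplier \<Rightarrow> 'a multiplier \<Rightarrow> 'a multiplier"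
  is "\<lambda>(l1, r1) (l2, r2). (l1 \<circ> l2, r2 \<circ> r1)"
  by (auto simp: double_centraliser_def bounded_clinear_def o_def intro: bounded_linear_compose)

lift_definition star_multiplier :: "'a multiplier \<Rightarrow> 'a multiplier"
  is "\<lambda>(l, r). (\<lambda>x. star (r (star x)), \<lambda>x. star (l (star x)))"
proof (clarsimp)
  fix l r :: "'a \<Rightarrow> 'a"
  assume lr: "double_centraliser l r"
  have bl: "bounded_clinear (\<lambda>x. star (f (star x)))" if "bounded_clinear f"
    for f :: "'a \<Rightarrow> 'a"
    using that
    by (auto simp: bounded_clinear_def star_scaleC
        intro!: bounded_linear_compose[OF bounded_linear_star]
          bounded_linear_compose[OF _ bounded_linear_star])
  have "star (l (star x)) * y = x * star (r (star y))" for x y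
  proof -
    have "r (star y) * star x = star y * l (star x)"
      using lr by (simp add: double_centraliser_def)
    then have "star (r (star y) * star x) = star (star y * l (star x))"
      by simp
    then show ?thesis
      by (simp add: star_mult star_star)
  qed
  then show "double_centraliser (\<lambda>x. star (r (star x))) (\<lambda>x. star (l (star x)))"
    using lr by (simp add: double_centraliser_def bl star_mult star_star)
qed

instance
  by standard (transfer; auto simp: o_def)+

end


section \<open>Hilbert spaces and bounded operators\<close>

text \<open>
  Hilbert spaces are carriers in an arbitrary type, so that one can quantify over all of them
  inside a formula. Inner products are linear in the first argument.
\<close>

record 'h hilb =
  hcarrier :: "'h set"
  hadd :: "'h \<Rightarrow> 'h \<Rightarrow> 'h"
  hzero :: 'h
  hscale :: "complex \<Rightarrow> 'h \<Rightarrow> 'h"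
  hinner :: "'h \<Rightarrow> 'h \<Rightarrow> complex"

definition hdist :: "'h hilb \<Rightarrow> 'h \<Rightarrow> 'h \<Rightarrow> real" where
  "hdist H x y =
     (let d = hadd H x (hscale H (- 1) y) in sqrt (Re (hinner H d d)))"

definition hnorm :: "'h hilb \<Rightarrow> 'h \<Rightarrow> real" where
  "hnorm H x = sqrt (Re (hinner H x x))"

locale hilbert_space =
  fixes H :: "'h hilb"
  assumes hzero_closed: "hzero H \<in> hcarrier H"
    and hadd_closed: "\<lbrakk>x \<in> hcarrier H; y \<in> hcarrier H\<rbrakk> \<Longrightarrow> hadd H x y \<in> hcarrier H"
    and hscale_closed: "x \<in> hcarrier H \<Longrightarrow> hscale H c x \<in> hcarrier H"
    and hadd_assoc: "\<lbrakk>x \<in> hcarrier H; y \<in> hcarrier H; z \<in> hcarrier H\<rbrakk>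
      \<Longrightarrow> hadd H (hadd H x y) z = hadd H x (hadd H y z)"
    and hadd_commute: "\<lbrakk>x \<in> hcarrier H; y \<in> hcarrier H\<rbrakk> \<Longrightarrow> hadd H x y = hadd H y x"
    and hadd_zero: "x \<in> hcarrier H \<Longrightarrow> hadd H (hzero H) x = x"
    and hadd_inverse: "x \<in> hcarrier H \<Longrightarrow> hadd H x (hscale H (- 1) x) = hzero H"
    and hscale_add_right: "\<lbrakk>x \<in> hcarrier H; y \<in> hcarrier H\<rbrakk>
      \<Longrightarrow> hscale H c (hadd H x y) = hadd H (hscale H c x) (hscale H c y)"
    and hscale_add_left: "x \<in> hcarrier H
      \<Longrightarrow> hscale H (c + d) x = hadd H (hscale H c x) (hscale H d x)"
    and hscale_hscale: "x \<in> hcarrier H \<Longrightarrow> hscale H c (hscale H d x) = hscale H (c * d) x"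
    and hscale_one: "x \<in> hcarrier H \<Longrightarrow> hscale H 1 x = x"
    and hinner_add_left: "\<lbrakk>x \<in> hcarrier H; y \<in> hcarrier H; z \<in> hcarrier H\<rbrakk>
      \<Longrightarrow> hinner H (hadd H x y) z = hinner H x z + hinner H y z"
    and hinner_scale_left: "\<lbrakk>x \<in> hcarrier H; y \<in> hcarrier H\<rbrakk>
      \<Longrightarrow> hinner H (hscale H c x) y = c * hinner H x y"
    and hinner_commute: "\<lbrakk>x \<in> hcarrier H; y \<in> hcarrier H\<rbrakk>
      \<Longrightarrow> hinner H x y = cnj (hinner H y x)"
    and hinner_nonneg: "x \<in> hcarrier H \<Longrightarrow> 0 \<le> Re (hinner H x x)"
    and hinner_definite: "\<lbrakk>x \<in> hcarrier H; hinner H x x = 0\<rbrakk> \<Longrightarrow> x = hzero H"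
    and hcomplete: "\<lbrakk>\<And>n. X n \<in> hcarrier H;
        \<And>e. e > 0 \<Longrightarrow> \<exists>N. \<forall>m\<ge>N. \<forall>n\<ge>N. hdist H (X m) (X n) < e\<rbrakk>
      \<Longrightarrow> \<exists>x\<in>hcarrier H. (\<lambda>n. hdist H (X n) x) \<longlonglongrightarrow> 0"

definition hclosed_subspace :: "'h hilb \<Rightarrow> 'h set \<Rightarrow> bool" where
  "hclosed_subspace H K \<longleftrightarrow>
     K \<subseteq> hcarrier H \<and> hzero H \<in> K \<and>
     (\<forall>x\<in>K. \<forall>y\<in>K. hadd H x y \<in> K) \<and> (\<forall>c. \<forall>x\<in>K. hscale H c x \<in> K) \<and>
     (\<forall>X. \<forall>x\<in>hcarrier H. (\<forall>n::nat. X n \<in> K) \<and> (\<lambda>n. hdist H (X n) x) \<longlonglongrightarrow> 0 \<longrightarrow> x \<in> K)"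

definition hclosed_span :: "'h hilb \<Rightarrow> 'h set \<Rightarrow> 'h set" where
  "hclosed_span H X = \<Inter> {K. hclosed_subspace H K \<and> X \<subseteq> K}"

text \<open>
  \<open>B(H)\<close>. Operators are \<open>undefined\<close> outside the carrier, so equality of operators is equality of
  functions and sets of representations are genuine sets.
\<close>

definition bounded_ops :: "'h hilb \<Rightarrow> ('h \<Rightarrow> 'h) set" where
  "bounded_ops H = {f \<in> hcarrier H \<rightarrow>\<^sub>E hcarrier H.
     (\<forall>x\<in>hcarrier H. \<forall>y\<in>hcarrier H. f (hadd H x y) = hadd H (f x) (f y)) \<and>
     (\<forall>c. \<forall>x\<in>hcarrier H. f (hscale H c x) = hscale H c (f x)) \<and>
     (\<exists>K. \<forall>x\<in>hcarrier H. hnorm H (f x) \<le> K * hnorm H x)}"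

abbreviation hcomp :: "'h hilb \<Rightarrow> ('h \<Rightarrow> 'h) \<Rightarrow> ('h \<Rightarrow> 'h) \<Rightarrow> 'h \<Rightarrow> 'h" where
  "hcomp H f g \<equiv> compose (hcarrier H) f g"

definition hid :: "'h hilb \<Rightarrow> 'h \<Rightarrow> 'h" where
  "hid H = (\<lambda>x\<in>hcarrier H. x)"

definition hadjoint :: "'h hilb \<Rightarrow> ('h \<Rightarrow> 'h) \<Rightarrow> 'h \<Rightarrow> 'h" where
  "hadjoint H f = (THE g. g \<in> bounded_ops H \<and>
     (\<forall>x\<in>hcarrier H. \<forall>y\<in>hcarrier H. hinner H (f x) y = hinner H x (g y)))"


section \<open>Representations\<close>

definition representation :: "'h hilb \<Rightarrow> ('b::cstar_algebra \<Rightarrow> 'h \<Rightarrow> 'h) \<Rightarrow> bool" where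
  "representation H \<sigma> \<longleftrightarrow>
     (\<forall>b. \<sigma> b \<in> bounded_ops H) \<and>
     (\<forall>b c. \<forall>x\<in>hcarrier H. \<sigma> (b + c) x = hadd H (\<sigma> b x) (\<sigma> c x)) \<and>
     (\<forall>z b. \<forall>x\<in>hcarrier H. \<sigma> (z *\<^sub>C b) x = hscale H z (\<sigma> b x)) \<and>
     (\<forall>b c. \<sigma> (b * c) = hcomp H (\<sigma> b) (\<sigma> c)) \<and>
     (\<forall>b. \<sigma> (star b) = hadjoint H (\<sigma> b))"

definition nondegenerate_representation ::
    "'h hilb \<Rightarrow> ('b::cstar_algebra \<Rightarrow> 'h \<Rightarrow> 'h) \<Rightarrow> bool" where
  "nondegenerate_representation H \<sigma> \<longleftrightarrow>
     representation H \<sigma> \<and>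
     hclosed_span H {\<sigma> b x | b x. x \<in> hcarrier H} = hcarrier H"

text \<open>
  The extension of \<open>\<sigma>\<close> to \<open>M(B)\<close>. It is determined by the defining equation exactly when
  \<open>\<sigma>\<close> is non-degenerate.
\<close>

definition multiplier_extension ::
    "'h hilb \<Rightarrow> ('b::cstar_algebra \<Rightarrow> 'h \<Rightarrow> 'h) \<Rightarrow> 'b multiplier \<Rightarrow> 'h \<Rightarrow> 'h" where
  "multiplier_extension H \<sigma> m = (THE f. f \<in> bounded_ops H \<and>
     (\<forall>b. \<forall>x\<in>hcarrier H. f (\<sigma> b x) = \<sigma> (mult_left m b) x))"

definition semigroup_representation ::
    "'h hilb \<Rightarrow> ('s::comm_monoid_add \<Rightarrow> 'h \<Rightarrow> 'h) \<Rightarrow> bool" where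
  "semigroup_representation H V \<longleftrightarrow>
     (\<forall>s. V s \<in> bounded_ops H) \<and>
     (\<forall>s t. V (s + t) = hcomp H (V s) (V t)) \<and> V 0 = hid H"

definition multiplier_semigroup_representation ::
    "('s::comm_monoid_add \<Rightarrow> 'b::cstar_algebra multiplier) \<Rightarrow> bool" where
  "multiplier_semigroup_representation V \<longleftrightarrow>
     (\<forall>s t. V (s + t) = V s * V t) \<and> V 0 = 1"

definition nondegenerate_hom :: "('a::cstar_algebra \<Rightarrow> 'b::cstar_algebra) \<Rightarrow> bool" where
  "nondegenerate_hom f \<longleftrightarrow> star_hom f \<and> closed_cspan {f a * b | a b. True} = UNIV"


section \<open>Actions, transfer operators and Toeplitz crossed products\<close>

definition semigroup_action :: "('s::comm_monoid_add \<Rightarrow> 'a \<Rightarrow> 'a) \<Rightarrow> bool" where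
  "semigroup_action \<alpha> \<longleftrightarrow> (\<forall>s t. \<alpha> (s + t) = \<alpha> s \<circ> \<alpha> t) \<and> \<alpha> 0 = id"

definition endomorphic_action ::
    "('s::comm_monoid_add \<Rightarrow> 'a::cstar_algebra \<Rightarrow> 'a) \<Rightarrow> bool" where
  "endomorphic_action \<alpha> \<longleftrightarrow> semigroup_action \<alpha> \<and> (\<forall>s. star_hom (\<alpha> s))"

definition transfer_operator ::
    "('a::cstar_algebra \<Rightarrow> 'a) \<Rightarrow> ('a \<Rightarrow> 'a) \<Rightarrow> bool" where
  "transfer_operator f T \<longleftrightarrow>
     bounded_clinear T \<and>
     (\<forall>a. positive_elem a \<longrightarrow> positive_elem (T a)) \<and>
     (\<forall>a b. T (f a * b) = a * T b)"

definition toeplitz_covariant ::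
    "'h hilb \<Rightarrow> ('s::comm_monoid_add \<Rightarrow> 'a::cstar_algebra \<Rightarrow> 'a) \<Rightarrow> ('s \<Rightarrow> 'a \<Rightarrow> 'a)
      \<Rightarrow> ('a \<Rightarrow> 'h \<Rightarrow> 'h) \<Rightarrow> ('s \<Rightarrow> 'h \<Rightarrow> 'h) \<Rightarrow> bool" where
  "toeplitz_covariant H \<alpha> T \<pi> V \<longleftrightarrow>
     nondegenerate_representation H \<pi> \<and> semigroup_representation H V \<and>
     (\<forall>s a. hcomp H (V s) (\<pi> a) = hcomp H (\<pi> (\<alpha> s a)) (V s)) \<and>
     (\<forall>s a. hcomp H (hadjoint H (V s)) (hcomp H (\<pi> a) (V s)) = \<pi> (T s a))"

text \<open>
  \<open>\<sigma>\<close> is a representation \<open>\<pi> \<times> V\<close> of \<open>B\<close>. If \<open>\<pi>\<close> is non-degenerate then so is \<open>\<sigma>\<close>, hence the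
  extension to multipliers is meaningful.
\<close>

definition integrated_form ::
    "'h hilb \<Rightarrow> ('a::cstar_algebra \<Rightarrow> 'b::cstar_algebra) \<Rightarrow> ('s \<Rightarrow> 'b multiplier)
      \<Rightarrow> ('a \<Rightarrow> 'h \<Rightarrow> 'h) \<Rightarrow> ('s \<Rightarrow> 'h \<Rightarrow> 'h) \<Rightarrow> ('b \<Rightarrow> 'h \<Rightarrow> 'h) \<Rightarrow> bool" where
  "integrated_form H i\<^sub>A i\<^sub>S \<pi> V \<sigma> \<longleftrightarrow>
     representation H \<sigma> \<and> \<sigma> \<circ> i\<^sub>A = \<pi> \<and> multiplier_extension H \<sigma> \<circ> i\<^sub>S = V"

text \<open>
  The type argument fixes the type in which the carriers of the Hilbert spaces live, as a
  definition cannot quantify over types. If \<open>\<kappa>\<close> is the cardinality of \<open>('a + 's) list\<close>, then every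
  representation in question is a direct sum of cyclic ones, and a cyclic one acts on a space with
  a dense subset of at most \<open>\<kappa>\<close> elements, that is, on a space with at most \<open>2 ^ \<kappa>\<close> elements.
  So for a type \<open>'h\<close> with at least \<open>2 ^ \<kappa>\<close> elements, as required by \<open>large_universe\<close>, the
  definition is equivalent to the one that refers to all Hilbert spaces whatsoever.
\<close>

definition toeplitz_crossed_product ::
    "'h itself \<Rightarrow> ('s::comm_monoid_add \<Rightarrow> 'a::cstar_algebra \<Rightarrow> 'a) \<Rightarrow> ('s \<Rightarrow> 'a \<Rightarrow> 'a)
      \<Rightarrow> ('a \<Rightarrow> 'b::cstar_algebra) \<Rightarrow> ('s \<Rightarrow> 'b multiplier) \<Rightarrow> bool" where
  "toeplitz_crossed_product _ \<alpha> T i\<^sub>A i\<^sub>S \<longleftrightarrow>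
     nondegenerate_hom i\<^sub>A \<and> multiplier_semigroup_representation i\<^sub>S \<and>
     (\<forall>(H :: 'h hilb) \<sigma>. hilbert_space H \<and> nondegenerate_representation H \<sigma> \<longrightarrow>
        toeplitz_covariant H \<alpha> T (\<sigma> \<circ> i\<^sub>A) (multiplier_extension H \<sigma> \<circ> i\<^sub>S)) \<and>
     (\<forall>(H :: 'h hilb) \<pi> V. hilbert_space H \<and> toeplitz_covariant H \<alpha> T \<pi> V \<longrightarrow>
        (\<exists>\<sigma>. integrated_form H i\<^sub>A i\<^sub>S \<pi> V \<sigma>)) \<and>
     generated_cstar_subalgebra {mult_right (i\<^sub>S s) (i\<^sub>A a) | a s. True} = UNIV"

definition large_universe :: "'a itself \<Rightarrow> 's itself \<Rightarrow> 'h itself \<Rightarrow> bool" where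
  "large_universe _ _ _ \<longleftrightarrow> (\<exists>u :: (('a + 's) list \<Rightarrow> complex) \<Rightarrow> 'h. inj u)"


section \<open>Crossed products\<close>

definition redundancy ::
    "('a::cstar_algebra \<Rightarrow> 'b::cstar_algebra) \<Rightarrow> ('s \<Rightarrow> 'b multiplier) \<Rightarrow> 's \<Rightarrow> 'b \<Rightarrow> 'b \<Rightarrow> bool"
  where
  "redundancy i\<^sub>A i\<^sub>S s a k \<longleftrightarrow>
     a \<in> range i\<^sub>A \<and>
     k \<in> closed_cspan {mult_right (i\<^sub>S s * star (i\<^sub>S s)) (i\<^sub>A b) * i\<^sub>A c | b c. True} \<and>
     (\<forall>b. mult_right (i\<^sub>S s) (a * i\<^sub>A b) = mult_right (i\<^sub>S s) (k * i\<^sub>A b))"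

definition redundancy_ideal ::
    "('s \<Rightarrow> 'a \<Rightarrow> 'a) \<Rightarrow> ('a::cstar_algebra \<Rightarrow> 'b::cstar_algebra) \<Rightarrow> ('s \<Rightarrow> 'b multiplier)
      \<Rightarrow> 'b set" where
  "redundancy_ideal \<alpha> i\<^sub>A i\<^sub>S = generated_closed_ideal
     {a - k | s a k. redundancy i\<^sub>A i\<^sub>S s a k \<and>
        a \<in> closed_cspan {i\<^sub>A (b * \<alpha> s c * d) | b c d. True}}"

record 'x star_algebra =
  sa_carrier :: "'x set"
  sa_add :: "'x \<Rightarrow> 'x \<Rightarrow> 'x"
  sa_scale :: "complex \<Rightarrow> 'x \<Rightarrow> 'x"
  sa_mult :: "'x \<Rightarrow> 'x \<Rightarrow> 'x"
  sa_star :: "'x \<Rightarrow> 'x"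
  sa_norm :: "'x \<Rightarrow> real"

definition coset :: "'b::cstar_algebra set \<Rightarrow> 'b \<Rightarrow> 'b set" where
  "coset I x = (\<lambda>y. x + y) ` I"

definition quotient_algebra :: "'b::cstar_algebra set \<Rightarrow> 'b set star_algebra" where
  "quotient_algebra I = \<lparr>
     sa_carrier = range (coset I),
     sa_add = \<lambda>X Y. \<Union>x\<in>X. \<Union>y\<in>Y. coset I (x + y),
     sa_scale = \<lambda>c X. \<Union>x\<in>X. coset I (c *\<^sub>C x),
     sa_mult = \<lambda>X Y. \<Union>x\<in>X. \<Union>y\<in>Y. coset I (x * y),
     sa_star = \<lambda>X. \<Union>x\<in>X. coset I (star x),
     sa_norm = \<lambda>X. INF x\<in>X. norm x \<rparr>"

definition star_algebra_iso ::
    "'x star_algebra \<Rightarrow> 'y star_algebra \<Rightarrow> ('x \<Rightarrow> 'y) \<Rightarrow> bool" where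
  "star_algebra_iso P Q \<Phi> \<longleftrightarrow>
     bij_betw \<Phi> (sa_carrier P) (sa_carrier Q) \<and>
     (\<forall>X\<in>sa_carrier P. \<forall>Y\<in>sa_carrier P. \<Phi> (sa_add P X Y) = sa_add Q (\<Phi> X) (\<Phi> Y)) \<and>
     (\<forall>c. \<forall>X\<in>sa_carrier P. \<Phi> (sa_scale P c X) = sa_scale Q c (\<Phi> X)) \<and>
     (\<forall>X\<in>sa_carrier P. \<forall>Y\<in>sa_carrier P. \<Phi> (sa_mult P X Y) = sa_mult Q (\<Phi> X) (\<Phi> Y)) \<and>
     (\<forall>X\<in>sa_carrier P. \<Phi> (sa_star P X) = sa_star Q (\<Phi> X)) \<and>
     (\<forall>X\<in>sa_carrier P. sa_norm Q (\<Phi> X) = sa_norm P X)"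

definition crossed_product ::
    "('s \<Rightarrow> 'a \<Rightarrow> 'a) \<Rightarrow> ('a::cstar_algebra \<Rightarrow> 'b::cstar_algebra) \<Rightarrow> ('s \<Rightarrow> 'b multiplier)
      \<Rightarrow> 'b set star_algebra" where
  "crossed_product \<alpha> i\<^sub>A i\<^sub>S = quotient_algebra (redundancy_ideal \<alpha> i\<^sub>A i\<^sub>S)"


section \<open>The two classes of covariant representations\<close>

definition left_pairs ::
    "'h hilb \<Rightarrow> ('s::comm_monoid_add \<Rightarrow> 'a::cstar_algebra \<Rightarrow> 'a) \<Rightarrow> ('s \<Rightarrow> 'a \<Rightarrow> 'a)
      \<Rightarrow> (('a \<Rightarrow> 'h \<Rightarrow> 'h) \<times> ('s \<Rightarrow> 'h \<Rightarrow> 'h)) set" where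
  "left_pairs H \<beta> L = {(\<pi>, V). toeplitz_covariant H L \<beta> \<pi> V \<and>
     (\<forall>s a. hcomp H (V s) (hcomp H (\<pi> a) (hadjoint H (V s))) = \<pi> (L s a))}"

text \<open>Here \<open>W\<close> plays the role of \<open>V\<^sup>*\<close>, so that \<open>V\<^sub>s\<^sup>* V\<^sub>s = W\<^sub>s W\<^sub>s\<^sup>*\<close>.\<close>

definition right_pairs ::
    "'h hilb \<Rightarrow> ('s::comm_monoid_add \<Rightarrow> 'a::cstar_algebra \<Rightarrow> 'a) \<Rightarrow> ('s \<Rightarrow> 'a \<Rightarrow> 'a)
      \<Rightarrow> (('a \<Rightarrow> 'h \<Rightarrow> 'h) \<times> ('s \<Rightarrow> 'h \<Rightarrow> 'h)) set" where
  "right_pairs H \<beta> L = {(\<pi>, W). toeplitz_covariant H \<beta> L \<pi> W \<and>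
     (\<forall>s a. \<pi> a = hcomp H (\<pi> a) (hcomp H (W s) (hadjoint H (W s))))}"

definition adjoint_pair ::
    "'h hilb \<Rightarrow> ('a \<Rightarrow> 'h \<Rightarrow> 'h) \<times> ('s \<Rightarrow> 'h \<Rightarrow> 'h) \<Rightarrow> ('a \<Rightarrow> 'h \<Rightarrow> 'h) \<times> ('s \<Rightarrow> 'h \<Rightarrow> 'h)" where
  "adjoint_pair H = (\<lambda>(\<pi>, V). (\<pi>, \<lambda>s. hadjoint H (V s)))"

end

theory Submission
  imports Defs
begin

text \<open>
  Since \<open>A\<close> is unital, both Toeplitz algebras are unital and the multipliers \<open>i\<^sub>S s\<close> are elements
  \<open>u\<^sub>s\<close>, \<open>v\<^sub>s\<close> of them. Modulo the redundancies, \<open>u\<^sub>s a u\<^sub>s\<^sup>* = L\<^sub>s(a)\<close> and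
  \<open>v\<^sub>s v\<^sub>s\<^sup>* = 1\<close>; conversely these two relations force the respective redundancy ideal into the
  kernel of an integrated form. So a representation of one crossed product gives, by taking
  adjoints on the \<open>S\<close>-part, a representation of the other that takes corresponding values on
  the *-algebra generated by the pairs \<open>(i\<^sub>A(a), j\<^sub>A(a))\<close> and \<open>(u\<^sub>s, v\<^sub>s\<^sup>*)\<close>. The quotient norm of
  an element is attained in some GNS representation, hence this correspondence is isometric and
  extends to the isomorphism. The Gelfand-Naimark theory needed for this is derived without
  spectra: positivity of \<open>k\<close> means \<open>\<parallel>t - k\<parallel> \<le> t\<close> for some \<open>t\<close>, square roots come from the
  iteration \<open>z \<mapsto> (h + z\<^sup>2) / 2\<close>, and a self-adjoint element whose powers grow at most linearly
  has norm at most one.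
\<close>

text \<open>Condition (ii) of a Toeplitz crossed product supplies representations on Hilbert spaces,
  not homomorphisms into another C*-algebra, so a map between the two quotients cannot be read off
  from universality. Nor do the Toeplitz algebras themselves correspond: in one
  \<open>u\<^sub>s\<close> is an isometry, in the other \<open>v\<^sub>s\<close> is only a partial
  isometry with \<open>v\<^sub>s\<^sup>* v\<^sub>s = L\<^sub>s(1)\<close>, and the relations match
  only modulo the redundancies. Hence the construction of a relation between elements instead of a
  map, with norms compared through representations.

  The universal property is moreover available only for Hilbert spaces whose carrier lies in the
  type \<open>'h\<close>. One cyclic GNS representation for each element suffices, and its points
  are named by complex functions on words in the generators; this is where
  \<open>large_universe\<close> enters. The final claim about integrated forms concerns spaces in an
  unrelated type \<open>'k\<close>; there no representation has to be constructed, and continuity is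
  enough.\<close>

lemma star_zero [simp]: "star 0 = (0 :: 'a::cstar_algebra)"
  using star_scaleC[of 0 "0::'a"] by simp

lemma star_minus: "star (- x) = - star (x :: 'a::cstar_algebra)"
  using star_scaleR[of "-1" x] by simp

lemma star_diff: "star (x - y) = star x - star (y :: 'a::cstar_algebra)"
  using star_add[of x "- y"] by (simp add: star_minus)

lemmas star_simps = star_star star_add star_minus star_diff star_mult star_scaleR star_scaleC

lemma tendsto_star: "(f \<longlongrightarrow> l) F \<Longrightarrow> ((\<lambda>x. star (f x)) \<longlongrightarrow> star (l :: 'a::cstar_algebra)) F"
  by (rule bounded_linear.tendsto[OF bounded_linear_star])

lemma scaleC_bounded_linear: "bounded_linear ((*\<^sub>C) c :: 'a \<Rightarrow> 'a::cstar_algebra)"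
proof (rule bounded_linear_intro[where K = "cmod c"])
  fix r and x :: 'a
  have "c *\<^sub>C r *\<^sub>R x = r *\<^sub>R c *\<^sub>C x"
    by (simp add: scaleC_of_real[symmetric] scaleC_scaleC mult.commute)
  then show "c *\<^sub>C r *\<^sub>R x = r *\<^sub>R c *\<^sub>C x" .
qed (simp_all add: scaleC_add_right norm_scaleC)

lemma scaleC_scaleR: "c *\<^sub>C r *\<^sub>R x = r *\<^sub>R c *\<^sub>C (x :: 'a::cstar_algebra)"
  using linear_scale[OF bounded_linear.linear[OF scaleC_bounded_linear]] .

lemma star_mult_self_eq_0: "star x * x = 0 \<longleftrightarrow> x = (0 :: 'a::cstar_algebra)"
  using cstar_identity[of x] by (metis mult_zero_right norm_eq_zero zero_less_power2 less_irrefl)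

lemma norm_star_mult_self: "norm (star x * x) = norm x * norm (x :: 'a::cstar_algebra)"
  by (simp add: cstar_identity power2_eq_square)

lemma scaleR_eq_scaleC: "r *\<^sub>R (x :: 'a::cstar_algebra) = complex_of_real r *\<^sub>C x"
  by (simp add: scaleC_of_real)


section \<open>Positive elements of unital C*-algebras\<close>

text \<open>A fixed point \<open>z\<close> satisfies \<open>z + z - z * z = h\<close>, that is
  \<open>(1 - z)^2 = 1 - h\<close>. Iterating for \<open>z\<close> instead of the root
  \<open>1 - z\<close> requires no unit in the type, and the real sequence for \<open>h = 1\<close>
  can serve as a majorant.\<close>

primrec sqrt_iter :: "'a::real_normed_algebra \<Rightarrow> nat \<Rightarrow> 'a" where
  "sqrt_iter h 0 = 0"
| "sqrt_iter h (Suc n) = (1/2) *\<^sub>R (h + sqrt_iter h n * sqrt_iter h n)"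

text \<open>Monotonicity is \<open>(1 - r)^2 \<ge> 0\<close>, read as
  \<open>r \<le> (1 + r^2) / 2\<close>.\<close>

lemma sqrt_iter_one:
  "0 \<le> sqrt_iter (1::real) n" "sqrt_iter (1::real) n \<le> 1"
  "sqrt_iter (1::real) n \<le> sqrt_iter 1 (Suc n)"
proof -
  show 0: "0 \<le> sqrt_iter (1::real) n"
    by (induction n) (auto simp: field_simps)
  show 1: "sqrt_iter (1::real) n \<le> 1"
  proof (induction n)
    case (Suc n)
    have "0 \<le> sqrt_iter (1::real) n"
      by (induction n) (auto simp: field_simps)
    with Suc show ?case by (simp add: mult_le_one)
  qed simp
  have "0 \<le> (1 - sqrt_iter (1::real) n)\<^sup>2" by simp
  then show "sqrt_iter (1::real) n \<le> sqrt_iter 1 (Suc n)"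
    by (simp add: power2_eq_square algebra_simps)
qed

text \<open>The increments are dominated by those of the bounded monotone sequence obtained for \<open>h = 1\<close>.\<close>

lemma sqrt_iter_bound:
  fixes h :: "'a::real_normed_algebra"
  assumes h: "norm h \<le> 1"
  shows "norm (sqrt_iter h n) \<le> sqrt_iter 1 n"
    and "norm (sqrt_iter h (Suc n) - sqrt_iter h n) \<le> sqrt_iter 1 (Suc n) - sqrt_iter 1 n"
proof -
  have b: "norm (sqrt_iter h n) \<le> sqrt_iter 1 n" for n
  proof (induction n)
    case (Suc n)
    have "norm (h + sqrt_iter h n * sqrt_iter h n)
        \<le> norm h + norm (sqrt_iter h n) * norm (sqrt_iter h n)"
      by (meson add_left_mono norm_mult_ineq norm_triangle_le order_trans)
    also have "\<dots> \<le> 1 + sqrt_iter 1 n * sqrt_iter 1 n"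
      using h Suc by (intro add_mono mult_mono) (auto intro: sqrt_iter_one)
    finally show ?case by simp
  qed simp
  then show "norm (sqrt_iter h n) \<le> sqrt_iter 1 n" .
  show "norm (sqrt_iter h (Suc n) - sqrt_iter h n) \<le> sqrt_iter 1 (Suc n) - sqrt_iter 1 n"
  proof (induction n)
    case 0
    then show ?case using h by simp
  next
    case (Suc n)
    let ?z = "sqrt_iter h" and ?r = "sqrt_iter (1::real)"
    \<comment> \<open>This factorisation of a difference of squares holds without
      commutativity.\<close>
    have "norm (?z (Suc n) * ?z (Suc n) - ?z n * ?z n)
        = norm (?z (Suc n) * (?z (Suc n) - ?z n) + (?z (Suc n) - ?z n) * ?z n)"
      by (simp only: right_diff_distrib left_diff_distrib) simp
    also have "\<dots> \<le> norm (?z (Suc n)) * norm (?z (Suc n) - ?z n)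
        + norm (?z (Suc n) - ?z n) * norm (?z n)"
      by (meson add_mono norm_mult_ineq norm_triangle_le)
    also have "\<dots> \<le> ?r (Suc n) * (?r (Suc n) - ?r n) + (?r (Suc n) - ?r n) * ?r n"
      using Suc b[of n] b[of "Suc n"] sqrt_iter_one[of n] sqrt_iter_one[of "Suc n"]
      by (intro add_mono mult_mono) (simp_all del: sqrt_iter.simps)
    also have "\<dots> = ?r (Suc n) * ?r (Suc n) - ?r n * ?r n"
      by (simp only: algebra_simps)
    finally have *: "norm (?z (Suc n) * ?z (Suc n) - ?z n * ?z n)
        \<le> ?r (Suc n) * ?r (Suc n) - ?r n * ?r n" .
    have "?z (Suc (Suc n)) - ?z (Suc n)
        = (1/2) *\<^sub>R (?z (Suc n) * ?z (Suc n) - ?z n * ?z n)"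
      unfolding sqrt_iter.simps(2)[of h "Suc n"] sqrt_iter.simps(2)[of h n]
      by (simp add: algebra_simps del: sqrt_iter.simps)
    moreover have "?r (Suc (Suc n)) - ?r (Suc n)
        = (1/2) * (?r (Suc n) * ?r (Suc n) - ?r n * ?r n)"
      unfolding sqrt_iter.simps(2)[of "1::real" "Suc n"] sqrt_iter.simps(2)[of "1::real" n]
      by (simp add: algebra_simps del: sqrt_iter.simps)
    ultimately show ?case
      using * by (simp del: sqrt_iter.simps)
  qed
qed

lemma sqrt_iter_convergent:
  fixes h :: "'a::{real_normed_algebra, banach}"
  assumes h: "norm h \<le> 1"
  shows "convergent (sqrt_iter h)"
proof -
  have "convergent (sqrt_iter (1::real))"
    by (rule Bseq_monoseq_convergent)
      (auto simp: monoseq_Suc sqrt_iter_one simp del: sqrt_iter.simps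
        intro!: BseqI'[where K = 1])
  then have "summable (\<lambda>n. sqrt_iter (1::real) (Suc n) - sqrt_iter 1 n)"
    by (metis convergent_def sums_summable telescope_sums)
  then have "summable (\<lambda>n. sqrt_iter h (Suc n) - sqrt_iter h n)"
    by (rule summable_comparison_test[rotated]) (use sqrt_iter_bound(2)[OF h] in blast)
  then show ?thesis
    by (subst (asm) summable_iff_convergent) (simp add: sum_lessThan_telescope del: sqrt_iter.simps(2))
qed

text \<open>All properties pass to the limit from the iterates, which are polynomials in
  \<open>h\<close>. The commutation clause stands in for functional calculus: it makes square roots
  of commuting elements commute. The norm bound will make the root \<open>e - z\<close>
  positive.\<close>

lemma convergent_minus_half_square:
  fixes h :: "'a::cstar_algebra"
  assumes h: "norm h \<le> 1" "star h = h"
  obtains z where "star z = z" "z + z - z * z = h" "\<And>x. x * h = h * x \<Longrightarrow> x * z = z * x"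
    "norm z \<le> 1"
proof -
  let ?z = "sqrt_iter h"
  from sqrt_iter_convergent[OF h(1)] obtain z where z: "?z \<longlonglongrightarrow> z"
    by (auto simp: convergent_def)
  have "star (?z n) = ?z n" for n
    by (induction n) (simp_all add: star_simps h)
  with tendsto_star[OF z] have "?z \<longlonglongrightarrow> star z"
    by simp
  then have "star z = z"
    using z by (rule LIMSEQ_unique)
  moreover have "z + z - z * z = h"
  proof -
    have "(\<lambda>n. ?z (Suc n)) \<longlonglongrightarrow> (1/2) *\<^sub>R (h + z * z)"
      unfolding sqrt_iter.simps by (intro tendsto_intros z)
    with z have "z = (1/2) *\<^sub>R (h + z * z)"
      by (metis LIMSEQ_Suc LIMSEQ_unique)
    then have "2 *\<^sub>R z = 2 *\<^sub>R (1/2) *\<^sub>R (h + z * z)"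
      by (rule arg_cong)
    then have "2 *\<^sub>R z = h + z * z"
      by simp
    then show ?thesis by (simp add: scaleR_2)
  qed
  moreover have "x * z = z * x" if x: "x * h = h * x" for x
  proof -
    have "x * ?z n = ?z n * x" for n
    proof (induction n)
      case (Suc n)
      have "x * (?z n * ?z n) = ?z n * ?z n * x"
        by (metis Suc mult.assoc)
      then show ?case by (simp add: x distrib_left distrib_right)
    qed simp
    then have "(\<lambda>n. x * ?z n) \<longlonglongrightarrow> z * x"
      using tendsto_mult_right[OF z, of x] by simp
    with tendsto_mult_left[OF z, of x] show ?thesis by (rule LIMSEQ_unique)
  qed
  moreover have "norm (?z n) \<le> 1" for n
    using sqrt_iter_bound(1)[OF h(1), of n] sqrt_iter_one(2)[of n] by linarith
  with tendsto_norm[OF z] have "norm z \<le> 1"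
    by (intro LIMSEQ_le_const2) auto
  ultimately show thesis by (rule that)
qed

section \<open>Square roots and the order of a unital C*-algebra\<close>

locale unital_cstar =
  fixes e :: "'b::cstar_algebra"
  assumes unit_left [simp]: "e * x = x" and unit_right [simp]: "x * e = x"
begin

lemma star_unit [simp]: "star e = e"
  by (metis star_mult star_star unit_right)

lemma norm_unit_le: "norm e \<le> 1"
  using cstar_identity[of e] by (cases "norm e = 0") (simp_all add: power2_eq_square)

lemma sqrt_unit_minus:
  assumes "norm h \<le> 1" "star h = h"
  obtains y where "star y = y" "y * y = e - h" "\<And>x. x * h = h * x \<Longrightarrow> x * y = y * x"
    "norm (e - y) \<le> 1"
proof -
  obtain z where z: "star z = z" "z + z - z * z = h" "\<And>x. x * h = h * x \<Longrightarrow> x * z = z * x"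
    "norm z \<le> 1"
    using convergent_minus_half_square[OF assms] by blast
  show thesis
  proof (rule that[of "e - z"])
    show "(e - z) * (e - z) = e - h"
      unfolding z(2)[symmetric] by (simp add: algebra_simps)
  qed (simp_all add: star_simps z algebra_simps)
qed

text \<open>If \<open>h\<^sup>2 + y\<^sup>2 = e\<close> then \<open>h + i y\<close> is unitary.\<close>

lemma norm_le_one_if_squares_sum_unit:
  assumes "star h = h" "star y = y" "h * y = y * h" "h * h + y * y = t *\<^sub>R e" "t \<ge> 0"
  shows "norm h \<le> sqrt t" "norm y \<le> sqrt t"
proof -
  define u where "u = h + \<i> *\<^sub>C y"
  have star_u: "star u = h - \<i> *\<^sub>C y"
    using assms by (simp add: u_def star_simps complex_vector.scale_minus_left)
  have "star u * u = h * h + y * y"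
    using assms unfolding star_u unfolding u_def
    by (simp add: distrib_left distrib_right left_diff_distrib right_diff_distrib mult_scaleC_left mult_scaleC_right
        scaleC_scaleC scaleC_add_right complex_vector.scale_right_diff_distrib
        complex_vector.scale_minus_left)
  then have "(norm u)\<^sup>2 = norm (t *\<^sub>R e)"
    using assms cstar_identity[of u] by simp
  also have "\<dots> \<le> t"
    using assms norm_unit_le by (simp add: mult_left_le)
  finally have nu: "norm u \<le> sqrt t"
    by (simp add: real_le_rsqrt)
  have "h = (1/2) *\<^sub>R (u + star u)"
    unfolding star_u unfolding u_def by (simp add: scaleR_2[symmetric])
  then have "norm h \<le> (1/2) * (norm u + norm (star u))"
    by (metis abs_of_pos half_gt_zero_iff norm_scaleR norm_triangle_ineq mult_left_mono
        less_imp_le zero_less_one)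
  with nu show "norm h \<le> sqrt t" by (simp add: norm_star)
  have "\<i> *\<^sub>C y = (1/2) *\<^sub>R (u - star u)"
    unfolding star_u unfolding u_def by (simp add: scaleR_2[symmetric])
  then have "norm (\<i> *\<^sub>C y) \<le> (1/2) * (norm u + norm (star u))"
    by (metis abs_of_pos half_gt_zero_iff norm_scaleR norm_triangle_ineq4 mult_left_mono
        less_imp_le zero_less_one)
  with nu show "norm y \<le> sqrt t" by (simp add: norm_star norm_scaleC)
qed

text \<open>A spectrum-free description of positivity: the spectrum of \<open>k\<close> lies in the disc of radius
  \<open>t\<close> around \<open>t\<close>.\<close>

definition positive :: "'b \<Rightarrow> bool" where
  "positive k \<longleftrightarrow> star k = k \<and> (\<exists>t. norm (t *\<^sub>R e - k) \<le> t)"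

lemma positive_star: "positive k \<Longrightarrow> star k = k"
  by (simp add: positive_def)

lemma positive_0 [simp]: "positive 0"
  by (auto simp: positive_def intro!: exI[of _ 0])

lemma positive_add:
  assumes "positive k" "positive l" shows "positive (k + l)"
proof -
  obtain t s where "norm (t *\<^sub>R e - k) \<le> t" "norm (s *\<^sub>R e - l) \<le> s"
    using assms by (auto simp: positive_def)
  then have "norm ((t + s) *\<^sub>R e - (k + l)) \<le> t + s"
    using norm_triangle_ineq[of "t *\<^sub>R e - k" "s *\<^sub>R e - l"] by (simp add: algebra_simps)
  with assms show ?thesis by (auto simp: positive_def star_add)
qed

lemma positive_scaleR:
  assumes "positive k" "c \<ge> 0" shows "positive (c *\<^sub>R k)"
proof -
  obtain t where "norm (t *\<^sub>R e - k) \<le> t"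
    using assms by (auto simp: positive_def)
  then have "norm (c *\<^sub>R (t *\<^sub>R e - k)) \<le> c * t"
    using assms by (simp add: mult_left_mono)
  then have "norm ((c * t) *\<^sub>R e - c *\<^sub>R k) \<le> c * t"
    by (simp add: algebra_simps)
  with assms show ?thesis by (auto simp: positive_def star_simps)
qed

text \<open>The root \<open>y\<close> of \<open>e - h * h\<close> commutes with \<open>h\<close>, so
  \<open>h + i y\<close> is unitary, which forces \<open>norm y \<le> 1\<close>. Squaring
  \<open>y\<close> gives the disc condition of radius 1 for \<open>h * h\<close>.\<close>

lemma positive_square_small:
  assumes "star h = h" "norm h \<le> 1"
  shows "norm (e - h * h) \<le> 1"
    and "\<exists>y. star y = y \<and> y * y = e - h * h \<and> h * y = y * h"
proof -
  have "norm (h * h) \<le> 1"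
    using assms by (metis norm_star_mult_self mult_le_one norm_ge_zero)
  moreover have "star (h * h) = h * h" using assms by (simp add: star_mult)
  ultimately obtain y where y: "star y = y" "y * y = e - h * h"
    "\<And>x. x * (h * h) = (h * h) * x \<Longrightarrow> x * y = y * x"
    by (rule sqrt_unit_minus) blast
  then have c: "h * y = y * h" by (simp add: mult.assoc)
  then have "norm y \<le> 1"
    using norm_le_one_if_squares_sum_unit(2)[of h y 1] assms y(1,2) by simp
  then show "norm (e - h * h) \<le> 1"
    unfolding y(2)[symmetric] by (metis norm_mult_ineq mult_le_one norm_ge_zero order_trans)
  show "\<exists>y. star y = y \<and> y * y = e - h * h \<and> h * y = y * h"
    using y c by blast
qed

lemma positive_square:
  assumes "star h = h" shows "positive (h * h)"
proof -
  \<comment> \<open>The summand 1 keeps the divisor positive when \<open>h = 0\<close>.\<close>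
  define c where "c = norm h + 1"
  have c: "c > 0" by (simp add: c_def add_nonneg_pos)
  define g where "g = (1 / c) *\<^sub>R h"
  have "norm g \<le> 1" using c by (simp add: g_def c_def)
  moreover have "star g = g" using assms by (simp add: g_def star_simps)
  ultimately have "norm (e - g * g) \<le> 1"
    by (rule positive_square_small(1)[rotated])
  then have "positive (g * g)"
    unfolding positive_def using \<open>star g = g\<close> by (auto simp: star_simps intro!: exI[of _ 1])
  then have "positive ((c * c) *\<^sub>R (g * g))"
    by (rule positive_scaleR) simp
  moreover have "(c * c) *\<^sub>R (g * g) = h * h"
    using c by (simp add: g_def)
  ultimately show ?thesis by simp
qed

lemma positive_unit: "positive e"
  using positive_square[of e] by simp

lemma positive_unit_add:
  assumes "star h = h" "norm h \<le> t" shows "positive (t *\<^sub>R e + h)" "positive (t *\<^sub>R e - h)"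
  using assms by (auto simp: positive_def star_simps intro!: exI[of _ t])

lemma positive_norm_bound:
  assumes "positive k" obtains t where "t > 0" "norm (e - (1 / t) *\<^sub>R k) \<le> 1"
proof -
  obtain t where t: "norm (t *\<^sub>R e - k) \<le> t" using assms by (auto simp: positive_def)
  have t0: "t \<ge> 0" using t norm_ge_zero order_trans by blast
  \<comment> \<open>The radius \<open>t\<close> may be zero; the larger radius still works because
    \<open>norm e \<le> 1\<close>.\<close>
  define s where "s = t + 1"
  have "norm (s *\<^sub>R e - k) \<le> norm (t *\<^sub>R e - k) + norm e"
    using norm_triangle_ineq[of "t *\<^sub>R e - k" e] by (simp add: s_def algebra_simps)
  then have s: "norm (s *\<^sub>R e - k) \<le> s" using t norm_unit_le by (simp add: s_def)
  have "e - (1 / s) *\<^sub>R k = (1 / s) *\<^sub>R (s *\<^sub>R e - k)"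
    using t0 by (simp add: s_def scaleR_diff_right)
  then have "norm (e - (1 / s) *\<^sub>R k) = norm (s *\<^sub>R e - k) / s"
    using t0 by (simp add: s_def)
  then show thesis using s t0 by (intro that[of s]) (auto simp: s_def)
qed

text \<open>The disc condition puts \<open>h = e - k / t\<close> into the unit ball, and
  \<open>k / t = e - h\<close> then has a root by the iteration. This root lies within distance 1 of
  \<open>e\<close>, hence is positive itself.\<close>

lemma positive_sqrt:
  assumes "positive k"
  obtains y where "star y = y" "y * y = k" "\<And>x. x * k = k * x \<Longrightarrow> x * y = y * x"
    "positive y"
proof -
  obtain t where t: "t > 0" "norm (e - (1 / t) *\<^sub>R k) \<le> 1"
    using positive_norm_bound[OF assms] by blast
  have "star (e - (1 / t) *\<^sub>R k) = e - (1 / t) *\<^sub>R k"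
    using assms by (simp add: star_simps positive_star)
  from t(2) this obtain y where y: "star y = y" "y * y = e - (e - (1 / t) *\<^sub>R k)"
    "\<And>x. x * (e - (1 / t) *\<^sub>R k) = (e - (1 / t) *\<^sub>R k) * x \<Longrightarrow> x * y = y * x"
    "norm (e - y) \<le> 1"
    by (rule sqrt_unit_minus) blast
  show thesis
  proof (rule that[of "sqrt t *\<^sub>R y"])
    show "sqrt t *\<^sub>R y * sqrt t *\<^sub>R y = k" using y(2) t by (simp add: real_sqrt_mult[symmetric])
    show "x * sqrt t *\<^sub>R y = sqrt t *\<^sub>R y * x" if "x * k = k * x" for x
      using y(3)[of x] that by (simp add: algebra_simps)
    have "positive y" using y(1,4) by (auto simp: positive_def intro!: exI[of _ 1])
    then show "positive (sqrt t *\<^sub>R y)" using t by (simp add: positive_scaleR)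
  qed (simp add: star_simps y(1))
qed

text \<open>The square roots commute with each other, so \<open>k * l\<close> is the square of their
  product, which is self-adjoint.\<close>

lemma positive_mult_commute:
  assumes "positive k" "positive l" "k * l = l * k" shows "positive (k * l)"
proof -
  obtain y where y: "star y = y" "y * y = k" "\<And>x. x * k = k * x \<Longrightarrow> x * y = y * x"
    using positive_sqrt[OF assms(1)] by blast
  obtain z where z: "star z = z" "z * z = l" "\<And>x. x * l = l * x \<Longrightarrow> x * z = z * x"
    using positive_sqrt[OF assms(2)] by blast
  have "l * y = y * l" using y(3)[of l] assms(3) by simp
  then have yz: "y * z = z * y" using z(3)[of y] by simp
  have "(y * z) * (y * z) = k * l"
    unfolding y(2)[symmetric] z(2)[symmetric] by (metis yz mult.assoc)
  moreover have "star (y * z) = y * z" by (simp add: star_mult y z yz)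
  ultimately show ?thesis using positive_square[of "y * z"] by simp
qed

text \<open>The roots \<open>h\<close> of \<open>a\<close> and \<open>g\<close> of
  \<open>t *\<^sub>R e - a\<close> commute, and their squares add up to
  \<open>t *\<^sub>R e\<close>. So \<open>h + i g\<close> is a multiple of a unitary, which bounds
  \<open>norm h\<close> by \<open>sqrt t\<close>.\<close>

lemma positive_norm_le:
  assumes "positive a" "positive (t *\<^sub>R e - a)" "t \<ge> 0"
  shows "norm a \<le> t"
proof -
  obtain h where h: "star h = h" "h * h = a" "\<And>x. x * a = a * x \<Longrightarrow> x * h = h * x"
    using positive_sqrt[OF assms(1)] by blast
  obtain g where g: "star g = g" "g * g = t *\<^sub>R e - a"
    "\<And>x. x * (t *\<^sub>R e - a) = (t *\<^sub>R e - a) * x \<Longrightarrow> x * g = g * x"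
    using positive_sqrt[OF assms(2)] by blast
  have "h * (h * h) = (h * h) * h" by (simp add: mult.assoc)
  then have "h * g = g * h" using g(3)[of h] by (simp add: algebra_simps h(2))
  moreover have "h * h + g * g = t *\<^sub>R e" by (simp add: h(2) g(2))
  ultimately have "norm h \<le> sqrt t"
    using norm_le_one_if_squares_sum_unit(1)[of h g t] h(1) g(1) assms by simp
  then have "norm h * norm h \<le> t"
    using assms by (metis mult_mono norm_ge_zero real_sqrt_ge_zero real_sqrt_mult_self abs_of_nonneg)
  then show ?thesis
    using norm_mult_ineq[of h h] h(2) by simp
qed

lemma positive_antisym:
  assumes "positive k" "positive (- k)" shows "k = 0"
  using positive_norm_le[of k 0] assms by simp

section \<open>Powers and the linear growth criterion\<close>

text \<open>The class operation \<open>^\<close> would start from the class constant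
  \<open>1\<close>, while the unit here is the parameter \<open>e\<close>.\<close>

primrec pw :: "'b \<Rightarrow> nat \<Rightarrow> 'b" where
  "pw x 0 = e"
| "pw x (Suc n) = pw x n * x"

lemma pw_add: "pw x (m + n) = pw x m * pw x n"
  by (induction n) (simp_all add: mult.assoc)

lemma pw_commute: "x * y = y * x \<Longrightarrow> pw x n * y = y * pw x n"
  by (induction n) (simp, metis mult.assoc pw.simps(2))

lemma star_pw: "star x = x \<Longrightarrow> star (pw x n) = pw x n"
  by (induction n) (simp_all add: star_mult pw_commute)

lemma norm_pw_le: "norm x \<le> 1 \<Longrightarrow> norm (pw x n) \<le> 1"
proof (induction n)
  case (Suc n)
  then show ?case
    using norm_mult_ineq[of "pw x n" x] mult_le_one[of "norm (pw x n)" "norm x"] by simp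
qed (simp add: norm_unit_le)

lemma norm_pw_double: "star x = x \<Longrightarrow> norm (pw x (n + n)) = norm (pw x n) * norm (pw x n)"
  by (metis pw_add star_pw norm_star_mult_self)

text \<open>For self-adjoint elements the C*-identity makes the norm exactly multiplicative under
  squaring. Along powers of two this replaces the spectral radius formula.\<close>

lemma norm_pw_power2: "star x = x \<Longrightarrow> norm (pw x (2 ^ n)) = norm x ^ (2 ^ n)"
proof (induction n)
  case (Suc n)
  then show ?case
    using norm_pw_double[OF Suc.prems, of "2 ^ n"] by (simp add: mult_2 power_add)
qed simp

text \<open>Telescoping bounds the \<open>n\<close>-th power by \<open>1 + n d\<close>. Along
  \<open>n = 2 ^ k\<close> its norm is exactly \<open>norm x ^ n\<close>, which would outgrow any
  linear bound if \<open>norm x > 1\<close>.\<close>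

lemma norm_le_one_if_linear_growth:
  assumes x: "star x = x" and d: "\<And>n. norm (pw x (Suc n) - pw x n) \<le> d"
  shows "norm x \<le> 1"
proof (rule ccontr)
  assume "\<not> norm x \<le> 1"
  then have r: "norm x > 1" by simp
  have lin: "norm (pw x n) \<le> 1 + real n * d" for n
  proof (induction n)
    case (Suc n)
    then show ?case
      using norm_triangle_ineq[of "pw x (Suc n) - pw x n" "pw x n"] d[of n]
      by (simp add: algebra_simps)
  qed (simp add: norm_unit_le)
  let ?f = "\<lambda>n. (1 + real n * d) / norm x ^ n"
  have "?f \<longlonglongrightarrow> 0"
  proof -
    have "(\<lambda>n. inverse (norm x) ^ n + d * (real n * inverse (norm x) ^ n)) \<longlonglongrightarrow> 0 + d * 0"
      using r by (intro tendsto_intros LIMSEQ_realpow_zero powser_times_n_limit_0)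
        (auto simp: inverse_less_1_iff)
    then show ?thesis
      by (simp add: field_simps power_inverse add_divide_distrib)
  qed
  then have "(\<lambda>k. ?f (2 ^ k)) \<longlonglongrightarrow> 0"
    using LIMSEQ_subseq_LIMSEQ[of ?f 0 "\<lambda>k. 2 ^ k"] by (simp add: strict_mono_def o_def)
  moreover have "?f (2 ^ k) \<ge> 1" for k
    using lin[of "2 ^ k"] norm_pw_power2[OF x, of k] r
    by (subst le_divide_eq_1_pos) (auto intro!: zero_less_power)
  ultimately have "(1::real) \<le> 0"
    by (intro LIMSEQ_le_const[where X = "\<lambda>k. ?f (2 ^ k)"]) auto
  then show False by simp
qed

text \<open>Since \<open>(e - u) ^ n u = (e - (u + v)) ^ n u\<close>, the powers of \<open>e - u\<close> grow at most linearly.\<close>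

lemma positive_orthogonal_summand:
  assumes "star u = u" "positive (u + v)" "v * u = 0"
  shows "positive u"
proof -
  obtain t where t: "t > 0" "norm (e - (1 / t) *\<^sub>R (u + v)) \<le> 1"
    using positive_norm_bound[OF assms(2)] by blast
  define u' where "u' = (1 / t) *\<^sub>R u"
  define g where "g = e - (1 / t) *\<^sub>R (u + v)"
  have gu: "g * u' = (e - u') * u'"
    by (simp add: g_def u'_def algebra_simps assms)
  have pw_eq: "pw (e - u') n * u' = pw g n * u'" for n
  proof (induction n)
    case (Suc n)
    have "(e - u') * u' = u' * (e - u')" by (simp add: algebra_simps)
    then show ?case using Suc gu by (simp add: mult.assoc) (metis mult.assoc)
  qed simp
  have "norm (pw (e - u') (Suc n) - pw (e - u') n) \<le> norm u'" for n
  proof -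
    have "pw (e - u') (Suc n) - pw (e - u') n = - (pw g n * u')"
      by (simp add: right_diff_distrib pw_eq)
    moreover have "norm (pw g n) \<le> 1" using t(2) by (simp add: g_def norm_pw_le)
    ultimately show ?thesis
      using norm_mult_ineq[of "pw g n" u'] mult_right_mono[of "norm (pw g n)" 1 "norm u'"] by simp
  qed
  moreover have su: "star u' = u'" using assms by (simp add: u'_def star_simps)
  ultimately have "norm (e - u') \<le> 1"
    by (intro norm_le_one_if_linear_growth[where d = "norm u'"]) (simp_all add: star_simps)
  then have "positive u'" using su by (auto simp: positive_def intro!: exI[of _ 1])
  then have "positive (t *\<^sub>R u')" using t by (simp add: positive_scaleR)
  then show ?thesis using t by (simp add: u'_def)
qed

text \<open>Here \<open>c\<close> is the absolute value of \<open>a\<close>. From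
  \<open>c * c = a * a\<close> and \<open>a * c = c * a\<close> it follows that \<open>c + a\<close>
  and \<open>c - a\<close> have product zero, so their halves are orthogonal summands of the
  positive element \<open>c\<close>.\<close>

lemma positive_parts:
  assumes "star a = a"
  obtains u v where "positive u" "positive v" "u * v = 0" "a = u - v"
proof -
  obtain c where c: "c * c = a * a" "\<And>x. x * (a * a) = a * a * x \<Longrightarrow> x * c = c * x" "positive c"
    by (rule positive_sqrt[OF positive_square[OF assms]]) blast
  have ac: "a * c = c * a" using c(2)[of a] by (simp add: mult.assoc)
  define u where "u = (1/2) *\<^sub>R (c + a)"
  define v where "v = (1/2) *\<^sub>R (c - a)"
  have uv: "u * v = 0" "v * u = 0"
    by (simp_all add: u_def v_def algebra_simps c(1) ac)
  have "u + v = c" by (simp add: u_def v_def scaleR_right_distrib[symmetric] scaleR_2[symmetric])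
  moreover have "star u = u" "star v = v"
    using assms positive_star[OF c(3)] by (simp_all add: u_def v_def star_simps)
  ultimately have "positive u" "positive v"
    using positive_orthogonal_summand[of u v] positive_orthogonal_summand[of v u] uv c(3)
    by (simp_all add: add.commute)
  moreover have "a = u - v"
    by (simp add: u_def v_def scaleR_diff_right[symmetric] scaleR_2[symmetric])
  ultimately show thesis using uv that by blast
qed

section \<open>Positivity of \<open>star x * x\<close>\<close>

text \<open>This replaces the equality of the nonzero spectra of \<open>star y * y\<close> and
  \<open>y * star y\<close>. After scaling, \<open>g = e + star z * z\<close> has norm at most 1,
  and \<open>f = e + z * star z\<close> satisfies \<open>f * z = z * g\<close>. Consecutive powers
  of \<open>f\<close> therefore differ by \<open>z * pw g n * star z\<close>, which is bounded, and
  the growth criterion gives \<open>norm f \<le> 1\<close>.\<close>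

lemma positive_minus_star_mult_commute:
  assumes "positive (- (star y * y))" shows "positive (- (y * star y))"
proof -
  obtain t where t: "t > 0" "norm (e - (1 / t) *\<^sub>R - (star y * y)) \<le> 1"
    using positive_norm_bound[OF assms] by blast
  define z where "z = (1 / sqrt t) *\<^sub>R y"
  define f where "f = e + z * star z"
  define g where "g = e + star z * z"
  have ng: "norm g \<le> 1"
    using t by (simp add: g_def z_def star_simps real_sqrt_mult[symmetric])
  have pz: "pw f n * z = z * pw g n" for n
  proof (induction n)
    case (Suc n)
    have "f * z = z * g" by (simp add: f_def g_def algebra_simps)
    then show ?case using Suc by (metis mult.assoc pw.simps(2))
  qed simp
  have "norm (pw f (Suc n) - pw f n) \<le> norm z * norm z" for n
  proof -
    have "pw f (Suc n) - pw f n = z * pw g n * star z"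
      using pz[of n] by (simp add: f_def[symmetric] distrib_left mult.assoc[symmetric])
        (simp add: f_def distrib_left mult.assoc[symmetric])
    also have "norm \<dots> \<le> norm z * norm (pw g n) * norm (star z)"
      by (meson mult_right_mono norm_ge_zero norm_mult_ineq order_trans)
    also have "\<dots> \<le> norm z * 1 * norm (star z)"
      using norm_pw_le[OF ng] by (intro mult_right_mono mult_left_mono) auto
    finally show ?thesis by (simp add: norm_star)
  qed
  then have "norm f \<le> 1"
    by (rule norm_le_one_if_linear_growth[rotated]) (simp add: f_def star_simps)
  then have "positive (- (z * star z))"
    by (auto simp: positive_def star_simps f_def intro!: exI[of _ 1])
  then have "positive (t *\<^sub>R - (z * star z))" using t by (intro positive_scaleR) auto
  then show ?thesis using t by (simp add: z_def star_simps real_sqrt_mult[symmetric])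
qed

text \<open>The elements \<open>h\<close> and \<open>k\<close> are, up to factors 2 and -2, the real
  and imaginary parts of \<open>y\<close>, so \<open>y * star y + star y * y\<close> is half of
  \<open>h * h + k * k\<close> and positive. Adding the hypothesis shows that
  \<open>y * star y\<close> is positive; its negative is positive by the preceding lemma.\<close>

lemma positive_minus_star_mult_self:
  assumes "positive (- (star y * y))" shows "y = 0"
proof -
  define h where "h = y + star y"
  define k where "k = \<i> *\<^sub>C (y - star y)"
  have "positive (h * h + k * k)"
    by (intro positive_add positive_square)
      (simp_all add: h_def k_def star_simps complex_vector.scale_minus_left
        complex_vector.scale_right_diff_distrib)
  moreover have "k * k = - ((y - star y) * (y - star y))"
    by (simp add: k_def mult_scaleC_left mult_scaleC_right scaleC_scaleC
        complex_vector.scale_minus_left)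
  then have "h * h + k * k = 2 *\<^sub>R (y * star y + star y * y)"
    by (simp add: h_def algebra_simps scaleR_2)
  ultimately have "positive (2 *\<^sub>R (y * star y + star y * y))" by simp
  then have "positive ((1/2) *\<^sub>R 2 *\<^sub>R (y * star y + star y * y))"
    by (rule positive_scaleR) simp
  then have "positive (y * star y + star y * y)" by simp
  from positive_add[OF this assms] have "positive (y * star y)" by simp
  then have "y * star y = 0"
    using positive_minus_star_mult_commute[OF assms] by (rule positive_antisym)
  then show ?thesis using star_mult_self_eq_0[of "star y"] by (metis star_star star_zero)
qed

text \<open>If \<open>v\<close> is the negative part of \<open>star x * x\<close>, then
  \<open>star (x * v) * (x * v)\<close> equals \<open>- (v * v * v)\<close>, so
  \<open>x * v = 0\<close> by the preceding lemma. Hence the cube of \<open>v\<close> vanishes, and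
  applying the C*-identity to \<open>v * v\<close> and then to \<open>v\<close> gives
  \<open>v = 0\<close>.\<close>

lemma positive_star_mult_self: "positive (star x * x)"
proof -
  obtain u v where uv: "positive u" "positive v" "u * v = 0" "star x * x = u - v"
    using positive_parts[of "star x * x"] by (auto simp: star_simps)
  note sv = positive_star[OF uv(2)]
  have "star (x * v) * (x * v) = v * (star x * x) * v" by (simp add: star_mult sv mult.assoc)
  also have "\<dots> = - (v * v * v)" by (simp add: uv algebra_simps)
  finally have *: "star (x * v) * (x * v) = - (v * v * v)" .
  have "positive (v * v * v)"
    using uv(2) sv by (intro positive_mult_commute positive_square) (simp_all add: mult.assoc)
  then have "x * v = 0"
    using * by (intro positive_minus_star_mult_self) simp
  with * have "v * v * v = 0" by simp
  then have "star (v * v) * (v * v) = 0" by (simp add: star_mult sv mult.assoc[symmetric])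
  then have "v * v = 0" by (simp add: star_mult_self_eq_0 del: mult_eq_0_iff)
  then have "v = 0" using star_mult_self_eq_0[of v] sv by simp
  then show ?thesis using uv by simp
qed

lemma positive_conjugate:
  assumes "positive k" shows "positive (star x * k * x)"
proof -
  obtain y where "star y = y" "y * y = k" using positive_sqrt[OF assms] by blast
  then have "star x * k * x = star (y * x) * (y * x)"
    unfolding \<open>y * y = k\<close>[symmetric] by (simp add: star_mult mult.assoc)
  then show ?thesis using positive_star_mult_self by simp
qed

lemma positive_norm_square: "positive ((norm x * norm x) *\<^sub>R e - star x * x)"
  by (rule positive_unit_add) (simp_all add: star_simps norm_star_mult_self)

lemma norm_square_le_if_positive:
  assumes "positive (t *\<^sub>R e - star x * x)" "t \<ge> 0" shows "norm x * norm x \<le> t"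
  using positive_norm_le[OF positive_star_mult_self assms] by (simp add: norm_star_mult_self)

section \<open>Decay of the elements \<open>w * pw (e - w) n\<close>\<close>

lemma positive_pw:
  assumes "positive x" shows "positive (pw x n)"
proof (induction n)
  case (Suc n)
  then show ?case using assms by (simp add: positive_mult_commute pw_commute)
qed (simp add: positive_unit)

text \<open>For scalars in the unit interval the terms \<open>w (1 - w)^k\<close> decrease in
  \<open>k\<close> and the first \<open>n + 1\<close> of them add up to
  \<open>1 - (1 - w)^(n + 1)\<close>, so \<open>(n + 1) w (1 - w)^n\<close> is at most this sum. The
  induction proves that inequality in the order of the algebra.\<close>

lemma norm_mult_pw_unit_minus_le:
  assumes w: "positive w" "positive (e - w)"
  shows "norm (w * pw (e - w) n) \<le> 1 / (real n + 1)"
proof -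
  let ?D = "\<lambda>n. w * pw (e - w) n"
  have cw: "w * pw (e - w) n = pw (e - w) n * w" for n
    by (rule pw_commute[symmetric]) (simp add: algebra_simps)
  have D: "positive (?D n)" for n
    by (intro positive_mult_commute positive_pw w cw)
  have ww: "positive (w * w)" using positive_square[OF positive_star[OF w(1)]] .
  have DD: "positive (?D n - ?D (Suc n))" for n
  proof -
    have "positive (w * w * pw (e - w) n)"
      by (intro positive_mult_commute positive_pw w ww) (metis cw mult.assoc)
    moreover have "w * w * pw (e - w) n = ?D n - ?D (Suc n)"
      by (simp add: right_diff_distrib mult.assoc cw)
    ultimately show ?thesis by simp
  qed
  have "positive (e - pw (e - w) (Suc n) - (real n + 1) *\<^sub>R ?D n)" for n
  proof (induction n)
    case (Suc n)
    have "positive (e - pw (e - w) (Suc n) - (real n + 1) *\<^sub>R ?D n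
        + (real n + 1) *\<^sub>R (?D n - ?D (Suc n)))"
      by (intro positive_add positive_scaleR DD Suc) simp
    moreover have "pw (e - w) (Suc (Suc n)) = pw (e - w) (Suc n) - ?D (Suc n)"
      by (simp only: pw.simps(2)[of _ "Suc n"] right_diff_distrib cw unit_right)
    moreover have "e - p - (real n + 1) *\<^sub>R c + (real n + 1) *\<^sub>R (c - d)
        = e - (p - d) - (real (Suc n) + 1) *\<^sub>R d" for p c d
      by (simp add: algebra_simps scaleR_2)
    ultimately show ?case by simp
  qed simp
  then have "positive (e - pw (e - w) (Suc n) - (real n + 1) *\<^sub>R ?D n + pw (e - w) (Suc n))"
    by (intro positive_add positive_pw w)
  then have "norm ((real n + 1) *\<^sub>R ?D n) \<le> 1"
    by (intro positive_norm_le positive_scaleR D) simp_all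
  moreover have "norm ((real n + 1) *\<^sub>R ?D n) = \<bar>real n + 1\<bar> * norm (?D n)"
    by (rule norm_scaleR)
  ultimately show ?thesis by (simp add: field_simps)
qed

end

text \<open>A unital *-homomorphism preserves \<open>\<parallel>x\<parallel>\<^sup>2 - x\<^sup>* x \<ge> 0\<close>.\<close>

lemma star_hom_contractive:
  assumes "unital_cstar e" "unital_cstar e'" "star_hom f" "f e = e'"
  shows "norm (f x) \<le> norm x"
proof -
  interpret E: unital_cstar e by fact
  interpret E': unital_cstar e' by fact
  have f: "f (x + y) = f x + f y" "f (c *\<^sub>C x) = c *\<^sub>C f x" "f (x * y) = f x * f y"
    "f (star x) = star (f x)" for x y c
    using assms(3) by (auto simp: star_hom_def)
  obtain y where y: "star y = y" "y * y = (norm x * norm x) *\<^sub>R e - star x * x"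
    using E.positive_sqrt[OF E.positive_norm_square] by metis
  have "f (y * y + star x * x) = f ((norm x * norm x) *\<^sub>R e)" by (simp add: y)
  then have "f y * f y = (norm x * norm x) *\<^sub>R e' - star (f x) * f x"
    by (simp only: scaleR_eq_scaleC f assms(4)) (simp add: algebra_simps)
  moreover have "star (f y) = f y" using f(4)[of y] y by simp
  ultimately have "E'.positive ((norm x * norm x) *\<^sub>R e' - star (f x) * f x)"
    using E'.positive_square by metis
  then have "norm (f x) * norm (f x) \<le> norm x * norm x"
    by (intro E'.norm_square_le_if_positive) auto
  then show ?thesis
    by (metis abs_norm_cancel power2_abs power2_eq_square power2_le_imp_le norm_ge_zero)
qed


section \<open>Closed ideals\<close>

lemma closed_ideal_closed: "closed_ideal N \<Longrightarrow> closed N"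
  and closed_ideal_csubspace: "closed_ideal N \<Longrightarrow> csubspace N"
  by (simp_all add: closed_ideal_def)

lemma closed_ideal_mult:
  "closed_ideal N \<Longrightarrow> x \<in> N \<Longrightarrow> x * y \<in> N" "closed_ideal N \<Longrightarrow> x \<in> N \<Longrightarrow> y * x \<in> N"
  by (auto simp: closed_ideal_def)

lemma closed_ideal_add: "closed_ideal N \<Longrightarrow> x \<in> N \<Longrightarrow> y \<in> N \<Longrightarrow> x + y \<in> N"
  and closed_ideal_minus: "closed_ideal N \<Longrightarrow> x \<in> N \<Longrightarrow> - x \<in> N"
  and closed_ideal_scaleC: "closed_ideal N \<Longrightarrow> x \<in> N \<Longrightarrow> c *\<^sub>C x \<in> N"
  and closed_ideal_scaleR: "closed_ideal N \<Longrightarrow> x \<in> N \<Longrightarrow> r *\<^sub>R x \<in> N"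
  and closed_ideal_0: "closed_ideal N \<Longrightarrow> 0 \<in> N"
  by (auto simp: closed_ideal_def complex_vector.subspace_add
      complex_vector.subspace_neg complex_vector.subspace_scale scaleR_eq_scaleC
      complex_vector.subspace_0)

context unital_cstar
begin

text \<open>The polynomial \<open>1 - (1 - w)^n\<close> has no constant term.\<close>

lemma unit_minus_pw_in_ideal:
  assumes N: "closed_ideal N" and w: "w \<in> N"
  shows "e - pw (e - w) n \<in> N"
proof (induction n)
  case (Suc n)
  have "e - pw (e - w) (Suc n) = e - pw (e - w) n + pw (e - w) n * w"
    by (simp add: right_diff_distrib)
  then show ?case
    using closed_ideal_add[OF N Suc closed_ideal_mult(2)[OF N w]] by (simp only:)
qed (simp add: closed_ideal_0[OF N])

text \<open>The elements \<open>e - (e - y\<^sup>* y) ^ n\<close> act as an approximate unit for \<open>y\<close>.\<close>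

lemma norm_mult_pw_unit_minus_star_mult_self:
  assumes "norm y \<le> 1"
  shows "norm (y * pw (e - star y * y) n) \<le> sqrt (1 / (real n + 1))"
    and "norm (pw (e - star y * y) n) \<le> 1"
    and "star (pw (e - star y * y) n) = pw (e - star y * y) n"
proof -
  let ?w = "star y * y"
  let ?g = "pw (e - ?w) n"
  show sg: "star ?g = ?g" by (simp add: star_pw star_simps)
  have n1: "norm ?w \<le> 1" using assms by (simp add: norm_star_mult_self mult_le_one)
  then have pos: "positive (1 *\<^sub>R e - ?w)"
    by (intro positive_unit_add) (simp_all add: star_simps)
  moreover have "positive (1 *\<^sub>R e - (1 *\<^sub>R e - ?w))" by (simp add: positive_star_mult_self)
  ultimately have "norm (1 *\<^sub>R e - ?w) \<le> 1" by (rule positive_norm_le) simp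
  then show ng: "norm ?g \<le> 1" by (simp add: norm_pw_le)
  have "norm (y * ?g) * norm (y * ?g) = norm (?g * (?w * ?g))"
    unfolding norm_star_mult_self[symmetric] by (simp add: star_mult sg mult.assoc)
  also have "\<dots> \<le> norm ?g * norm (?w * ?g)" by (rule norm_mult_ineq)
  also have "\<dots> \<le> 1 * (1 / (real n + 1))"
    using ng pos
    by (intro mult_mono norm_mult_pw_unit_minus_le) (simp_all add: positive_star_mult_self)
  finally show "norm (y * ?g) \<le> sqrt (1 / (real n + 1))"
    by (intro real_le_rsqrt) (simp add: power2_eq_square)
qed

lemma tendsto_mult_pw_unit_minus_star_mult_self:
  assumes "norm y \<le> 1"
  shows "(\<lambda>n. y * pw (e - star y * y) n) \<longlonglongrightarrow> 0"
proof (rule Lim_null_comparison)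
  show "\<forall>\<^sub>F n in sequentially. norm (y * pw (e - star y * y) n) \<le> sqrt (1 / (real n + 1))"
    using norm_mult_pw_unit_minus_star_mult_self(1)[OF assms] by simp
  have "(\<lambda>n. 1 / (real n + 1)) \<longlonglongrightarrow> 0"
    using LIMSEQ_inverse_real_of_nat by (simp add: inverse_eq_divide add.commute)
  then show "(\<lambda>n. sqrt (1 / (real n + 1))) \<longlonglongrightarrow> 0"
    using tendsto_real_sqrt by fastforce
qed

text \<open>With \<open>g\<close> the \<open>n\<close>-th power of \<open>e - star y * y\<close>,
  the adjoint of \<open>y * g\<close> is \<open>g * star y\<close> and tends to 0. So
  \<open>star y\<close> is the limit of \<open>(e - g) * star y\<close>, and \<open>e - g\<close>
  lies in \<open>N\<close> because \<open>star y * y\<close> does.\<close>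

lemma closed_ideal_star:
  fixes N :: "'b set"
  assumes N: "closed_ideal N" and x: "x \<in> N" shows "star x \<in> N"
proof -
  define y where "y = (1 / (norm x + 1)) *\<^sub>R x"
  have c: "norm x + 1 > 0" by (simp add: add_nonneg_pos)
  have y: "y \<in> N" "norm y \<le> 1"
    using c x by (simp_all add: y_def closed_ideal_scaleR[OF N])
  let ?g = "\<lambda>n. pw (e - star y * y) n"
  have "(\<lambda>n. star (y * ?g n)) \<longlonglongrightarrow> star 0"
    by (intro tendsto_star tendsto_mult_pw_unit_minus_star_mult_self y)
  then have "(\<lambda>n. star y - ?g n * star y) \<longlonglongrightarrow> star y - 0"
    by (intro tendsto_intros)
      (simp add: star_mult norm_mult_pw_unit_minus_star_mult_self(3)[OF y(2)])
  moreover have "star y - ?g n * star y \<in> N" for n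
  proof -
    have "e - ?g n \<in> N" by (intro unit_minus_pw_in_ideal N closed_ideal_mult y)
    then have "(e - ?g n) * star y \<in> N" by (rule closed_ideal_mult[OF N])
    then show ?thesis by (simp add: left_diff_distrib)
  qed
  ultimately have "star y \<in> N"
    using closed_sequentially[OF closed_ideal_closed[OF N]] by fastforce
  then have "(norm x + 1) *\<^sub>R star y \<in> N" by (rule closed_ideal_scaleR[OF N])
  then show ?thesis using c by (simp add: y_def star_simps)
qed

text \<open>An order bound modulo the ideal becomes a norm bound for a suitable representative. With
  \<open>g\<close> from the approximate unit for \<open>k\<close>, the element \<open>x * g\<close>
  differs from \<open>x\<close> by a member of the ideal, and conjugating the hypothesis by
  \<open>g\<close> replaces \<open>k\<close> by \<open>g * k * g\<close>, whose norm is at most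
  \<open>\<epsilon>\<close>.\<close>

lemma ideal_order_bound:
  assumes N: "closed_ideal N" and k: "k \<in> N" "star k = k"
    and pos: "positive (t *\<^sub>R e - star x * x - k)" and t: "t \<ge> 0" and \<epsilon>: "\<epsilon> > 0"
  shows "\<exists>i\<in>N. norm (x + i) * norm (x + i) \<le> t + \<epsilon>"
proof -
  define c where "c = norm k + 1"
  have c: "c > 0" by (simp add: c_def add_nonneg_pos)
  define y where "y = (1 / c) *\<^sub>R k"
  have y: "y \<in> N" "norm y \<le> 1" and ky: "k = c *\<^sub>R y"
    using c k by (simp_all add: y_def closed_ideal_scaleR[OF N] c_def)
  let ?g = "\<lambda>n. pw (e - star y * y) n"
  have "(\<lambda>n. norm (c *\<^sub>R (y * ?g n))) \<longlonglongrightarrow> norm (c *\<^sub>R (0::'b))"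
    by (intro tendsto_intros tendsto_mult_pw_unit_minus_star_mult_self y)
  then have "\<forall>\<^sub>F n in sequentially. norm (c *\<^sub>R (y * ?g n)) < \<epsilon>"
    using \<epsilon> by (auto dest: order_tendstoD)
  then obtain n where n: "norm (c *\<^sub>R (y * ?g n)) < \<epsilon>"
    by (auto simp: eventually_sequentially)
  let ?g = "?g n"
  note g = norm_mult_pw_unit_minus_star_mult_self[OF y(2), of n]
  have "norm (?g * k * ?g) \<le> norm ?g * norm (k * ?g)"
    using norm_mult_ineq[of ?g "k * ?g"] by (simp add: mult.assoc)
  also have "\<dots> \<le> 1 * \<epsilon>" using g n by (intro mult_mono) (simp_all add: ky)
  finally have "positive (\<epsilon> *\<^sub>R e + ?g * k * ?g)"
    by (intro positive_unit_add) (simp_all add: star_mult g k mult.assoc)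
  moreover have "positive (t *\<^sub>R (e - ?g * ?g))"
  proof (rule positive_scaleR[OF _ t])
    have "norm (?g * ?g) \<le> 1"
      using norm_mult_ineq[of ?g ?g] mult_le_one[OF g(2) norm_ge_zero g(2)] by linarith
    then have "positive (1 *\<^sub>R e - ?g * ?g)"
      using g by (intro positive_unit_add) (simp_all add: star_mult)
    then show "positive (e - ?g * ?g)" by simp
  qed
  moreover have "positive (star ?g * (t *\<^sub>R e - star x * x - k) * ?g)"
    by (rule positive_conjugate[OF pos])
  ultimately have "positive (\<epsilon> *\<^sub>R e + ?g * k * ?g + t *\<^sub>R (e - ?g * ?g)
      + star ?g * (t *\<^sub>R e - star x * x - k) * ?g)"
    by (rule positive_add[OF positive_add])
  also have "\<epsilon> *\<^sub>R e + ?g * k * ?g + t *\<^sub>R (e - ?g * ?g)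
      + star ?g * (t *\<^sub>R e - star x * x - k) * ?g = (t + \<epsilon>) *\<^sub>R e - star (x * ?g) * (x * ?g)"
    by (simp add: star_mult g(3) algebra_simps)
  finally have "norm (x * ?g) * norm (x * ?g) \<le> t + \<epsilon>"
    using t \<epsilon> by (intro norm_square_le_if_positive) auto
  moreover have "- (x * (e - ?g)) \<in> N"
    by (intro closed_ideal_minus N closed_ideal_mult unit_minus_pw_in_ideal y)
  ultimately show ?thesis
    by (intro bexI[of _ "- (x * (e - ?g))"]) (simp_all add: algebra_simps)
qed

end


section \<open>Sublinear functionals and states\<close>

definition sublinear :: "('v::real_vector \<Rightarrow> real) \<Rightarrow> bool" where
  "sublinear p \<longleftrightarrow> (\<forall>x y. p (x + y) \<le> p x + p y) \<and> (\<forall>c x. c > 0 \<longrightarrow> p (c *\<^sub>R x) = c * p x)"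

lemma sublinear_add: "sublinear p \<Longrightarrow> p (x + y) \<le> p x + p y"
  and sublinear_scaleR: "sublinear p \<Longrightarrow> c > 0 \<Longrightarrow> p (c *\<^sub>R x) = c * p x"
  by (auto simp: sublinear_def)

lemma sublinear_0: "sublinear p \<Longrightarrow> p 0 = 0"
  using sublinear_scaleR[of p 2 0] by simp

lemma sublinear_minus: "sublinear p \<Longrightarrow> - p (- x) \<le> p x"
  using sublinear_add[of p x "- x"] sublinear_0[of p] by simp

lemma sublinearI:
  assumes "\<And>x y. p (x + y) \<le> p x + p y" and le: "\<And>c x. c > 0 \<Longrightarrow> p (c *\<^sub>R x) \<le> c * p x"
  shows "sublinear p"
  unfolding sublinear_def
proof (intro conjI allI impI)
  fix c :: real and x assume c: "c > 0"
  have "p x = p ((1 / c) *\<^sub>R c *\<^sub>R x)" using c by simp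
  also have "\<dots> \<le> (1 / c) * p (c *\<^sub>R x)" using c by (intro le) simp
  finally show "p (c *\<^sub>R x) = c * p x"
    using le[OF c, of x] c by (simp add: field_simps)
qed fact

text \<open>For sublinear \<open>q\<close> this is the largest sublinear functional below
  \<open>q\<close> whose value at \<open>- a\<close> is at most \<open>- q a\<close>. A linear
  functional below it therefore takes the value \<open>q a\<close> at \<open>a\<close>.\<close>

definition sublinear_shift :: "('v::real_vector \<Rightarrow> real) \<Rightarrow> 'v \<Rightarrow> 'v \<Rightarrow> real" where
  "sublinear_shift q a x = (INF t\<in>{0..}. q (x + t *\<^sub>R a) - t * q a)"

lemma sublinear_shift_le:
  assumes q: "sublinear q" and "t \<ge> 0"
  shows "sublinear_shift q a x \<le> q (x + t *\<^sub>R a) - t * q a"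
  unfolding sublinear_shift_def
proof (rule cINF_lower)
  show "bdd_below ((\<lambda>t. q (x + t *\<^sub>R a) - t * q a) ` {0..})"
  proof (rule bdd_belowI2)
    fix t :: real assume "t \<in> {0..}"
    then have "q (t *\<^sub>R a) = t * q a"
      using q by (cases "t = 0") (auto simp: sublinear_0 sublinear_scaleR)
    then show "- q (- x) \<le> q (x + t *\<^sub>R a) - t * q a"
      using sublinear_add[OF q, of "x + t *\<^sub>R a" "- x"] by simp
  qed
qed (use assms in auto)

lemma sublinear_shift_sublinear:
  assumes q: "sublinear q" shows "sublinear (sublinear_shift q a)"
proof (rule sublinearI)
  fix x y
  have *: "sublinear_shift q a (x + y) \<le> (q (x + t *\<^sub>R a) - t * q a) + (q (y + s *\<^sub>R a) - s * q a)"
    if "t \<ge> 0" "s \<ge> 0" for s t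
  proof -
    have "q (x + y + (t + s) *\<^sub>R a) \<le> q (x + t *\<^sub>R a) + q (y + s *\<^sub>R a)"
      using sublinear_add[OF q, of "x + t *\<^sub>R a" "y + s *\<^sub>R a"] by (simp add: algebra_simps)
    then show ?thesis
      using sublinear_shift_le[OF q, of "t + s" a "x + y"] that by (simp add: algebra_simps)
  qed
  have "sublinear_shift q a (x + y) - (q (y + s *\<^sub>R a) - s * q a) \<le> sublinear_shift q a x"
    if "s \<ge> 0" for s
    unfolding sublinear_shift_def[of q a x]
    using *[OF _ that] by (intro cINF_greatest) (auto simp: algebra_simps)
  then have "sublinear_shift q a (x + y) - sublinear_shift q a x \<le> q (y + s *\<^sub>R a) - s * q a"
    if "s \<ge> 0" for s using that by (simp add: algebra_simps)
  then have "sublinear_shift q a (x + y) - sublinear_shift q a x \<le> sublinear_shift q a y"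
    unfolding sublinear_shift_def[of q a y] by (intro cINF_greatest) auto
  then show "sublinear_shift q a (x + y) \<le> sublinear_shift q a x + sublinear_shift q a y"
    by simp
next
  fix c :: real and x assume c: "c > 0"
  have "sublinear_shift q a (c *\<^sub>R x) / c \<le> q (x + t *\<^sub>R a) - t * q a" if "t \<ge> 0" for t
  proof -
    have "sublinear_shift q a (c *\<^sub>R x) \<le> q (c *\<^sub>R x + (c * t) *\<^sub>R a) - (c * t) * q a"
      using c that by (intro sublinear_shift_le[OF q]) simp
    also have "q (c *\<^sub>R x + (c * t) *\<^sub>R a) = c * q (x + t *\<^sub>R a)"
      using sublinear_scaleR[OF q c, of "x + t *\<^sub>R a"] by (simp add: algebra_simps)
    finally show ?thesis using c by (simp add: field_simps)
  qed
  then have "sublinear_shift q a (c *\<^sub>R x) / c \<le> sublinear_shift q a x"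
    unfolding sublinear_shift_def[of q a x] by (intro cINF_greatest) auto
  then show "sublinear_shift q a (c *\<^sub>R x) \<le> c * sublinear_shift q a x"
    using c by (simp add: field_simps)
qed

text \<open>Minimality forces \<open>sublinear_shift q a = q\<close>, and the parameter value 1 in
  the infimum then gives superadditivity.\<close>

lemma minimal_sublinear_linear:
  assumes q: "sublinear q" and min: "\<And>r. sublinear r \<Longrightarrow> (\<And>x. r x \<le> q x) \<Longrightarrow> r = q"
  shows "linear q"
proof -
  have add: "q (x + a) = q x + q a" for x a
  proof -
    have "sublinear_shift q a = q"
      using sublinear_shift_le[OF q, of 0 a] by (intro min sublinear_shift_sublinear q) simp
    with sublinear_shift_le[OF q, of 1 a x] have "q x \<le> q (x + a) - q a" by simp
    with sublinear_add[OF q, of x a] show ?thesis by simp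
  qed
  have neg: "q (- x) = - q x" for x using add[of x "- x"] sublinear_0[OF q] by simp
  have "q (c *\<^sub>R x) = c * q x" for c x
  proof -
    consider "c > 0" | "c = 0" | "- c > 0" by linarith
    then show ?thesis
    proof cases
      case 3
      from sublinear_scaleR[OF q this, of x] show ?thesis by (simp add: neg)
    qed (simp_all add: sublinear_scaleR[OF q] sublinear_0[OF q])
  qed
  with add show ?thesis by (intro linearI) simp_all
qed

lemma exists_minimal_sublinear:
  fixes p :: "'v::real_vector \<Rightarrow> real"
  assumes p: "sublinear p"
  shows "\<exists>q. sublinear q \<and> (\<forall>x. q x \<le> p x) \<and>
    (\<forall>r. sublinear r \<longrightarrow> (\<forall>x. r x \<le> q x) \<longrightarrow> r = q)"
proof -
  define A where "A = {q. sublinear q \<and> (\<forall>x. q x \<le> p x)}"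
  \<comment> \<open>The order is reversed, so that the maximal element given by Zorn's lemma is a
    minimal functional.\<close>
  define le where "le = (\<lambda>q r :: 'v \<Rightarrow> real. \<forall>x. r x \<le> q x)"
  have "\<exists>m\<in>A. \<forall>a\<in>A. le m a \<longrightarrow> a = m"
  proof (rule predicate_Zorn)
    show "partial_order_on A (relation_of le A)"
      by (rule partial_order_on_relation_ofI) (auto simp: le_def intro: order_trans antisym intro!: ext)
    fix C assume C: "C \<in> Chains (relation_of le A)"
    then have CA: "C \<subseteq> A" by (auto simp: Chains_def relation_of_def)
    have chain: "le q r \<or> le r q" if "q \<in> C" "r \<in> C" for q r
      using C that by (auto simp: Chains_def relation_of_def)
    show "\<exists>u\<in>A. \<forall>a\<in>C. le a u"
    proof (cases "C = {}")
      case True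
      then show ?thesis using p by (auto simp: A_def)
    next
      case False
      define u where "u = (\<lambda>x. INF q\<in>C. q x)"
      have low: "u x \<le> q x" if "q \<in> C" for q x
        unfolding u_def
      proof (rule cINF_lower[OF _ that])
        \<comment> \<open>This bound is common to all members of \<open>A\<close>, so the pointwise
          infimum of the chain is finite.\<close>
        have "- p (- x) \<le> q x" if "q \<in> C" for q
        proof -
          have "sublinear q" "q (- x) \<le> p (- x)" using CA that by (auto simp: A_def)
          with sublinear_minus[of q x] show ?thesis by linarith
        qed
        then show "bdd_below ((\<lambda>q. q x) ` C)" by (rule bdd_belowI2)
      qed
      have great: "m \<le> u x" if "\<And>q. q \<in> C \<Longrightarrow> m \<le> q x" for m x
        unfolding u_def using False that by (rule cINF_greatest)
      have "sublinear u"
      proof (rule sublinearI)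
        fix x y
        \<comment> \<open>The two functionals may differ; the smaller one, which exists in a chain,
          can be used at both points.\<close>
        have *: "u (x + y) \<le> q x + r y" if qr: "q \<in> C" "r \<in> C" for q r
        proof -
          have "u (x + y) \<le> s x + s y" if "s \<in> C" for s
            using CA that low[OF that, of "x + y"] sublinear_add[of s x y] by (force simp: A_def)
          from this[OF qr(1)] this[OF qr(2)] chain[OF qr] show ?thesis
            unfolding le_def by (meson add_left_mono add_right_mono order_trans)
        qed
        have "u (x + y) - r y \<le> u x" if "r \<in> C" for r
          using *[OF _ that] by (intro great) (simp add: algebra_simps)
        then have "u (x + y) - u x \<le> u y"
          by (intro great) (simp add: algebra_simps)
        then show "u (x + y) \<le> u x + u y" by simp
      next
        fix c :: real and x assume c: "c > 0"
        have "u (c *\<^sub>R x) / c \<le> u x"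
        proof (rule great)
          fix q assume "q \<in> C"
          with CA low[OF this, of "c *\<^sub>R x"] c show "u (c *\<^sub>R x) / c \<le> q x"
            by (auto simp: A_def sublinear_scaleR field_simps)
        qed
        then show "u (c *\<^sub>R x) \<le> c * u x" using c by (simp add: field_simps)
      qed
      moreover have "u x \<le> p x" for x
        using False CA low[of _ x] by (force simp: A_def intro: order_trans)
      ultimately have "u \<in> A" by (simp add: A_def)
      then show ?thesis using low by (auto simp: le_def)
    qed
  qed
  then obtain m where m: "m \<in> A" "\<And>a. a \<in> A \<Longrightarrow> le m a \<Longrightarrow> a = m" by blast
  show ?thesis
  proof (intro exI[of _ m] conjI allI impI)
    fix r assume r: "sublinear r" "\<forall>x. r x \<le> m x"
    then have "r \<in> A" using m(1) by (force simp: A_def intro: order_trans)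
    then show "r = m" using m(2) r by (simp add: le_def)
  qed (use m(1) in \<open>auto simp: A_def\<close>)
qed

text \<open>A form of the Hahn-Banach theorem without extension from subspaces: the linear
  functional is a minimal sublinear one below the shifted \<open>p\<close>, and the shift enforces
  equality at \<open>a\<close>.\<close>

theorem dominated_linear_functional:
  assumes p: "sublinear p"
  obtains f where "linear f" "\<And>x. f x \<le> p x" "f a = p a"
proof -
  obtain f where f: "sublinear f" "\<And>x. f x \<le> sublinear_shift p a x"
    "\<And>r. sublinear r \<Longrightarrow> (\<And>x. r x \<le> f x) \<Longrightarrow> r = f"
    using exists_minimal_sublinear[OF sublinear_shift_sublinear[OF p, of a]] by blast
  have lin: "linear f" by (rule minimal_sublinear_linear[OF f(1)]) (rule f(3))
  have le: "f x \<le> p x" for x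
    using f(2)[of x] sublinear_shift_le[OF p, of 0 a x] by simp
  have "f (- a) \<le> - p a"
    using f(2)[of "- a"] sublinear_shift_le[OF p, of 1 a "- a"] sublinear_0[OF p] by simp
  then have "f a = p a" using le[of a] linear_neg[OF lin, of a] by simp
  with lin le show thesis by (rule that)
qed

section \<open>The quotient seminorm of a closed ideal\<close>

definition ideal_norm :: "'b::cstar_algebra set \<Rightarrow> 'b \<Rightarrow> real" where
  "ideal_norm N x = (INF i\<in>N. norm (x + i))"

lemma bdd_below_norm_image: "bdd_below ((\<lambda>i. norm (x + i)) ` N)"
  by (rule bdd_belowI2[of _ 0]) simp

lemma ideal_norm_le: "i \<in> N \<Longrightarrow> ideal_norm N x \<le> norm (x + i)"
  unfolding ideal_norm_def by (rule cINF_lower[OF bdd_below_norm_image])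

lemma ideal_norm_nonneg: "N \<noteq> {} \<Longrightarrow> 0 \<le> ideal_norm N x"
  unfolding ideal_norm_def by (rule cINF_greatest) simp_all

lemma ideal_norm_approx:
  assumes "N \<noteq> {}" "ideal_norm N x < r" obtains i where "i \<in> N" "norm (x + i) < r"
  using assms cINF_less_iff[OF _ bdd_below_norm_image] unfolding ideal_norm_def by blast

lemma ideal_norm_zero_imp:
  assumes N: "closed_ideal N" and "ideal_norm N x = 0" shows "x \<in> N"
proof -
  have "\<exists>y\<in>N. dist y x < \<epsilon>" if "\<epsilon> > 0" for \<epsilon>
  proof -
    from assms that closed_ideal_0[OF N] obtain i where i: "i \<in> N" "norm (x + i) < \<epsilon>"
      by (metis ideal_norm_approx empty_iff)
    then show ?thesis
      by (intro bexI[of _ "- i"])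
        (simp_all add: dist_norm closed_ideal_minus[OF N] norm_minus_commute add.commute)
  qed
  then have "x \<in> closure N" by (simp add: closure_approachable)
  then show ?thesis using closed_ideal_closed[OF N] by simp
qed

section \<open>Positive functionals that attain the quotient norm\<close>

context unital_cstar
begin

text \<open>The order-unit seminorm of the quotient by \<open>N\<close>; \<open>re\<close> extends it from the self-adjoint
  elements to all of \<open>B\<close>.\<close>

definition re :: "'b \<Rightarrow> 'b" where
  "re y = (1/2) *\<^sub>R (y + star y)"

definition upper_bounds :: "'b set \<Rightarrow> 'b \<Rightarrow> real set" where
  "upper_bounds N y = {t. \<exists>k\<in>N. star k = k \<and> positive (t *\<^sub>R e - re y - k)}"

lemma re_simps: "re (x + y) = re x + re y" "re (c *\<^sub>R x) = c *\<^sub>R re x" "star (re x) = re x"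
  "norm (re x) \<le> norm x"
proof -
  show "norm (re x) \<le> norm x"
    using norm_triangle_ineq[of x "star x"] by (simp add: re_def norm_star)
qed (simp_all add: re_def star_simps algebra_simps)

lemma re_self_adjoint: "star x = x \<Longrightarrow> re x = x"
  by (simp add: re_def scaleR_2[symmetric])

lemma zero_in_upper_bounds:
  assumes "k \<in> N" "star k = k" "positive (- re y - k)" shows "0 \<in> upper_bounds N y"
  using assms by (auto simp: upper_bounds_def)

lemma norm_in_upper_bounds:
  assumes "closed_ideal N" shows "norm y \<in> upper_bounds N y"
  using closed_ideal_0[OF assms] positive_unit_add(2)[of "re y" "norm y"]
  by (auto simp: upper_bounds_def re_simps intro!: bexI[of _ 0])

text \<open>This keeps the infimum of the upper bounds finite. If \<open>s < 0\<close>, the multiple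
  \<open>x = sqrt (- s) *\<^sub>R e\<close> satisfies the hypothesis of
  \<open>ideal_order_bound\<close> with \<open>t = 0\<close>, so its quotient norm vanishes and the
  unit would lie in \<open>N\<close>.\<close>

lemma positive_modulo_ideal_nonneg:
  assumes N: "closed_ideal N" "N \<noteq> UNIV" and k: "k \<in> N" "star k = k" and pos: "positive (s *\<^sub>R e - k)"
  shows "s \<ge> 0"
proof (rule ccontr)
  assume "\<not> s \<ge> 0"
  then have s: "s < 0" by simp
  define x where "x = sqrt (- s) *\<^sub>R e"
  have "star x * x = (- s) *\<^sub>R e"
    using s by (simp add: x_def star_simps real_sqrt_mult[symmetric])
  then have pos': "positive (0 *\<^sub>R e - star x * x - k)" using pos by simp
  have "ideal_norm N x \<le> \<epsilon>" if \<epsilon>: "\<epsilon> > 0" for \<epsilon>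
  proof -
    obtain i where i: "i \<in> N" "norm (x + i) * norm (x + i) \<le> 0 + \<epsilon> * \<epsilon>"
      using ideal_order_bound[OF N(1) k pos', of "\<epsilon> * \<epsilon>"] \<epsilon> by auto
    then have "(norm (x + i))\<^sup>2 \<le> \<epsilon>\<^sup>2" by (simp only: power2_eq_square add_0)
    then have "norm (x + i) \<le> \<epsilon>" by (rule power2_le_imp_le) (use \<epsilon> in simp)
    with ideal_norm_le[OF i(1), of x] show ?thesis by simp
  qed
  then have "ideal_norm N x \<le> 0" by (rule field_le_epsilon[where y = 0, simplified])
  then have "x \<in> N"
    using ideal_norm_nonneg[of N x] closed_ideal_0[OF N(1)]
    by (intro ideal_norm_zero_imp[OF N(1)]) force
  then have "(1 / sqrt (- s)) *\<^sub>R x \<in> N" by (rule closed_ideal_scaleR[OF N(1)])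
  then have "e \<in> N" using s by (simp add: x_def)
  then have "N = UNIV" using closed_ideal_mult(1)[OF N(1), of e] by auto
  with N show False by simp
qed

lemma upper_bounds_ge:
  assumes N: "closed_ideal N" "N \<noteq> UNIV" and t: "t \<in> upper_bounds N y"
  shows "- norm y \<le> t"
proof -
  obtain k where k: "k \<in> N" "star k = k" "positive (t *\<^sub>R e - re y - k)"
    using t by (auto simp: upper_bounds_def)
  have "positive (norm y *\<^sub>R e + re y)" by (rule positive_unit_add) (simp_all add: re_simps)
  from positive_add[OF this k(3)] have "positive ((t + norm y) *\<^sub>R e - k)"
    by (simp add: algebra_simps)
  then have "t + norm y \<ge> 0" by (rule positive_modulo_ideal_nonneg[OF N k(1,2)])
  then show ?thesis by simp
qed

lemma upper_bounds_add:
  assumes N: "closed_ideal N" and "s \<in> upper_bounds N x" "t \<in> upper_bounds N y"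
  shows "s + t \<in> upper_bounds N (x + y)"
proof -
  obtain k l where kl: "k \<in> N" "star k = k" "positive (s *\<^sub>R e - re x - k)"
    "l \<in> N" "star l = l" "positive (t *\<^sub>R e - re y - l)"
    using assms(2,3) by (auto simp: upper_bounds_def)
  have "positive ((s + t) *\<^sub>R e - re (x + y) - (k + l))"
    using positive_add[OF kl(3,6)] by (simp add: re_simps algebra_simps)
  then show ?thesis
    using kl closed_ideal_add[OF N] by (auto simp: upper_bounds_def star_add intro!: bexI[of _ "k + l"])
qed

lemma upper_bounds_scaleR:
  assumes N: "closed_ideal N" and "t \<in> upper_bounds N x" "c \<ge> 0"
  shows "c * t \<in> upper_bounds N (c *\<^sub>R x)"
proof -
  obtain k where k: "k \<in> N" "star k = k" "positive (t *\<^sub>R e - re x - k)"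
    using assms(2) by (auto simp: upper_bounds_def)
  have "positive ((c * t) *\<^sub>R e - re (c *\<^sub>R x) - c *\<^sub>R k)"
    using positive_scaleR[OF k(3) assms(3)] by (simp add: re_simps algebra_simps)
  then show ?thesis
    using k closed_ideal_scaleR[OF N]
    by (auto simp: upper_bounds_def star_simps intro!: bexI[of _ "c *\<^sub>R k"])
qed

lemma sublinear_Inf_upper_bounds:
  assumes N: "closed_ideal N" "N \<noteq> UNIV"
  shows "sublinear (\<lambda>y. Inf (upper_bounds N y))"
proof (rule sublinearI)
  have low: "Inf (upper_bounds N y) \<le> t" if "t \<in> upper_bounds N y" for y t
    using that upper_bounds_ge[OF N, of _ y] by (intro cInf_lower bdd_belowI)
  have ne: "upper_bounds N y \<noteq> {}" for y using norm_in_upper_bounds[OF N(1)] by blast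
  show "Inf (upper_bounds N (x + y)) \<le> Inf (upper_bounds N x) + Inf (upper_bounds N y)" for x y
  proof -
    have "Inf (upper_bounds N (x + y)) - t \<le> Inf (upper_bounds N x)" if "t \<in> upper_bounds N y" for t
    proof (rule cInf_greatest[OF ne])
      fix s assume "s \<in> upper_bounds N x"
      from low[OF upper_bounds_add[OF N(1) this that]]
      show "Inf (upper_bounds N (x + y)) - t \<le> s" by simp
    qed
    then have "Inf (upper_bounds N (x + y)) - Inf (upper_bounds N x) \<le> Inf (upper_bounds N y)"
      by (intro cInf_greatest[OF ne]) (simp add: algebra_simps)
    then show ?thesis by simp
  qed
  show "Inf (upper_bounds N (c *\<^sub>R x)) \<le> c * Inf (upper_bounds N x)" if c: "c > 0" for c x
  proof -
    have "Inf (upper_bounds N (c *\<^sub>R x)) / c \<le> Inf (upper_bounds N x)"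
    proof (rule cInf_greatest[OF ne])
      fix t assume "t \<in> upper_bounds N x"
      from low[OF upper_bounds_scaleR[OF N(1) this, of c]] c
      show "Inf (upper_bounds N (c *\<^sub>R x)) / c \<le> t" by (simp add: field_simps)
    qed
    then show ?thesis using c by (simp add: field_simps)
  qed
qed

text \<open>The real functional \<open>f\<close> supports the infimum of the upper bounds at
  \<open>star x * x\<close>. Its positivity, its invariance under \<open>star\<close> and its
  vanishing on \<open>N\<close> all hold because 0 is an upper bound of suitable elements. By
  \<open>ideal_order_bound\<close>, every upper bound of \<open>star x * x\<close> dominates the
  squared quotient norm of \<open>x\<close>, so the supported value does too.\<close>

lemma exists_functional_attaining_ideal_norm:
  assumes N: "closed_ideal N" "N \<noteq> UNIV"
  obtains \<phi> :: "'b \<Rightarrow> complex" where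
    "\<And>y z. \<phi> (y + z) = \<phi> y + \<phi> z" "\<And>c y. \<phi> (c *\<^sub>C y) = c * \<phi> y"
    "\<And>y. \<phi> (star y) = cnj (\<phi> y)" "\<And>y. Re (\<phi> (star y * y)) \<ge> 0"
    "\<And>i. i \<in> N \<Longrightarrow> \<phi> i = 0" "Re (\<phi> e) \<le> 1"
    "(ideal_norm N x)\<^sup>2 \<le> Re (\<phi> (star x * x))"
proof -
  obtain f where lin: "linear f" and le: "\<And>y. f y \<le> Inf (upper_bounds N y)"
    and fx: "f (star x * x) = Inf (upper_bounds N (star x * x))"
    using dominated_linear_functional[OF sublinear_Inf_upper_bounds[OF N]] by metis
  have f_le: "f y \<le> t" if "t \<in> upper_bounds N y" for y t
    using that upper_bounds_ge[OF N, of _ y]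
    by (intro order_trans[OF le cInf_lower] bdd_belowI)
  \<comment> \<open>Zero as an upper bound of both \<open>y\<close> and \<open>- y\<close> squeezes
    \<open>f y\<close> from both sides.\<close>
  have f_zero: "f y = 0" if "0 \<in> upper_bounds N y" "0 \<in> upper_bounds N (- y)" for y
    using f_le[OF that(1)] f_le[OF that(2)] linear_neg[OF lin, of y] by simp
  note 0 = closed_ideal_0[OF N(1)]
  have f_star: "f (star y) = f y" for y
  proof -
    have "f (y - star y) = 0"
      by (rule f_zero; rule zero_in_upper_bounds[of 0]) (simp_all add: 0 re_def star_simps)
    then show ?thesis by (simp add: linear_diff[OF lin])
  qed
  have f_N: "f i = 0" if i: "i \<in> N" for i
  proof (rule f_zero)
    have "re i \<in> N" unfolding re_def
      by (intro closed_ideal_scaleR closed_ideal_add closed_ideal_star N i)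
    moreover have "re (- i) = - re i" by (simp add: re_def star_simps algebra_simps)
    ultimately show "0 \<in> upper_bounds N i" "0 \<in> upper_bounds N (- i)"
      using zero_in_upper_bounds[of "- re i" N i] zero_in_upper_bounds[of "re i" N "- i"]
        closed_ideal_minus[OF N(1)] re_simps(3)[of i] by (simp_all add: star_simps)
  qed
  have f_pos: "0 \<le> f k" if "positive k" for k
  proof -
    have "0 \<in> upper_bounds N (- k)"
      using that positive_star[OF that]
      by (intro zero_in_upper_bounds[of 0]) (simp_all add: 0 re_self_adjoint star_simps)
    from f_le[OF this] show ?thesis by (simp add: linear_neg[OF lin])
  qed
  have f_e: "f e \<le> 1"
    by (rule f_le)
      (auto simp: upper_bounds_def re_self_adjoint 0 intro!: bexI[of _ 0])
  have f_x: "(ideal_norm N x)\<^sup>2 \<le> f (star x * x)"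
    unfolding fx
  proof (rule cInf_greatest)
    show "upper_bounds N (star x * x) \<noteq> {}" using norm_in_upper_bounds[OF N(1)] by blast
    fix t assume "t \<in> upper_bounds N (star x * x)"
    then obtain k where k: "k \<in> N" "star k = k" "positive (t *\<^sub>R e - star x * x - k)"
      by (auto simp: upper_bounds_def re_self_adjoint star_simps)
    from positive_add[OF k(3) positive_star_mult_self[of x]] have "positive (t *\<^sub>R e - k)" by simp
    then have t: "t \<ge> 0" by (rule positive_modulo_ideal_nonneg[OF N k(1,2)])
    show "(ideal_norm N x)\<^sup>2 \<le> t"
    proof (rule field_le_epsilon)
      fix \<epsilon> :: real assume "\<epsilon> > 0"
      then obtain i where i: "i \<in> N" "norm (x + i) * norm (x + i) \<le> t + \<epsilon>"
        using ideal_order_bound[OF N(1) k t] by blast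
      have "0 \<le> ideal_norm N x" using 0 by (intro ideal_norm_nonneg) blast
      with ideal_norm_le[OF i(1), of x] have "(ideal_norm N x)\<^sup>2 \<le> (norm (x + i))\<^sup>2"
        by (intro power_mono)
      with i show "(ideal_norm N x)\<^sup>2 \<le> t + \<epsilon>" by (simp add: power2_eq_square)
    qed
  qed
  \<comment> \<open>The only complex-linear functional whose real part is \<open>f\<close>.\<close>
  define \<phi> where "\<phi> y = Complex (f y) (- f (\<i> *\<^sub>C y))" for y
  have f_i: "f (\<i> *\<^sub>C star y) = - f (\<i> *\<^sub>C y)" for y
    using f_star[of "\<i> *\<^sub>C y"] linear_neg[OF lin]
    by (simp add: star_simps complex_vector.scale_minus_left)
  show thesis
  proof (rule that[of \<phi>])
    show "\<phi> (y + z) = \<phi> y + \<phi> z" for y z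
      by (simp add: \<phi>_def scaleC_add_right linear_add[OF lin] complex_eq_iff)
    show "\<phi> (c *\<^sub>C y) = c * \<phi> y" for c y
    proof -
      have c: "c = complex_of_real (Re c) + \<i> * complex_of_real (Im c)" by (simp add: complex_eq_iff)
      have 1: "c *\<^sub>C y = Re c *\<^sub>R y + Im c *\<^sub>R (\<i> *\<^sub>C y)"
        by (subst c)
          (simp only: scaleC_add_left scaleC_of_real scaleC_scaleC[symmetric] scaleC_scaleR)
      have "\<i> *\<^sub>C c *\<^sub>C y = Re c *\<^sub>R (\<i> *\<^sub>C y) + Im c *\<^sub>R (\<i> *\<^sub>C \<i> *\<^sub>C y)"
        unfolding 1 by (simp only: scaleC_add_right scaleC_scaleR)
      also have "\<i> *\<^sub>C \<i> *\<^sub>C y = - y"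
        by (simp add: scaleC_scaleC complex_vector.scale_minus_left scaleC_one)
      finally have 2: "\<i> *\<^sub>C c *\<^sub>C y = Re c *\<^sub>R (\<i> *\<^sub>C y) + Im c *\<^sub>R (- y)" .
      show ?thesis
        unfolding \<phi>_def 2 unfolding 1
        by (simp add: complex_eq_iff linear_add[OF lin] linear_scale[OF lin] linear_neg[OF lin]
            linear_diff[OF lin])
    qed
    show "\<phi> (star y) = cnj (\<phi> y)" for y
      by (simp add: \<phi>_def f_star f_i complex_eq_iff)
    show "Re (\<phi> (star y * y)) \<ge> 0" for y
      by (simp add: \<phi>_def f_pos positive_star_mult_self)
    show "\<phi> i = 0" if "i \<in> N" for i
      using that by (simp add: \<phi>_def f_N closed_ideal_scaleC[OF N(1)] complex_eq_iff)
  qed (simp_all add: \<phi>_def f_e f_x)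
qed

end


section \<open>Operators on Hilbert spaces\<close>

text \<open>The common core of both Cauchy-Schwarz inequalities and of the estimate in
  \<open>Riesz_representation\<close>. Restricting to \<open>c = - t * cnj z\<close> leaves a real
  quadratic in \<open>t\<close>.\<close>

lemma norm_sq_le_if_quadratic_nonneg:
  fixes z :: complex
  assumes nn: "\<And>c. 0 \<le> A + 2 * Re (c * z) + (cmod c)\<^sup>2 * B" and B: "B \<ge> 0"
  shows "(cmod z)\<^sup>2 \<le> A * B"
proof -
  have *: "0 \<le> A - 2 * t * (cmod z)\<^sup>2 + t\<^sup>2 * (cmod z)\<^sup>2 * B" for t
  proof -
    have "Re (- complex_of_real t * cnj z * z) = - t * (cmod z)\<^sup>2"
      by (simp add: cmod_power2) (simp add: power2_eq_square algebra_simps)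
    then show ?thesis
      using nn[of "- complex_of_real t * cnj z"]
      by (simp add: norm_mult power_mult_distrib)
  qed
  show ?thesis
  proof (cases "B = 0")
    case True
    have "(cmod z)\<^sup>2 = 0"
    proof (rule ccontr)
      assume "(cmod z)\<^sup>2 \<noteq> 0"
      \<comment> \<open>For \<open>B = 0\<close> the expression is affine in \<open>t\<close>, and
        this \<open>t\<close> gives it the value -1.\<close>
      then show False
        using *[of "(A + 1) / (2 * (cmod z)\<^sup>2)"] True by (simp add: field_simps)
    qed
    then show ?thesis using True by simp
  next
    case False
    with B have "B > 0" by simp
    \<comment> \<open>The quadratic is minimal at \<open>t = 1 / B\<close>.\<close>
    then show ?thesis using *[of "1 / B"] by (simp add: field_simps power2_eq_square)
  qed
qed

context hilbert_space
begin

abbreviation C where "C \<equiv> hcarrier H"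
abbreviation ip where "ip \<equiv> hinner H"
abbreviation hsub where "hsub x y \<equiv> hadd H x (hscale H (- 1) y)"

lemmas closed_intros = hzero_closed hadd_closed hscale_closed

lemma hinner_add_right:
  "\<lbrakk>x \<in> C; y \<in> C; z \<in> C\<rbrakk> \<Longrightarrow> ip x (hadd H y z) = ip x y + ip x z"
  by (metis hinner_commute hinner_add_left hadd_closed complex_cnj_add)

lemma hinner_scale_right: "\<lbrakk>x \<in> C; y \<in> C\<rbrakk> \<Longrightarrow> ip x (hscale H c y) = cnj c * ip x y"
  by (metis hinner_commute hinner_scale_left hscale_closed complex_cnj_mult)

lemma hinner_zero_left: "x \<in> C \<Longrightarrow> ip (hzero H) x = 0"
  by (metis hadd_zero hinner_add_left hzero_closed add_cancel_right_left)

lemma hinner_zero_right: "x \<in> C \<Longrightarrow> ip x (hzero H) = 0"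
  using hinner_commute[of x "hzero H"] hinner_zero_left[of x] hzero_closed by simp

lemmas hinner_simps = hinner_add_left hinner_scale_left hinner_add_right hinner_scale_right
  hinner_zero_left hinner_zero_right closed_intros

lemma hnorm_square: "x \<in> C \<Longrightarrow> (hnorm H x)\<^sup>2 = Re (ip x x)"
  by (simp add: hnorm_def hinner_nonneg)

lemma hnorm_nonneg: "x \<in> C \<Longrightarrow> 0 \<le> hnorm H x"
  by (simp add: hnorm_def hinner_nonneg)

lemma hinner_self: "x \<in> C \<Longrightarrow> ip x x = complex_of_real ((hnorm H x)\<^sup>2)"
  using hinner_commute[of x x] by (simp add: complex_eq_iff hnorm_square)

lemma hdist_hnorm: "hdist H x y = hnorm H (hsub x y)"
  by (simp add: hdist_def hnorm_def Let_def)

lemma hnorm_eq_0: "x \<in> C \<Longrightarrow> hnorm H x = 0 \<longleftrightarrow> x = hzero H"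
  using hinner_self[of x] hinner_definite[of x] hinner_zero_left[of "hzero H"] hzero_closed
  by (auto simp: hnorm_def)

lemma hinner_square_add_scale:
  assumes "x \<in> C" "y \<in> C"
  shows "Re (ip (hadd H x (hscale H c y)) (hadd H x (hscale H c y)))
    = Re (ip x x) + 2 * Re (c * ip y x) + (cmod c)\<^sup>2 * Re (ip y y)"
proof -
  have "Re (cnj c * ip x y) = Re (c * ip y x)"
    using hinner_commute[OF assms] by simp
  moreover have "Re (cnj c * (c * ip y y)) = (cmod c)\<^sup>2 * Re (ip y y)"
    unfolding cmod_power2 by (simp add: power2_eq_square algebra_simps)
  ultimately show ?thesis
    using assms by (simp add: hinner_simps distrib_left del: times_complex.sel)
qed

lemma Cauchy_Schwarz:
  assumes "x \<in> C" "y \<in> C" shows "cmod (ip x y) \<le> hnorm H x * hnorm H y"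
proof (rule power2_le_imp_le)
  have "0 \<le> Re (ip y y) + 2 * Re (c * ip x y) + (cmod c)\<^sup>2 * Re (ip x x)" for c
    unfolding hinner_square_add_scale[OF assms(2,1), symmetric]
    using assms by (intro hinner_nonneg closed_intros)
  then have "(cmod (ip x y))\<^sup>2 \<le> Re (ip y y) * Re (ip x x)"
    using assms by (intro norm_sq_le_if_quadratic_nonneg hinner_nonneg)
  then show "(cmod (ip x y))\<^sup>2 \<le> (hnorm H x * hnorm H y)\<^sup>2"
    using assms by (simp add: power_mult_distrib hnorm_square mult.commute)
qed (use assms in \<open>simp add: hnorm_nonneg\<close>)

lemma hinner_eqI:
  assumes "x \<in> C" "y \<in> C" "\<And>z. z \<in> C \<Longrightarrow> ip x z = ip y z" shows "x = y"
proof -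
  have "ip (hsub x y) (hsub x y) = 0"
    using assms by (simp add: hinner_simps)
  then have d: "hsub x y = hzero H" using assms by (intro hinner_definite closed_intros)
  have "x = hadd H x (hadd H (hscale H (-1) y) y)"
    using assms hadd_inverse[of y] hadd_zero[of x]
    by (simp add: hadd_commute closed_intros)
  also have "\<dots> = hadd H (hsub x y) y" using assms by (simp add: hadd_assoc closed_intros)
  also have "\<dots> = y" using assms by (simp add: d hadd_zero)
  finally show ?thesis .
qed

lemma hinner_eqI_right:
  assumes "x \<in> C" "y \<in> C" "\<And>z. z \<in> C \<Longrightarrow> ip z x = ip z y" shows "x = y"
proof (rule hinner_eqI)
  show "ip x z = ip y z" if "z \<in> C" for z
    using assms that hinner_commute[of x z] hinner_commute[of y z] by simp
qed (use assms in auto)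

lemma hinner_tendsto_left:
  assumes X: "\<And>n. X n \<in> C" "x \<in> C" "(\<lambda>n. hdist H (X n) x) \<longlonglongrightarrow> 0" and y: "y \<in> C"
  shows "(\<lambda>n. ip (X n) y) \<longlonglongrightarrow> ip x y"
proof -
  have "(\<lambda>n. ip (X n) y - ip x y) \<longlonglongrightarrow> 0"
  proof (rule Lim_null_comparison)
    show "\<forall>\<^sub>F n in sequentially. norm (ip (X n) y - ip x y) \<le> hdist H (X n) x * hnorm H y"
    proof (rule always_eventually, rule allI)
      fix n
      have "ip (X n) y - ip x y = ip (hsub (X n) x) y"
        using X y by (simp add: hinner_simps)
      then show "norm (ip (X n) y - ip x y) \<le> hdist H (X n) x * hnorm H y"
        using X y by (simp add: hdist_hnorm Cauchy_Schwarz closed_intros)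
    qed
    show "(\<lambda>n. hdist H (X n) x * hnorm H y) \<longlonglongrightarrow> 0"
      using tendsto_mult_right[OF X(3), of "hnorm H y"] by simp
  qed
  then show ?thesis by (simp add: LIM_zero_iff)
qed

lemma bounded_opsD:
  assumes "f \<in> bounded_ops H"
  shows "x \<in> C \<Longrightarrow> f x \<in> C" "x \<notin> C \<Longrightarrow> f x = undefined"
    "x \<in> C \<Longrightarrow> y \<in> C \<Longrightarrow> f (hadd H x y) = hadd H (f x) (f y)"
    "x \<in> C \<Longrightarrow> f (hscale H c x) = hscale H c (f x)"
  using assms by (auto simp: bounded_ops_def PiE_def extensional_def)

lemma bounded_ops_bound:
  assumes "f \<in> bounded_ops H"
  obtains K where "K \<ge> 0" "\<And>x. x \<in> C \<Longrightarrow> hnorm H (f x) \<le> K * hnorm H x"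
proof -
  obtain K where K: "\<And>x. x \<in> C \<Longrightarrow> hnorm H (f x) \<le> K * hnorm H x"
    using assms unfolding bounded_ops_def by blast
  have "hnorm H (f x) \<le> max K 0 * hnorm H x" if "x \<in> C" for x
    using K[OF that] hnorm_nonneg[OF that] mult_right_mono[of K "max K 0" "hnorm H x"] by linarith
  then show thesis using that[of "max K 0"] by simp
qed

lemma bounded_opsI:
  assumes "\<And>x. x \<in> C \<Longrightarrow> f x \<in> C" "\<And>x. x \<notin> C \<Longrightarrow> f x = undefined"
    "\<And>x y. x \<in> C \<Longrightarrow> y \<in> C \<Longrightarrow> f (hadd H x y) = hadd H (f x) (f y)"
    "\<And>c x. x \<in> C \<Longrightarrow> f (hscale H c x) = hscale H c (f x)"
    "\<And>x. x \<in> C \<Longrightarrow> hnorm H (f x) \<le> K * hnorm H x"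
  shows "f \<in> bounded_ops H"
  using assms unfolding bounded_ops_def by (auto simp: PiE_def extensional_def intro!: exI[of _ K])

lemma bounded_ops_eqI:
  assumes "f \<in> bounded_ops H" "g \<in> bounded_ops H" "\<And>x. x \<in> C \<Longrightarrow> f x = g x" shows "f = g"
  using assms by (metis bounded_opsD(2) ext)

lemma bounded_ops_hcomp:
  assumes f: "f \<in> bounded_ops H" and g: "g \<in> bounded_ops H"
  shows "hcomp H f g \<in> bounded_ops H"
proof -
  obtain K where K: "K \<ge> 0" "\<And>x. x \<in> C \<Longrightarrow> hnorm H (f x) \<le> K * hnorm H x"
    using bounded_ops_bound[OF f] by blast
  obtain L where L: "\<And>x. x \<in> C \<Longrightarrow> hnorm H (g x) \<le> L * hnorm H x"
    using bounded_ops_bound[OF g] by blast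
  show ?thesis
  proof (rule bounded_opsI)
    show "hnorm H (hcomp H f g x) \<le> (K * L) * hnorm H x" if x: "x \<in> C" for x
    proof -
      have "hnorm H (f (g x)) \<le> K * (L * hnorm H x)"
        using K L[OF x] bounded_opsD(1)[OF g x] by (meson mult_left_mono order_trans)
      then show ?thesis using x by (simp add: compose_def mult.assoc)
    qed
  qed (auto simp: compose_def bounded_opsD[OF f] bounded_opsD[OF g] closed_intros)
qed

lemma hid_bounded_ops: "hid H \<in> bounded_ops H"
  by (rule bounded_opsI[where K = 1]) (auto simp: hid_def closed_intros)

lemma bounded_ops_tendsto:
  assumes f: "f \<in> bounded_ops H" and X: "\<And>n. X n \<in> C" "x \<in> C" "(\<lambda>n. hdist H (X n) x) \<longlonglongrightarrow> 0"
  shows "(\<lambda>n. hdist H (f (X n)) (f x)) \<longlonglongrightarrow> 0"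
proof -
  obtain K where K: "\<And>x. x \<in> C \<Longrightarrow> hnorm H (f x) \<le> K * hnorm H x"
    using bounded_ops_bound[OF f] by blast
  show ?thesis
  proof (rule Lim_null_comparison)
    have "norm (hdist H (f (X n)) (f x)) \<le> K * hdist H (X n) x" for n
    proof -
      have d: "hsub (X n) x \<in> C" using X by (simp add: closed_intros)
      have "hdist H (f (X n)) (f x) = hnorm H (f (hsub (X n) x))"
        using X by (simp add: hdist_hnorm bounded_opsD[OF f] closed_intros)
      then show ?thesis
        using K[OF d] hnorm_nonneg[OF bounded_opsD(1)[OF f d]] by (simp add: hdist_hnorm)
    qed
    then show "\<forall>\<^sub>F n in sequentially. norm (hdist H (f (X n)) (f x)) \<le> K * hdist H (X n) x"
      by simp
    show "(\<lambda>n. K * hdist H (X n) x) \<longlonglongrightarrow> 0"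
      using tendsto_mult_left[OF X(3), of K] by simp
  qed
qed

text \<open>The representing vector is the limit of a minimising sequence of
  \<open>\<parallel>x\<parallel>\<^sup>2 - 2 Re (\<psi> x)\<close>: at an almost minimal point \<open>x\<close> the functional \<open>\<psi>\<close> is close to
  \<open>\<langle>\<cdot>, x\<rangle>\<close> in norm, which also makes the sequence a Cauchy sequence.\<close>

lemma Riesz_representation:
  assumes add: "\<And>x y. x \<in> C \<Longrightarrow> y \<in> C \<Longrightarrow> \<psi> (hadd H x y) = \<psi> x + \<psi> y"
    and scale: "\<And>c x. x \<in> C \<Longrightarrow> \<psi> (hscale H c x) = c * \<psi> x"
    and bound: "\<And>x. x \<in> C \<Longrightarrow> cmod (\<psi> x) \<le> M * hnorm H x"
  shows "\<exists>z\<in>C. \<forall>x\<in>C. \<psi> x = ip x z"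
proof -
  define J where "J x = (hnorm H x)\<^sup>2 - 2 * Re (\<psi> x)" for x
  define m where "m = (INF x\<in>C. J x)"
  have low: "- (M\<^sup>2) \<le> J x" if x: "x \<in> C" for x
  proof -
    have "Re (\<psi> x) \<le> M * hnorm H x"
      using bound[OF x] complex_Re_le_cmod[of "\<psi> x"] by linarith
    moreover have "0 \<le> (hnorm H x - M)\<^sup>2" by simp
    ultimately show ?thesis by (simp add: J_def power2_eq_square algebra_simps)
  qed
  have m_le: "m \<le> J x" if "x \<in> C" for x
    unfolding m_def using that low by (intro cINF_lower bdd_belowI2)
  have close: "cmod (ip u x - \<psi> u) \<le> r * hnorm H u"
    if "x \<in> C" "u \<in> C" "J x \<le> m + r\<^sup>2" "r \<ge> 0" for x u r
  proof (rule power2_le_imp_le)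
    \<comment> \<open>Moving from \<open>x\<close> by \<open>c u\<close> cannot bring
      \<open>J\<close> below its infimum \<open>m\<close>, so it lowers \<open>J\<close> by at most
      \<open>r^2\<close>. The change is a quadratic expression in \<open>c\<close>.\<close>
    have "0 \<le> r\<^sup>2 + 2 * Re (c * (ip u x - \<psi> u)) + (cmod c)\<^sup>2 * Re (ip u u)" for c
    proof -
      have "m \<le> J (hadd H x (hscale H c u))" using that by (intro m_le closed_intros)
      also have "\<dots> = J x + 2 * Re (c * ip u x) + (cmod c)\<^sup>2 * Re (ip u u) - 2 * Re (c * \<psi> u)"
        using that hinner_square_add_scale[of x u c]
        by (simp add: J_def hnorm_square closed_intros add scale del: times_complex.sel)
      finally show ?thesis using that by (simp add: algebra_simps)
    qed
    then have "(cmod (ip u x - \<psi> u))\<^sup>2 \<le> r\<^sup>2 * Re (ip u u)"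
      using that by (intro norm_sq_le_if_quadratic_nonneg hinner_nonneg)
    then show "(cmod (ip u x - \<psi> u))\<^sup>2 \<le> (r * hnorm H u)\<^sup>2"
      using that by (simp add: hnorm_square power_mult_distrib)
  qed (use that in \<open>simp add: hnorm_nonneg\<close>)
  have "\<exists>x\<in>C. J x \<le> m + (1 / (real n + 1))\<^sup>2" for n
  proof -
    have "m < m + (1 / (real n + 1))\<^sup>2" by simp
    then show ?thesis
      using cINF_less_iff[of C J "m + (1 / (real n + 1))\<^sup>2"] hzero_closed low
      unfolding m_def by (metis bdd_belowI2 empty_iff less_imp_le)
  qed
  then obtain X where X: "\<And>n. X n \<in> C" "\<And>n. J (X n) \<le> m + (1 / (real n + 1))\<^sup>2" by metis
  have dist: "hdist H (X k) (X n) \<le> 1 / (real k + 1) + 1 / (real n + 1)" for k n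
  proof -
    define u where "u = hsub (X k) (X n)"
    have u: "u \<in> C" using X by (simp add: u_def closed_intros)
    \<comment> \<open>The values \<open>\<psi> u\<close> cancel, and what remains is the inner
      product of \<open>u\<close> with \<open>X k - X n\<close>, which is \<open>u\<close>
      again.\<close>
    have "complex_of_real ((hnorm H u)\<^sup>2) = (ip u (X k) - \<psi> u) - (ip u (X n) - \<psi> u)"
      unfolding hinner_self[OF u, symmetric]
      using X u by (subst (2) u_def) (simp add: hinner_simps)
    then have "(hnorm H u)\<^sup>2 = cmod ((ip u (X k) - \<psi> u) - (ip u (X n) - \<psi> u))"
      by (metis norm_of_real abs_of_nonneg zero_le_power2)
    also have "\<dots> \<le> cmod (ip u (X k) - \<psi> u) + cmod (ip u (X n) - \<psi> u)" by (rule norm_triangle_ineq4)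
    also have "\<dots> \<le> 1 / (real k + 1) * hnorm H u + 1 / (real n + 1) * hnorm H u"
      using X u by (intro add_mono close) auto
    finally have "hnorm H u * hnorm H u \<le> (1 / (real k + 1) + 1 / (real n + 1)) * hnorm H u"
      by (simp add: power2_eq_square distrib_right)
    then have "hnorm H u \<le> 1 / (real k + 1) + 1 / (real n + 1)"
      using hnorm_nonneg[OF u] by (cases "hnorm H u = 0") auto
    then show ?thesis by (simp add: hdist_hnorm u_def)
  qed
  have "\<exists>z\<in>C. (\<lambda>n. hdist H (X n) z) \<longlonglongrightarrow> 0"
  proof (rule hcomplete)
    fix \<epsilon> :: real assume "\<epsilon> > 0"
    then obtain N where N: "1 / (real N + 1) < \<epsilon> / 2"
      using nat_approx_posE[of "\<epsilon> / 2"] by (metis half_gt_zero Suc_eq_plus1 of_nat_Suc add.commute)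
    have "hdist H (X k) (X n) < \<epsilon>" if "k \<ge> N" "n \<ge> N" for k n
    proof -
      have "1 / (real k + 1) \<le> 1 / (real N + 1)" "1 / (real n + 1) \<le> 1 / (real N + 1)"
        using that by (simp_all add: field_simps)
      with N dist[of k n] show ?thesis by linarith
    qed
    then show "\<exists>N. \<forall>k\<ge>N. \<forall>n\<ge>N. hdist H (X k) (X n) < \<epsilon>" by blast
  qed (rule X)
  then obtain z where z: "z \<in> C" "(\<lambda>n. hdist H (X n) z) \<longlonglongrightarrow> 0" by blast
  have "\<psi> u = ip u z" if u: "u \<in> C" for u
  proof (rule LIMSEQ_unique)
    have "(\<lambda>n. cnj (ip (X n) u)) \<longlonglongrightarrow> cnj (ip z u)"
      by (intro tendsto_cnj hinner_tendsto_left X z u)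
    then show "(\<lambda>n. ip u (X n)) \<longlonglongrightarrow> ip u z"
      using hinner_commute[OF u] X z by simp
    have "(\<lambda>n. ip u (X n) - \<psi> u) \<longlonglongrightarrow> 0"
    proof (rule Lim_null_comparison)
      show "\<forall>\<^sub>F n in sequentially. norm (ip u (X n) - \<psi> u) \<le> 1 / (real n + 1) * hnorm H u"
        using X u by (intro always_eventually allI close) auto
      have "(\<lambda>n. 1 / (real n + 1)) \<longlonglongrightarrow> 0"
        using LIMSEQ_inverse_real_of_nat by (simp add: inverse_eq_divide add.commute)
      then show "(\<lambda>n. 1 / (real n + 1) * hnorm H u) \<longlonglongrightarrow> 0"
        using tendsto_mult_right[of _ 0 sequentially "hnorm H u"] by fastforce
    qed
    then show "(\<lambda>n. ip u (X n)) \<longlonglongrightarrow> \<psi> u" by (simp add: LIM_zero_iff)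
  qed
  with z show ?thesis by blast
qed

section \<open>Adjoints\<close>

text \<open>\<open>hadjoint\<close> is a definite description, so existence has to be established
  before anything can be said about it. The Riesz representation gives the values of
  \<open>g\<close> one by one; its bound comes from writing the squared norm of \<open>g y\<close>
  as the inner product of \<open>f (g y)\<close> and \<open>y\<close>.\<close>

lemma adjoint_exists:
  assumes f: "f \<in> bounded_ops H"
  shows "\<exists>g\<in>bounded_ops H. \<forall>x\<in>C. \<forall>y\<in>C. ip (f x) y = ip x (g y)"
proof -
  obtain K where K: "K \<ge> 0" "\<And>x. x \<in> C \<Longrightarrow> hnorm H (f x) \<le> K * hnorm H x"
    using bounded_ops_bound[OF f] by blast
  note fD = bounded_opsD[OF f]
  have "\<exists>z\<in>C. \<forall>x\<in>C. ip (f x) y = ip x z" if y: "y \<in> C" for y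
  proof (rule Riesz_representation)
    show "cmod (ip (f x) y) \<le> (K * hnorm H y) * hnorm H x" if x: "x \<in> C" for x
    proof -
      have "cmod (ip (f x) y) \<le> hnorm H (f x) * hnorm H y"
        using x y fD by (intro Cauchy_Schwarz)
      also have "\<dots> \<le> K * hnorm H x * hnorm H y"
        using K(2)[OF x] hnorm_nonneg[OF y] by (rule mult_right_mono)
      finally show ?thesis by (simp add: algebra_simps)
    qed
  qed (use y fD in \<open>simp_all add: hinner_simps\<close>)
  then obtain g0 where g0: "\<And>y. y \<in> C \<Longrightarrow> g0 y \<in> C" "\<And>x y. x \<in> C \<Longrightarrow> y \<in> C \<Longrightarrow> ip (f x) y = ip x (g0 y)"
    by metis
  define g where "g = restrict g0 C"
  have g: "g y \<in> C" "x \<in> C \<Longrightarrow> ip (f x) y = ip x (g y)" if "y \<in> C" for x y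
    using that g0 by (simp_all add: g_def)
  have "g \<in> bounded_ops H"
  proof (rule bounded_opsI)
    show "g (hadd H x y) = hadd H (g x) (g y)" if "x \<in> C" "y \<in> C" for x y
    proof (rule hinner_eqI_right)
      show "ip z (g (hadd H x y)) = ip z (hadd H (g x) (g y))" if "z \<in> C" for z
        using that \<open>x \<in> C\<close> \<open>y \<in> C\<close> by (simp add: g(2)[symmetric] g(1) hinner_simps fD)
    qed (use that in \<open>simp_all add: g closed_intros\<close>)
    show "g (hscale H c x) = hscale H c (g x)" if "x \<in> C" for c x
    proof (rule hinner_eqI_right)
      show "ip z (g (hscale H c x)) = ip z (hscale H c (g x))" if "z \<in> C" for z
        using that \<open>x \<in> C\<close> by (simp add: g(2)[symmetric] g(1) hinner_simps fD)
    qed (use that in \<open>simp_all add: g closed_intros\<close>)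
    show "hnorm H (g y) \<le> K * hnorm H y" if y: "y \<in> C" for y
    proof -
      have "(hnorm H (g y))\<^sup>2 = cmod (ip (f (g y)) y)"
        using g[OF y] g(2)[OF y g(1)[OF y]] hinner_self[of "g y"] by (simp add: norm_power hnorm_nonneg)
      also have "\<dots> \<le> hnorm H (f (g y)) * hnorm H y"
        using g[OF y] y fD by (intro Cauchy_Schwarz) auto
      also have "\<dots> \<le> K * hnorm H (g y) * hnorm H y"
        using K(2)[OF g(1)[OF y]] hnorm_nonneg[OF y] by (rule mult_right_mono)
      finally have "hnorm H (g y) * hnorm H (g y) \<le> (K * hnorm H y) * hnorm H (g y)"
        by (simp add: power2_eq_square algebra_simps)
      then show ?thesis
        using hnorm_nonneg[OF g(1)[OF y]] hnorm_nonneg[OF y] K(1)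
        by (cases "hnorm H (g y) = 0") auto
    qed
  qed (simp_all add: g, simp add: g_def)
  with g show ?thesis by blast
qed

lemma adjoint_unique:
  assumes "f \<in> bounded_ops H" "g \<in> bounded_ops H" "h \<in> bounded_ops H"
    "\<And>x y. x \<in> C \<Longrightarrow> y \<in> C \<Longrightarrow> ip (f x) y = ip x (g y)"
    "\<And>x y. x \<in> C \<Longrightarrow> y \<in> C \<Longrightarrow> ip (f x) y = ip x (h y)"
  shows "g = h"
proof (rule bounded_ops_eqI[OF assms(2,3)])
  fix y assume y: "y \<in> C"
  show "g y = h y"
    using assms(4,5) y bounded_opsD(1)[OF assms(2)] bounded_opsD(1)[OF assms(3)]
    by (intro hinner_eqI_right) auto
qed

lemma hadjointI:
  assumes "f \<in> bounded_ops H" "g \<in> bounded_ops H"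
    "\<And>x y. x \<in> C \<Longrightarrow> y \<in> C \<Longrightarrow> ip (f x) y = ip x (g y)"
  shows "hadjoint H f = g"
  unfolding hadjoint_def using assms by (intro the_equality) (auto intro: adjoint_unique)

lemma hadjoint:
  assumes "f \<in> bounded_ops H"
  shows "hadjoint H f \<in> bounded_ops H"
    and "\<And>x y. x \<in> C \<Longrightarrow> y \<in> C \<Longrightarrow> ip (f x) y = ip x (hadjoint H f y)"
    and "\<And>x y. x \<in> C \<Longrightarrow> y \<in> C \<Longrightarrow> ip x (f y) = ip (hadjoint H f x) y"
proof -
  obtain g where g: "g \<in> bounded_ops H" "\<And>x y. x \<in> C \<Longrightarrow> y \<in> C \<Longrightarrow> ip (f x) y = ip x (g y)"
    using adjoint_exists[OF assms] by blast
  then have eq: "hadjoint H f = g" by (intro hadjointI assms)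
  show "hadjoint H f \<in> bounded_ops H"
    "\<And>x y. x \<in> C \<Longrightarrow> y \<in> C \<Longrightarrow> ip (f x) y = ip x (hadjoint H f y)" by (simp_all add: eq g)
  show "ip x (f y) = ip (hadjoint H f x) y" if "x \<in> C" "y \<in> C" for x y
    using that g hinner_commute[of x "f y"] hinner_commute[of "g x" y] bounded_opsD(1)[OF assms]
      bounded_opsD(1)[OF g(1)] by (simp add: eq)
qed

lemma hadjoint_hadjoint:
  assumes "f \<in> bounded_ops H" shows "hadjoint H (hadjoint H f) = f"
  by (rule hadjointI) (simp_all add: hadjoint[OF assms] assms)

lemma hadjoint_hcomp:
  assumes "f \<in> bounded_ops H" "g \<in> bounded_ops H"
  shows "hadjoint H (hcomp H f g) = hcomp H (hadjoint H g) (hadjoint H f)"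
proof (rule hadjointI)
  fix x y assume "x \<in> C" "y \<in> C"
  then show "ip (hcomp H f g x) y = ip x (hcomp H (hadjoint H g) (hadjoint H f) y)"
    using assms hadjoint(1) bounded_opsD(1)
    by (simp add: compose_def hadjoint(2)[symmetric])
qed (simp_all add: assms bounded_ops_hcomp hadjoint)

lemma hadjoint_hid: "hadjoint H (hid H) = hid H"
  by (rule hadjointI[OF hid_bounded_ops hid_bounded_ops]) (simp add: hid_def)

end

text \<open>Non-degeneracy is expressed by a closed span; this lemma lets an identity of operators
  spread from a set to its closed span.\<close>

lemma hclosed_subspace_equalizer:
  assumes "hilbert_space H" and f: "f \<in> bounded_ops H" "g \<in> bounded_ops H"
  shows "hclosed_subspace H {x \<in> hcarrier H. f x = g x}"
proof -
  interpret hilbert_space H by fact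
  have "f x = g x"
    if X: "\<And>n::nat. X n \<in> C" "\<And>n. f (X n) = g (X n)" "x \<in> C" "(\<lambda>n. hdist H (X n) x) \<longlonglongrightarrow> 0" for X x
  proof (rule hinner_eqI)
    fix z assume z: "z \<in> C"
    have lim: "(\<lambda>n. ip (h (X n)) z) \<longlonglongrightarrow> ip (h x) z" if h: "h \<in> bounded_ops H" for h
      by (rule hinner_tendsto_left[OF bounded_opsD(1)[OF h X(1)] bounded_opsD(1)[OF h X(3)]
            bounded_ops_tendsto[OF h X(1,3,4)] z])
    from this[OF f(1)] have "(\<lambda>n. ip (g (X n)) z) \<longlonglongrightarrow> ip (f x) z" by (simp only: X(2))
    then show "ip (f x) z = ip (g x) z" using lim[OF f(2)] by (rule LIMSEQ_unique)
  qed (rule bounded_opsD(1)[OF f(1) X(3)], rule bounded_opsD(1)[OF f(2) X(3)])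
  moreover have zero: "f (hzero H) = hzero H" if f: "f \<in> bounded_ops H" for f
  proof (rule hinner_eqI)
    fix z assume z: "z \<in> C"
    have "ip (f (hscale H 0 (hzero H))) z = 0"
      using z bounded_opsD[OF f] by (simp add: hinner_simps)
    moreover have "hscale H 0 (hzero H) = hzero H"
      by (rule hinner_eqI) (simp_all add: hinner_simps)
    ultimately show "ip (f (hzero H)) z = ip (hzero H) z" using z by (simp add: hinner_zero_left)
  qed (use bounded_opsD(1)[OF f] closed_intros in auto)
  ultimately show ?thesis
    unfolding hclosed_subspace_def
    by (auto simp: closed_intros bounded_opsD[OF f(1)] bounded_opsD[OF f(2)] zero[OF f(1)] zero[OF f(2)])
qed


section \<open>Completion and the GNS construction\<close>

text \<open>The form may be degenerate, so \<open>nrm\<close> is only a seminorm. Separation and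
  completion are later done at once, on Cauchy sequences.\<close>

locale semi_inner =
  fixes form :: "'b::cstar_algebra \<Rightarrow> 'b \<Rightarrow> complex"
  assumes form_add_left: "form (x + y) z = form x z + form y z"
    and form_scaleC_left: "form (c *\<^sub>C x) y = c * form x y"
    and form_commute: "form x y = cnj (form y x)"
    and form_nonneg: "0 \<le> Re (form x x)"
begin

definition nrm :: "'b \<Rightarrow> real" where "nrm x = sqrt (Re (form x x))"

lemma form_add_right: "form x (y + z) = form x y + form x z"
  by (metis complex_cnj_add form_add_left form_commute)

lemma form_scaleC_right: "form x (c *\<^sub>C y) = cnj c * form x y"
  by (metis complex_cnj_mult form_scaleC_left form_commute)

lemma form_zero [simp]: "form 0 x = 0" "form x 0 = 0"
  using form_scaleC_left[of 0 0 x] form_scaleC_right[of x 0 0] by simp_all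

lemma form_minus: "form (- x) y = - form x y" "form x (- y) = - form x y"
  using form_scaleC_left[of "-1" x y] form_scaleC_right[of x "-1" y]
  by (simp_all add: complex_vector.scale_minus_left scaleC_one)

lemma form_diff: "form (x - y) z = form x z - form y z" "form x (y - z) = form x y - form x z"
  using form_add_left[of x "- y" z] form_add_right[of x y "- z"] by (simp_all add: form_minus)

lemmas form_simps = form_add_left form_add_right form_scaleC_left form_scaleC_right form_minus
  form_diff

lemma nrm_square: "(nrm x)\<^sup>2 = Re (form x x)"
  by (simp add: nrm_def form_nonneg)

lemma nrm_nonneg: "0 \<le> nrm x"
  by (simp add: nrm_def form_nonneg)

lemma form_self: "form x x = complex_of_real ((nrm x)\<^sup>2)"
  using form_commute[of x x] by (simp add: complex_eq_iff nrm_square)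

lemma nrm_scaleC: "nrm (c *\<^sub>C x) = cmod c * nrm x"
proof -
  have "Re (c * (cnj c * form x x)) = (cmod c)\<^sup>2 * Re (form x x)"
    unfolding cmod_power2 by (simp add: power2_eq_square algebra_simps)
  moreover have "form (c *\<^sub>C x) (c *\<^sub>C x) = c * (cnj c * form x x)"
    by (simp add: form_simps mult.left_commute)
  ultimately show ?thesis by (simp add: nrm_def real_sqrt_mult del: times_complex.sel)
qed

lemma nrm_minus: "nrm (- x) = nrm x"
  by (simp add: nrm_def form_minus)

lemma nrm_minus_commute: "nrm (x - y) = nrm (y - x)"
  using nrm_minus[of "x - y"] by simp

lemma form_Cauchy_Schwarz: "cmod (form x y) \<le> nrm x * nrm y"
proof (rule power2_le_imp_le)
  have "0 \<le> Re (form y y) + 2 * Re (c * form x y) + (cmod c)\<^sup>2 * Re (form x x)" for c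
  proof -
    have "0 \<le> Re (form (y + c *\<^sub>C x) (y + c *\<^sub>C x))" by (rule form_nonneg)
    also have "\<dots> = Re (form y y) + (Re (c * form x y) + Re (cnj c * form y x))
        + Re (c * (cnj c * form x x))"
      by (simp add: form_simps distrib_left mult.left_commute del: times_complex.sel)
    also have "Re (cnj c * form y x) = Re (c * form x y)"
      using form_commute[of y x] by simp
    also have "Re (c * (cnj c * form x x)) = (cmod c)\<^sup>2 * Re (form x x)"
      unfolding cmod_power2 by (simp add: power2_eq_square algebra_simps)
    finally show ?thesis by simp
  qed
  then have "(cmod (form x y))\<^sup>2 \<le> Re (form y y) * Re (form x x)"
    by (intro norm_sq_le_if_quadratic_nonneg form_nonneg)
  then show "(cmod (form x y))\<^sup>2 \<le> (nrm x * nrm y)\<^sup>2"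
    by (simp add: power_mult_distrib nrm_square mult.commute)
qed (simp add: nrm_nonneg)

lemma nrm_triangle: "nrm (x + y) \<le> nrm x + nrm y"
proof (rule power2_le_imp_le)
  have "Re (form x y) \<le> nrm x * nrm y" "Re (form y x) \<le> nrm x * nrm y"
    using form_Cauchy_Schwarz[of x y] form_Cauchy_Schwarz[of y x]
      complex_Re_le_cmod[of "form x y"] complex_Re_le_cmod[of "form y x"]
    by (simp_all add: mult.commute)
  then show "(nrm (x + y))\<^sup>2 \<le> (nrm x + nrm y)\<^sup>2"
    unfolding nrm_square power2_sum by (simp add: form_simps nrm_square)
qed (simp add: nrm_nonneg)

lemma nrm_triangle_diff: "nrm (x - z) \<le> nrm (x - y) + nrm (y - z)"
  using nrm_triangle[of "x - y" "y - z"] by simp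

definition cauchy :: "(nat \<Rightarrow> 'b) \<Rightarrow> bool" where
  "cauchy b \<longleftrightarrow> (\<forall>\<epsilon>>0. \<exists>N. \<forall>m\<ge>N. \<forall>n\<ge>N. nrm (b m - b n) < \<epsilon>)"

lemma cauchy_const: "cauchy (\<lambda>_. x)"
  by (simp add: cauchy_def nrm_def)

lemma cauchy_bounded:
  assumes "cauchy b" obtains K where "K > 0" "\<And>n. nrm (b n) \<le> K"
proof -
  obtain N where N: "\<And>m n. m \<ge> N \<Longrightarrow> n \<ge> N \<Longrightarrow> nrm (b m - b n) < 1"
    using assms by (fastforce simp: cauchy_def)
  define K where "K = nrm (b N) + 1 + (\<Sum>n<N. nrm (b n))"
  have "nrm (b n) \<le> K" for n
  proof (cases "n < N")
    case True
    then have "nrm (b n) \<le> (\<Sum>n<N. nrm (b n))" by (intro member_le_sum) (auto simp: nrm_nonneg)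
    then show ?thesis using nrm_nonneg[of "b N"] by (simp add: K_def)
  next
    case False
    then show ?thesis
      using N[of n N] nrm_triangle[of "b n - b N" "b N"] sum_nonneg[of "{..<N}" "\<lambda>n. nrm (b n)"]
      by (simp add: K_def nrm_nonneg)
  qed
  moreover have "K > 0"
    unfolding K_def by (intro add_pos_nonneg add_nonneg_pos nrm_nonneg sum_nonneg) simp
  ultimately show thesis using that by blast
qed

lemma cauchy_contraction:
  assumes b: "cauchy b" and le: "\<And>m n. nrm (c m - c n) \<le> K * nrm (b m - b n)" and K: "K \<ge> 0"
  shows "cauchy c"
  unfolding cauchy_def
proof (intro allI impI)
  fix \<epsilon> :: real assume \<epsilon>: "\<epsilon> > 0"
  obtain N where N: "\<And>m n. m \<ge> N \<Longrightarrow> n \<ge> N \<Longrightarrow> nrm (b m - b n) < \<epsilon> / (K + 1)"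
    using b \<epsilon> K unfolding cauchy_def by (metis add_nonneg_pos divide_pos_pos zero_less_one)
  have "nrm (c m - c n) < \<epsilon>" if "m \<ge> N" "n \<ge> N" for m n
  proof -
    have "nrm (c m - c n) \<le> (K + 1) * nrm (b m - b n)"
      using le[of m n] nrm_nonneg[of "b m - b n"] by (simp add: distrib_right)
    also have "\<dots> < (K + 1) * (\<epsilon> / (K + 1))" using N[OF that] K by (intro mult_strict_left_mono) auto
    also have "\<dots> = \<epsilon>" using K by simp
    finally show ?thesis .
  qed
  then show "\<exists>N. \<forall>m\<ge>N. \<forall>n\<ge>N. nrm (c m - c n) < \<epsilon>" by blast
qed

lemma cauchy_add:
  assumes "cauchy b" "cauchy c" shows "cauchy (\<lambda>n. b n + c n)"
  unfolding cauchy_def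
proof (intro allI impI)
  fix \<epsilon> :: real assume "\<epsilon> > 0"
  then have "\<epsilon> / 2 > 0" by simp
  then obtain N M where "\<And>m n. m \<ge> N \<Longrightarrow> n \<ge> N \<Longrightarrow> nrm (b m - b n) < \<epsilon> / 2"
    "\<And>m n. m \<ge> M \<Longrightarrow> n \<ge> M \<Longrightarrow> nrm (c m - c n) < \<epsilon> / 2"
    using assms unfolding cauchy_def by metis
  then have "nrm (b m + c m - (b n + c n)) < \<epsilon>" if "m \<ge> max N M" "n \<ge> max N M" for m n
    using that nrm_triangle[of "b m - b n" "c m - c n"] by (force simp: add_diff_add)
  then show "\<exists>N. \<forall>m\<ge>N. \<forall>n\<ge>N. nrm (b m + c m - (b n + c n)) < \<epsilon>" by blast
qed

lemma cauchy_scaleC: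
  assumes "cauchy b" shows "cauchy (\<lambda>n. c *\<^sub>C b n)"
  by (rule cauchy_contraction[OF assms, where K = "cmod c"])
    (simp_all add: nrm_scaleC complex_vector.scale_right_diff_distrib[symmetric])

lemma cauchy_minus: "cauchy b \<Longrightarrow> cauchy (\<lambda>n. - b n)"
  using cauchy_scaleC[of b "-1"] by (simp add: complex_vector.scale_minus_left scaleC_one)

lemma cauchy_diff: "cauchy b \<Longrightarrow> cauchy c \<Longrightarrow> cauchy (\<lambda>n. b n - c n)"
  using cauchy_add[of b "\<lambda>n. - c n"] by (simp add: cauchy_minus)

lemma form_tendsto_zero:
  assumes d: "(\<lambda>n. nrm (d n)) \<longlonglongrightarrow> 0" and c: "\<And>n. nrm (c n) \<le> K"
  shows "(\<lambda>n. form (d n) (c n)) \<longlonglongrightarrow> 0" "(\<lambda>n. form (c n) (d n)) \<longlonglongrightarrow> 0"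
proof -
  show *: "(\<lambda>n. form (d n) (c n)) \<longlonglongrightarrow> 0"
  proof (rule Lim_null_comparison)
    show "\<forall>\<^sub>F n in sequentially. norm (form (d n) (c n)) \<le> nrm (d n) * K"
      using c by (intro always_eventually allI order_trans[OF form_Cauchy_Schwarz] mult_left_mono)
        (simp_all add: nrm_nonneg)
    show "(\<lambda>n. nrm (d n) * K) \<longlonglongrightarrow> 0" using tendsto_mult_right[OF d, of K] by simp
  qed
  show "(\<lambda>n. form (c n) (d n)) \<longlonglongrightarrow> 0"
    using tendsto_cnj[OF *] by (simp add: form_commute[of "c _"])
qed

lemma form_convergent:
  assumes b: "cauchy b" and c: "cauchy c" shows "convergent (\<lambda>n. form (b n) (c n))"
proof -
  obtain K where K: "K > 0" "\<And>n. nrm (b n) \<le> K" using cauchy_bounded[OF b] by blast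
  obtain L where L: "L > 0" "\<And>n. nrm (c n) \<le> L" using cauchy_bounded[OF c] by blast
  have "Cauchy (\<lambda>n. form (b n) (c n))"
    unfolding Cauchy_def
  proof (intro allI impI)
    fix \<epsilon> :: real assume \<epsilon>: "\<epsilon> > 0"
    have "\<epsilon> / (2 * L) > 0" "\<epsilon> / (2 * K) > 0" using \<epsilon> K L by simp_all
    then obtain N M where
      N: "\<And>m n. m \<ge> N \<Longrightarrow> n \<ge> N \<Longrightarrow> nrm (b m - b n) < \<epsilon> / (2 * L)" and
      M: "\<And>m n. m \<ge> M \<Longrightarrow> n \<ge> M \<Longrightarrow> nrm (c m - c n) < \<epsilon> / (2 * K)"
      using b c unfolding cauchy_def by metis
    have "dist (form (b m) (c m)) (form (b n) (c n)) < \<epsilon>" if "m \<ge> max N M" "n \<ge> max N M" for m n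
    proof -
      have "form (b m) (c m) - form (b n) (c n) = form (b m - b n) (c m) + form (b n) (c m - c n)"
        by (simp add: form_simps)
      then have "dist (form (b m) (c m)) (form (b n) (c n))
          \<le> cmod (form (b m - b n) (c m)) + cmod (form (b n) (c m - c n))"
        by (simp add: dist_norm norm_triangle_ineq)
      also have "\<dots> \<le> nrm (b m - b n) * L + K * nrm (c m - c n)"
        using K L by (intro add_mono order_trans[OF form_Cauchy_Schwarz] mult_mono)
          (simp_all add: nrm_nonneg)
      also have "\<dots> < \<epsilon> / (2 * L) * L + K * (\<epsilon> / (2 * K))"
        using N[of m n] M[of m n] that K L
        by (intro add_strict_mono mult_strict_right_mono mult_strict_left_mono) auto
      also have "\<dots> = \<epsilon>" using K L by simp
      finally show ?thesis .
    qed
    then show "\<exists>N. \<forall>m\<ge>N. \<forall>n\<ge>N. dist (form (b m) (c m)) (form (b n) (c n)) < \<epsilon>" by blast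
  qed
  then show ?thesis by (rule Cauchy_convergent)
qed

definition null :: "(nat \<Rightarrow> 'b) \<Rightarrow> bool" where "null d \<longleftrightarrow> (\<lambda>n. nrm (d n)) \<longlonglongrightarrow> 0"

lemma null_add: "null c \<Longrightarrow> null d \<Longrightarrow> null (\<lambda>n. c n + d n)"
  unfolding null_def
  by (rule Lim_null_comparison[where g = "\<lambda>n. nrm (c n) + nrm (d n)"])
    (use tendsto_add[of "\<lambda>n. nrm (c n)" 0 sequentially "\<lambda>n. nrm (d n)" 0] in
      \<open>auto simp: nrm_nonneg nrm_triangle\<close>)

lemma null_contraction:
  "null d \<Longrightarrow> (\<And>n. nrm (c n) \<le> K * nrm (d n)) \<Longrightarrow> null c"
  unfolding null_def
  by (rule Lim_null_comparison[where g = "\<lambda>n. K * nrm (d n)"])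
    (use tendsto_mult_left[of "\<lambda>n. nrm (d n)" 0 sequentially K] in \<open>auto simp: nrm_nonneg\<close>)

lemma null_scaleC:
  assumes "null d" shows "null (\<lambda>n. c *\<^sub>C d n)"
  by (rule null_contraction[OF assms, where K = "cmod c"]) (simp add: nrm_scaleC)

text \<open>In \<open>form (d n) (d n) = form (d n) (d n - d M) + form (d n) (d M)\<close> the first
  summand is small because the sequence is Cauchy and bounded, the second because \<open>d M\<close>
  is a fixed vector. Hence the limits of scalar products alone identify a point of the
  completion.\<close>

lemma cauchy_weakly_null:
  assumes d: "cauchy d" and w: "\<And>y. (\<lambda>n. form (d n) y) \<longlonglongrightarrow> 0" shows "null d"
  unfolding null_def LIMSEQ_def
proof (intro allI impI)
  fix \<epsilon> :: real assume \<epsilon>: "\<epsilon> > 0"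
  obtain K where K: "K > 0" "\<And>n. nrm (d n) \<le> K" using cauchy_bounded[OF d] by blast
  have "\<epsilon>\<^sup>2 / (2 * K) > 0" using \<epsilon> K by simp
  then obtain M where M: "\<And>m n. m \<ge> M \<Longrightarrow> n \<ge> M \<Longrightarrow> nrm (d m - d n) < \<epsilon>\<^sup>2 / (2 * K)"
    using d unfolding cauchy_def by metis
  have "\<epsilon>\<^sup>2 / 2 > 0" using \<epsilon> by simp
  from LIMSEQ_D[OF w[of "d M"] this] obtain N
    where N: "\<And>n. n \<ge> N \<Longrightarrow> cmod (form (d n) (d M)) < \<epsilon>\<^sup>2 / 2" by auto
  have "nrm (d n) < \<epsilon>" if n: "n \<ge> max M N" for n
  proof (rule power2_less_imp_less)
    have "(nrm (d n))\<^sup>2 = cmod (form (d n) (d n))"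
      by (simp add: form_self norm_power nrm_nonneg)
    also have "form (d n) (d n) = form (d n) (d n - d M) + form (d n) (d M)"
      by (simp add: form_simps)
    also have "cmod \<dots> \<le> cmod (form (d n) (d n - d M)) + cmod (form (d n) (d M))"
      by (rule norm_triangle_ineq)
    also have "\<dots> < K * (\<epsilon>\<^sup>2 / (2 * K)) + \<epsilon>\<^sup>2 / 2"
    proof (rule add_le_less_mono)
      have "cmod (form (d n) (d n - d M)) \<le> nrm (d n) * nrm (d n - d M)"
        by (rule form_Cauchy_Schwarz)
      also have "\<dots> \<le> K * (\<epsilon>\<^sup>2 / (2 * K))"
        using K M[of n M] n by (intro mult_mono) (auto simp: nrm_nonneg intro: less_imp_le)
      finally show "cmod (form (d n) (d n - d M)) \<le> K * (\<epsilon>\<^sup>2 / (2 * K))" .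
    qed (use N n in simp)
    also have "\<dots> = \<epsilon>\<^sup>2" using K by simp
    finally show "(nrm (d n))\<^sup>2 < \<epsilon>\<^sup>2" .
  qed (use \<epsilon> in simp)
  then show "\<exists>N. \<forall>n\<ge>N. dist (nrm (d n)) 0 < \<epsilon>" by (auto simp: nrm_nonneg intro!: exI[of _ "max M N"])
qed

end

text \<open>The points of the completion are named by an arbitrary complete invariant \<open>q\<close> of Cauchy
  sequences modulo null sequences, so that the completion can be placed in a given type.\<close>

locale completion = semi_inner form
  for form :: "'b::cstar_algebra \<Rightarrow> 'b \<Rightarrow> complex" +
  fixes q :: "(nat \<Rightarrow> 'b) \<Rightarrow> 'h"
  assumes q_eq_iff: "cauchy b \<Longrightarrow> cauchy c \<Longrightarrow> q b = q c \<longleftrightarrow> null (\<lambda>n. b n - c n)"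
begin

definition rep :: "'h \<Rightarrow> nat \<Rightarrow> 'b" where "rep x = (SOME b. cauchy b \<and> q b = x)"

text \<open>The operations use chosen representatives; \<open>hadd_q\<close>,
  \<open>hscale_q\<close> and \<open>hinner_q\<close> show that any other Cauchy sequence of the
  class gives the same result.\<close>

definition H :: "'h hilb" where
  "H = \<lparr>hcarrier = q ` {b. cauchy b}, hadd = \<lambda>x y. q (\<lambda>n. rep x n + rep y n), hzero = q (\<lambda>_. 0),
     hscale = \<lambda>c x. q (\<lambda>n. c *\<^sub>C rep x n), hinner = \<lambda>x y. lim (\<lambda>n. form (rep x n) (rep y n))\<rparr>"

lemma rep: "cauchy b \<Longrightarrow> cauchy (rep (q b)) \<and> q (rep (q b)) = q b"
  unfolding rep_def by (rule someI[of _ b]) simp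

lemma null_rep: "cauchy b \<Longrightarrow> null (\<lambda>n. rep (q b) n - b n)"
  using rep[of b] q_eq_iff by blast

lemma q_in: "cauchy b \<Longrightarrow> q b \<in> hcarrier H"
  by (simp add: H_def)

lemma in_HE:
  assumes "x \<in> hcarrier H" obtains b where "cauchy b" "x = q b"
  using assms by (auto simp: H_def)

lemma hadd_q:
  assumes "cauchy b" "cauchy c" shows "hadd H (q b) (q c) = q (\<lambda>n. b n + c n)"
proof -
  have "null (\<lambda>n. (rep (q b) n - b n) + (rep (q c) n - c n))"
    by (intro null_add null_rep assms)
  then have "null (\<lambda>n. rep (q b) n + rep (q c) n - (b n + c n))"
    by (simp add: add_diff_add)
  then show ?thesis
    using assms rep by (simp add: H_def q_eq_iff cauchy_add)
qed

lemma hscale_q: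
  assumes "cauchy b" shows "hscale H c (q b) = q (\<lambda>n. c *\<^sub>C b n)"
proof -
  have "null (\<lambda>n. c *\<^sub>C (rep (q b) n - b n))"
    by (intro null_scaleC null_rep assms)
  then show ?thesis
    using assms rep
    by (simp add: H_def q_eq_iff cauchy_scaleC complex_vector.scale_right_diff_distrib)
qed

lemma hzero_q: "hzero H = q (\<lambda>_. 0)"
  by (simp add: H_def)

lemma hinner_q:
  assumes b: "cauchy b" and c: "cauchy c"
  shows "(\<lambda>n. form (b n) (c n)) \<longlonglongrightarrow> hinner H (q b) (q c)"
proof -
  let ?b = "rep (q b)" and ?c = "rep (q c)"
  have rb: "cauchy ?b" and rc: "cauchy ?c" using rep b c by auto
  obtain K where K: "\<And>n. nrm (?c n) \<le> K" using cauchy_bounded[OF rc] by blast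
  obtain L where L: "\<And>n. nrm (b n) \<le> L" using cauchy_bounded[OF b] by blast
  have 1: "(\<lambda>n. form (?b n - b n) (?c n)) \<longlonglongrightarrow> 0"
    using null_rep[OF b] K unfolding null_def by (rule form_tendsto_zero)
  have 2: "(\<lambda>n. form (b n) (?c n - c n)) \<longlonglongrightarrow> 0"
    using null_rep[OF c] L unfolding null_def by (rule form_tendsto_zero)
  have 3: "(\<lambda>n. form (?b n) (?c n)) \<longlonglongrightarrow> hinner H (q b) (q c)"
    using form_convergent[OF rb rc] by (simp add: H_def convergent_LIMSEQ_iff)
  from tendsto_diff[OF 3 tendsto_add[OF 1 2]] show ?thesis by (simp add: form_simps)
qed

lemma hinner_q_eqI:
  assumes "cauchy b" "cauchy c" "(\<lambda>n. form (b n) (c n)) \<longlonglongrightarrow> l"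
  shows "hinner H (q b) (q c) = l"
  using hinner_q[OF assms(1,2)] assms(3) by (rule LIMSEQ_unique)

lemma hnorm_q: "cauchy b \<Longrightarrow> (\<lambda>n. nrm (b n)) \<longlonglongrightarrow> hnorm H (q b)"
  unfolding nrm_def hnorm_def by (intro tendsto_real_sqrt tendsto_Re hinner_q)

lemma hdist_q:
  assumes "cauchy b" "cauchy c" shows "(\<lambda>n. nrm (b n - c n)) \<longlonglongrightarrow> hdist H (q b) (q c)"
proof -
  have "hdist H (q b) (q c) = hnorm H (q (\<lambda>n. b n - c n))"
    using assms by (simp add: hdist_def hnorm_def Let_def hscale_q hadd_q cauchy_minus)
  then show ?thesis using hnorm_q[OF cauchy_diff[OF assms]] by simp
qed

text \<open>A diagonal argument: \<open>c n\<close> is a term of the \<open>n\<close>-th sequence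
  beyond which that sequence moves by less than \<open>1 / (n + 1)\<close>. The constant sequence at
  \<open>c n\<close> is then this close to \<open>X n\<close>, and the class of \<open>c\<close> is
  the limit.\<close>

lemma H_complete:
  assumes X: "\<And>n. X n \<in> hcarrier H"
    and cau: "\<And>\<epsilon>. \<epsilon> > 0 \<Longrightarrow> \<exists>N. \<forall>m\<ge>N. \<forall>n\<ge>N. hdist H (X m) (X n) < \<epsilon>"
  shows "\<exists>x\<in>hcarrier H. (\<lambda>n. hdist H (X n) x) \<longlonglongrightarrow> 0"
proof -
  have "\<exists>b. cauchy b \<and> X n = q b" for n using X[of n] in_HE by blast
  then obtain b where b: "\<And>n. cauchy (b n)" "\<And>n. X n = q (b n)" by metis
  have "\<exists>k. \<forall>m\<ge>k. nrm (b n m - b n k) < 1 / (real n + 1)" for n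
    using b(1)[of n] unfolding cauchy_def by (metis of_nat_0_le_iff add_nonneg_pos order_refl
        zero_less_divide_1_iff zero_less_one)
  then obtain k where k: "\<And>n m. m \<ge> k n \<Longrightarrow> nrm (b n m - b n (k n)) < 1 / (real n + 1)" by metis
  define c where "c n = b n (k n)" for n
  have to_const: "hdist H (X n) (q (\<lambda>_. c n)) \<le> 1 / (real n + 1)" for n
  proof (rule LIMSEQ_le_const2)
    show "(\<lambda>m. nrm (b n m - c n)) \<longlonglongrightarrow> hdist H (X n) (q (\<lambda>_. c n))"
      unfolding b(2) by (rule hdist_q[OF b(1) cauchy_const])
    show "\<exists>N. \<forall>m\<ge>N. nrm (b n m - c n) \<le> 1 / (real n + 1)"
      using k unfolding c_def by (blast intro: less_imp_le)
  qed
  have tri: "hdist H (q x) (q z) \<le> hdist H (q x) (q y) + hdist H (q y) (q z)"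
    if "cauchy x" "cauchy y" "cauchy z" for x y z
    by (rule LIMSEQ_le[OF hdist_q[OF that(1,3)] tendsto_add[OF hdist_q[OF that(1,2)] hdist_q[OF that(2,3)]]])
      (blast intro: nrm_triangle_diff)
  have sym: "hdist H (q x) (q y) = hdist H (q y) (q x)" if "cauchy x" "cauchy y" for x y
    using hdist_q[OF that] hdist_q[OF that(2,1)]
    unfolding nrm_minus_commute[of "x _"] by (rule LIMSEQ_unique)
  have const: "hdist H (q (\<lambda>_. x)) (q (\<lambda>_. y)) = nrm (x - y)" for x y
    using hdist_q[OF cauchy_const cauchy_const, of x y] by (simp add: LIMSEQ_const_iff)
  have c_diff: "nrm (c m - c n) \<le> 1 / (real m + 1) + hdist H (X m) (X n) + 1 / (real n + 1)" for m n
  proof -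
    have "nrm (c m - c n) = hdist H (q (\<lambda>_. c m)) (q (\<lambda>_. c n))" by (simp add: const)
    also have "\<dots> \<le> hdist H (q (\<lambda>_. c m)) (q (b m)) + (hdist H (q (b m)) (q (b n))
        + hdist H (q (b n)) (q (\<lambda>_. c n)))"
      using tri[OF cauchy_const[of "c m"] b(1)[of m] cauchy_const[of "c n"]]
        tri[OF b(1)[of m] b(1)[of n] cauchy_const[of "c n"]] by linarith
    also have "\<dots> \<le> 1 / (real m + 1) + (hdist H (X m) (X n) + 1 / (real n + 1))"
      using to_const[of m] to_const[of n] sym[OF cauchy_const[of "c m"] b(1)[of m]] by (simp add: b(2))
    finally show ?thesis by simp
  qed
  have small: "\<exists>N. \<forall>n\<ge>N. 1 / (real n + 1) < \<epsilon>" if \<epsilon>: "\<epsilon> > 0" for \<epsilon> :: real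
  proof -
    obtain N where "1 / real (Suc N) < \<epsilon>" using nat_approx_posE[OF \<epsilon>] by blast
    then have N: "1 / (real N + 1) < \<epsilon>" by (simp add: add.commute)
    have "1 / (real n + 1) \<le> 1 / (real N + 1)" if "n \<ge> N" for n
      using that by (simp add: field_simps)
    with N show ?thesis by (meson le_less_trans)
  qed
  have c: "cauchy c"
    unfolding cauchy_def
  proof (intro allI impI)
    fix \<epsilon> :: real assume "\<epsilon> > 0"
    then have "\<epsilon> / 3 > 0" by simp
    from small[OF this] cau[OF this] obtain M N
      where M: "\<And>n. n \<ge> M \<Longrightarrow> 1 / (real n + 1) < \<epsilon> / 3"
        and N: "\<And>m n. m \<ge> N \<Longrightarrow> n \<ge> N \<Longrightarrow> hdist H (X m) (X n) < \<epsilon> / 3"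
      by blast
    have "nrm (c m - c n) < \<epsilon>" if "m \<ge> max M N" "n \<ge> max M N" for m n
      using c_diff[of m n] M[of m] M[of n] N[of m n] that by simp
    then show "\<exists>N. \<forall>m\<ge>N. \<forall>n\<ge>N. nrm (c m - c n) < \<epsilon>" by blast
  qed
  have "(\<lambda>n. hdist H (X n) (q c)) \<longlonglongrightarrow> 0"
    unfolding LIMSEQ_def
  proof (intro allI impI)
    fix \<epsilon> :: real assume "\<epsilon> > 0"
    then have "\<epsilon> / 3 > 0" by simp
    from small[OF this] c obtain M N
      where M: "\<And>n. n \<ge> M \<Longrightarrow> 1 / (real n + 1) < \<epsilon> / 3"
        and N: "\<And>m n. m \<ge> N \<Longrightarrow> n \<ge> N \<Longrightarrow> nrm (c m - c n) < \<epsilon> / 3"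
      unfolding cauchy_def using \<open>\<epsilon> / 3 > 0\<close> by metis
    have "dist (hdist H (X n) (q c)) 0 < \<epsilon>" if n: "n \<ge> max M N" for n
    proof -
      have "hdist H (q (\<lambda>_. c n)) (q c) \<le> \<epsilon> / 3"
      proof (rule LIMSEQ_le_const2)
        show "(\<lambda>m. nrm (c n - c m)) \<longlonglongrightarrow> hdist H (q (\<lambda>_. c n)) (q c)"
          by (rule hdist_q[OF cauchy_const c])
        show "\<exists>N. \<forall>m\<ge>N. nrm (c n - c m) \<le> \<epsilon> / 3"
          using N[of n] n by (auto intro!: exI[of _ N] less_imp_le)
      qed
      moreover have "hdist H (X n) (q c) \<le> hdist H (X n) (q (\<lambda>_. c n)) + hdist H (q (\<lambda>_. c n)) (q c)"
        unfolding b(2) by (rule tri[OF b(1) cauchy_const c])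
      moreover have "0 \<le> hdist H (X n) (q c)"
        unfolding b(2) by (rule LIMSEQ_le_const[OF hdist_q[OF b(1) c]]) (simp add: nrm_nonneg)
      ultimately show ?thesis using to_const[of n] M[of n] n \<open>\<epsilon> > 0\<close> by simp
    qed
    then show "\<exists>N. \<forall>n\<ge>N. dist (hdist H (X n) (q c)) 0 < \<epsilon>" by blast
  qed
  with q_in[OF c] show ?thesis by blast
qed

lemma hilbert_space_H: "hilbert_space H"
proof
  note ci = cauchy_add cauchy_scaleC cauchy_minus cauchy_const
  note qs = hadd_q hscale_q hzero_q ci
  show "hzero H \<in> hcarrier H" by (simp add: hzero_q q_in cauchy_const)
  show "hadd H x y \<in> hcarrier H" if "x \<in> hcarrier H" "y \<in> hcarrier H" for x y
    using that by (elim in_HE) (simp add: qs q_in)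
  show "hscale H c x \<in> hcarrier H" if "x \<in> hcarrier H" for c x
    using that by (elim in_HE) (simp add: qs q_in)
  show "hadd H (hadd H x y) z = hadd H x (hadd H y z)"
    if "x \<in> hcarrier H" "y \<in> hcarrier H" "z \<in> hcarrier H" for x y z
    using that by (elim in_HE) (simp add: qs add.assoc)
  show "hadd H x y = hadd H y x" if "x \<in> hcarrier H" "y \<in> hcarrier H" for x y
    using that by (elim in_HE) (simp add: qs add.commute)
  show "hadd H (hzero H) x = x" if "x \<in> hcarrier H" for x
    using that by (elim in_HE) (simp add: qs)
  show "hadd H x (hscale H (- 1) x) = hzero H" if "x \<in> hcarrier H" for x
    using that by (elim in_HE) (simp add: qs complex_vector.scale_minus_left scaleC_one)
  show "hscale H c (hadd H x y) = hadd H (hscale H c x) (hscale H c y)"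
    if "x \<in> hcarrier H" "y \<in> hcarrier H" for c x y
    using that by (elim in_HE) (simp add: qs scaleC_add_right)
  show "hscale H (c + d) x = hadd H (hscale H c x) (hscale H d x)" if "x \<in> hcarrier H" for c d x
    using that by (elim in_HE) (simp add: qs scaleC_add_left)
  show "hscale H c (hscale H d x) = hscale H (c * d) x" if "x \<in> hcarrier H" for c d x
    using that by (elim in_HE) (simp add: qs scaleC_scaleC)
  show "hscale H 1 x = x" if "x \<in> hcarrier H" for x
    using that by (elim in_HE) (simp add: qs scaleC_one)
  show "hinner H (hadd H x y) z = hinner H x z + hinner H y z"
    if xyz: "x \<in> hcarrier H" "y \<in> hcarrier H" "z \<in> hcarrier H" for x y z
  proof -
    from xyz obtain b c d where *: "cauchy b" "cauchy c" "cauchy d" "x = q b" "y = q c" "z = q d"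
      by (meson in_HE)
    then have "(\<lambda>n. form (b n) (d n) + form (c n) (d n)) \<longlonglongrightarrow> hinner H x z + hinner H y z"
      by (auto intro: tendsto_add hinner_q)
    with * show ?thesis
      by (auto simp: qs form_simps intro!: hinner_q_eqI)
  qed
  show "hinner H (hscale H c x) y = c * hinner H x y" if xy: "x \<in> hcarrier H" "y \<in> hcarrier H" for c x y
  proof -
    from xy obtain b d where *: "cauchy b" "cauchy d" "x = q b" "y = q d" by (meson in_HE)
    then have "(\<lambda>n. c * form (b n) (d n)) \<longlonglongrightarrow> c * hinner H x y"
      by (auto intro: tendsto_mult_left hinner_q)
    with * show ?thesis
      by (auto simp: qs form_simps intro!: hinner_q_eqI)
  qed
  show "hinner H x y = cnj (hinner H y x)" if xy: "x \<in> hcarrier H" "y \<in> hcarrier H" for x y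
  proof -
    from xy obtain b d where *: "cauchy b" "cauchy d" "x = q b" "y = q d" by (meson in_HE)
    then have "(\<lambda>n. cnj (form (d n) (b n))) \<longlonglongrightarrow> cnj (hinner H y x)"
      by (auto intro: tendsto_cnj hinner_q)
    with * show ?thesis
      by (auto simp: form_commute[symmetric] intro!: hinner_q_eqI)
  qed
  show "0 \<le> Re (hinner H x x)" if x: "x \<in> hcarrier H" for x
  proof -
    from x obtain b where b: "cauchy b" "x = q b" by (rule in_HE)
    show ?thesis
      unfolding b(2) by (rule LIMSEQ_le_const[OF tendsto_Re[OF hinner_q[OF b(1) b(1)]]])
        (simp add: form_nonneg)
  qed
  show "x = hzero H" if x: "x \<in> hcarrier H" "hinner H x x = 0" for x
  proof -
    from x(1) obtain b where b: "cauchy b" "x = q b" by (rule in_HE)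
    have "hnorm H x = 0" using x(2) by (simp add: hnorm_def)
    then have "null b" using hnorm_q[OF b(1)] by (simp add: null_def b(2))
    then show ?thesis using b by (simp add: hzero_q q_eq_iff cauchy_const)
  qed
qed (rule H_complete)

end

section \<open>The GNS representation inside a given type\<close>

locale gns = semi_inner form + unital_cstar e
  for form :: "'b::cstar_algebra \<Rightarrow> 'b \<Rightarrow> complex" and e :: 'b +
  fixes w :: "'i \<Rightarrow> 'b" and u :: "('i \<Rightarrow> complex) \<Rightarrow> 'h"
  assumes form_star: "form (b * x) y = form x (star b * y)"
    and dense: "closed_cspan (range w) = UNIV"
    and inj_u: "inj u"
begin

text \<open>The positive element \<open>(norm b * norm b) *\<^sub>R e - star b * b\<close> is the
  square of a self-adjoint \<open>y\<close>, so its expectation at \<open>x\<close> is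
  \<open>form (y * x) (y * x)\<close> and nonnegative.\<close>

lemma nrm_mult_le: "nrm (b * x) \<le> norm b * nrm x"
proof (rule power2_le_imp_le)
  obtain y where y: "star y = y" "y * y = (norm b * norm b) *\<^sub>R e - star b * b"
    using positive_sqrt[OF positive_norm_square] by metis
  have "0 \<le> Re (form (y * x) (y * x))" by (rule form_nonneg)
  also have "form (y * x) (y * x) = form x ((y * y) * x)" by (simp only: form_star y(1) mult.assoc)
  also have "(y * y) * x = complex_of_real (norm b * norm b) *\<^sub>C x - (star b * b) * x"
    by (simp add: y left_diff_distrib scaleC_of_real del: of_real_mult)
  also have "form x \<dots> = complex_of_real (norm b * norm b) * form x x - form (b * x) (b * x)"
    by (simp add: form_simps form_star mult.assoc del: of_real_mult)
  finally have "Re (form (b * x) (b * x)) \<le> norm b * norm b * Re (form x x)" by simp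
  then show "(nrm (b * x))\<^sup>2 \<le> (norm b * nrm x)\<^sup>2"
    unfolding power_mult_distrib nrm_square by (simp add: power2_eq_square)
qed (simp add: nrm_nonneg)

lemma nrm_le: "nrm x \<le> norm x * nrm e"
  using nrm_mult_le[of x e] by simp

lemma weakly_null_if_null_on_dense:
  assumes d: "cauchy d" and w: "\<And>i. (\<lambda>n. form (d n) (w i)) \<longlonglongrightarrow> 0"
  shows "(\<lambda>n. form (d n) y) \<longlonglongrightarrow> 0"
proof -
  define Y where "Y = {y. (\<lambda>n. form (d n) y) \<longlonglongrightarrow> 0}"
  obtain K where K: "K > 0" "\<And>n. nrm (d n) \<le> K" using cauchy_bounded[OF d] by blast
  have "csubspace Y"
    unfolding complex_vector.subspace_def
  proof (intro conjI ballI allI)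
    show "x + y \<in> Y" if "x \<in> Y" "y \<in> Y" for x y
      using tendsto_add[of _ 0 sequentially _ 0] that by (fastforce simp: Y_def form_simps)
    show "c *\<^sub>C x \<in> Y" if "x \<in> Y" for c x
      using tendsto_mult_left[of _ 0 sequentially "cnj c"] that by (fastforce simp: Y_def form_simps)
  qed (simp add: Y_def)
  moreover have "range w \<subseteq> Y" using w by (auto simp: Y_def)
  ultimately have span: "cspan (range w) \<subseteq> Y" by (intro complex_vector.span_minimal)
  show ?thesis
    unfolding LIMSEQ_def
  proof (intro allI impI)
    fix \<epsilon> :: real assume \<epsilon>: "\<epsilon> > 0"
    \<comment> \<open>Chosen so that \<open>K * (\<delta> * (nrm e + 1)) = \<epsilon> / 2\<close>;
      the summand 1 covers the case \<open>nrm e = 0\<close>.\<close>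
    define \<delta> where "\<delta> = \<epsilon> / (2 * K * (nrm e + 1))"
    have \<delta>: "\<delta> > 0" using \<epsilon> K nrm_nonneg[of e] by (simp add: \<delta>_def add_nonneg_pos)
    have "y \<in> closure (cspan (range w))" using dense by (auto simp: closed_cspan_def)
    then obtain z where z: "z \<in> cspan (range w)" "norm (y - z) < \<delta>"
      using \<delta> by (metis closure_approachable dist_norm norm_minus_commute)
    then have "(\<lambda>n. form (d n) z) \<longlonglongrightarrow> 0" using span by (auto simp: Y_def)
    from LIMSEQ_D[OF this, of "\<epsilon> / 2"] \<epsilon> obtain N
      where N: "\<And>n. n \<ge> N \<Longrightarrow> cmod (form (d n) z) < \<epsilon> / 2" by auto
    have "dist (form (d n) y) 0 < \<epsilon>" if "n \<ge> N" for n
    proof -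
      have "form (d n) y = form (d n) (y - z) + form (d n) z" by (simp add: form_simps)
      then have "cmod (form (d n) y) \<le> cmod (form (d n) (y - z)) + cmod (form (d n) z)"
        by (metis norm_triangle_ineq)
      moreover have "cmod (form (d n) (y - z)) \<le> \<epsilon> / 2"
      proof -
        have "cmod (form (d n) (y - z)) \<le> nrm (d n) * nrm (y - z)" by (rule form_Cauchy_Schwarz)
        also have "\<dots> \<le> K * (\<delta> * (nrm e + 1))"
        proof (rule mult_mono)
          have "nrm (y - z) \<le> norm (y - z) * nrm e" by (rule nrm_le)
          also have "\<dots> \<le> \<delta> * (nrm e + 1)" using z \<delta> by (intro mult_mono) (auto simp: nrm_nonneg)
          finally show "nrm (y - z) \<le> \<delta> * (nrm e + 1)" .
        qed (use K in \<open>auto simp: nrm_nonneg\<close>)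
        also have "\<dots> = \<epsilon> / 2"
        proof -
          have "nrm e + 1 \<noteq> 0" using nrm_nonneg[of e] by simp
          then show ?thesis using K by (simp add: \<delta>_def)
        qed
        finally show ?thesis .
      qed
      ultimately show ?thesis using N[OF that] by simp
    qed
    then show "\<exists>N. \<forall>n\<ge>N. dist (form (d n) y) 0 < \<epsilon>" by blast
  qed
qed

text \<open>A class is named by its scalar products with the family \<open>w\<close>. They determine
  the class because \<open>w\<close> has dense span, and the resulting function on the index type is
  what \<open>u\<close> can carry into \<open>'h\<close>.\<close>

definition q :: "(nat \<Rightarrow> 'b) \<Rightarrow> 'h" where
  "q b = u (\<lambda>i. lim (\<lambda>n. form (b n) (w i)))"

sublocale completion form q
proof
  fix b c assume b: "cauchy b" and c: "cauchy c"
  have lim: "(\<lambda>n. form (f n) (w i)) \<longlonglongrightarrow> lim (\<lambda>n. form (f n) (w i))" if "cauchy f" for f i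
    using form_convergent[OF that cauchy_const] by (simp add: convergent_LIMSEQ_iff)
  have d: "cauchy (\<lambda>n. b n - c n)" by (rule cauchy_diff[OF b c])
  have lim_diff: "(\<lambda>n. form (b n - c n) (w i)) \<longlonglongrightarrow>
      lim (\<lambda>n. form (b n) (w i)) - lim (\<lambda>n. form (c n) (w i))" for i
    unfolding form_simps by (intro tendsto_diff lim b c)
  have "q b = q c \<longleftrightarrow> (\<forall>i. lim (\<lambda>n. form (b n) (w i)) - lim (\<lambda>n. form (c n) (w i)) = 0)"
    by (simp add: q_def inj_eq[OF inj_u] fun_eq_iff)
  also have "\<dots> \<longleftrightarrow> (\<forall>i. (\<lambda>n. form (b n - c n) (w i)) \<longlonglongrightarrow> 0)"
  proof -
    have "lim (\<lambda>n. form (b n) (w i)) - lim (\<lambda>n. form (c n) (w i)) = 0 \<longleftrightarrow>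
        (\<lambda>n. form (b n - c n) (w i)) \<longlonglongrightarrow> 0" for i
    proof
      show "(\<lambda>n. form (b n - c n) (w i)) \<longlonglongrightarrow> 0"
        if "lim (\<lambda>n. form (b n) (w i)) - lim (\<lambda>n. form (c n) (w i)) = 0"
        using lim_diff[of i] unfolding that .
    qed (rule LIMSEQ_unique[OF lim_diff])
    then show ?thesis by simp
  qed
  also have "\<dots> \<longleftrightarrow> null (\<lambda>n. b n - c n)"
  proof
    assume w: "\<forall>i. (\<lambda>n. form (b n - c n) (w i)) \<longlonglongrightarrow> 0"
    show "null (\<lambda>n. b n - c n)"
      by (rule cauchy_weakly_null[OF d weakly_null_if_null_on_dense[OF d w[rule_format]]])
  next
    assume "null (\<lambda>n. b n - c n)"
    then show "\<forall>i. (\<lambda>n. form (b n - c n) (w i)) \<longlonglongrightarrow> 0"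
      unfolding null_def by (intro allI form_tendsto_zero(1)[OF _ order_refl])
  qed
  finally show "q b = q c \<longleftrightarrow> null (\<lambda>n. b n - c n)" .
qed

definition \<sigma> :: "'b \<Rightarrow> 'h \<Rightarrow> 'h" where
  "\<sigma> b = (\<lambda>x\<in>hcarrier H. q (\<lambda>n. b * rep x n))"

lemma cauchy_mult:
  assumes "cauchy c" shows "cauchy (\<lambda>n. b * c n)"
  by (rule cauchy_contraction[OF assms, where K = "norm b"])
    (simp_all add: nrm_mult_le right_diff_distrib[symmetric])

lemma \<sigma>_q: "cauchy c \<Longrightarrow> \<sigma> b (q c) = q (\<lambda>n. b * c n)"
proof -
  assume c: "cauchy c"
  have "null (\<lambda>n. b * (rep (q c) n - c n))"
    by (rule null_contraction[OF null_rep[OF c], where K = "norm b"]) (simp add: nrm_mult_le)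
  then show ?thesis
    using c rep by (simp add: \<sigma>_def q_in q_eq_iff cauchy_mult right_diff_distrib)
qed

lemma gns_bounded_ops: "\<sigma> b \<in> bounded_ops H"
proof -
  interpret hilbert_space H by (rule hilbert_space_H)
  note qs = hadd_q hscale_q cauchy_add cauchy_scaleC cauchy_mult \<sigma>_q q_in
  show ?thesis
  proof (rule bounded_opsI)
    show "\<sigma> b x \<in> hcarrier H" if "x \<in> hcarrier H" for x
      using that by (elim in_HE) (simp add: qs)
    show "\<sigma> b (hadd H x y) = hadd H (\<sigma> b x) (\<sigma> b y)" if "x \<in> hcarrier H" "y \<in> hcarrier H" for x y
      using that by (elim in_HE) (simp add: qs distrib_left)
    show "\<sigma> b (hscale H c x) = hscale H c (\<sigma> b x)" if "x \<in> hcarrier H" for c x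
      using that by (elim in_HE) (simp add: qs mult_scaleC_right)
    show "hnorm H (\<sigma> b x) \<le> norm b * hnorm H x" if x: "x \<in> hcarrier H" for x
    proof -
      from x obtain c where c: "cauchy c" "x = q c" by (rule in_HE)
      show ?thesis
        unfolding c(2) \<sigma>_q[OF c(1)]
        by (rule LIMSEQ_le[OF hnorm_q[OF cauchy_mult[OF c(1)]] tendsto_mult_left[OF hnorm_q[OF c(1)]]])
          (blast intro: nrm_mult_le)
    qed
  qed (simp add: \<sigma>_def)
qed

lemma gns_representation: "nondegenerate_representation H \<sigma>"
proof -
  interpret hilbert_space H by (rule hilbert_space_H)
  note qs = hadd_q hscale_q cauchy_add cauchy_scaleC cauchy_mult \<sigma>_q q_in
  have unit: "\<sigma> e x = x" if "x \<in> hcarrier H" for x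
    using that by (elim in_HE) (simp add: qs)
  have "representation H \<sigma>"
    unfolding representation_def
  proof (intro conjI allI ballI gns_bounded_ops)
    show "\<sigma> (b + c) x = hadd H (\<sigma> b x) (\<sigma> c x)" if "x \<in> hcarrier H" for b c x
      using that by (elim in_HE) (simp add: qs distrib_right)
    show "\<sigma> (z *\<^sub>C b) x = hscale H z (\<sigma> b x)" if "x \<in> hcarrier H" for z b x
      using that by (elim in_HE) (simp add: qs mult_scaleC_left)
    show "\<sigma> (b * c) = hcomp H (\<sigma> b) (\<sigma> c)" for b c
    proof (rule bounded_ops_eqI)
      show "\<sigma> (b * c) x = hcomp H (\<sigma> b) (\<sigma> c) x" if x: "x \<in> hcarrier H" for x
        using x by (simp add: compose_def) (elim in_HE, simp add: qs mult.assoc)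
    qed (intro gns_bounded_ops bounded_ops_hcomp)+
    show "\<sigma> (star b) = hadjoint H (\<sigma> b)" for b
    proof (rule sym, rule hadjointI)
      show "hinner H (\<sigma> b x) y = hinner H x (\<sigma> (star b) y)"
        if xy: "x \<in> hcarrier H" "y \<in> hcarrier H" for x y
      proof -
        from xy obtain c d where *: "cauchy c" "cauchy d" "x = q c" "y = q d" by (meson in_HE)
        have "(\<lambda>n. form (b * c n) (d n)) \<longlonglongrightarrow> hinner H (q c) (q (\<lambda>n. star b * d n))"
          unfolding form_star by (intro hinner_q cauchy_mult *)
        with * show ?thesis by (simp add: \<sigma>_q) (intro hinner_q_eqI cauchy_mult)
      qed
    qed (rule gns_bounded_ops)+
  qed
  moreover have "hclosed_span H {\<sigma> b x | b x. x \<in> hcarrier H} = hcarrier H"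
  proof
    have "hclosed_subspace H (hcarrier H)"
      by (auto simp: hclosed_subspace_def closed_intros)
    moreover have "{\<sigma> b x | b x. x \<in> hcarrier H} \<subseteq> hcarrier H"
      using bounded_opsD(1)[OF gns_bounded_ops] by blast
    ultimately show "hclosed_span H {\<sigma> b x | b x. x \<in> hcarrier H} \<subseteq> hcarrier H"
      by (auto simp: hclosed_span_def)
    have "x \<in> {\<sigma> b x | b x. x \<in> hcarrier H}" if "x \<in> hcarrier H" for x
      using unit[OF that] that by (auto intro!: exI[of _ e] exI[of _ x])
    then show "hcarrier H \<subseteq> hclosed_span H {\<sigma> b x | b x. x \<in> hcarrier H}"
      unfolding hclosed_span_def by blast
  qed
  ultimately show ?thesis by (simp add: nondegenerate_representation_def)
qed

lemma gns_cyclic_vector: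
  "q (\<lambda>_. e) \<in> hcarrier H" "hnorm H (\<sigma> b (q (\<lambda>_. e))) = nrm b" "hnorm H (q (\<lambda>_. e)) = nrm e"
proof -
  have const: "hnorm H (q (\<lambda>_. b)) = nrm b" for b
    using hnorm_q[OF cauchy_const[of b]] by (simp add: LIMSEQ_const_iff)
  then show "hnorm H (\<sigma> b (q (\<lambda>_. e))) = nrm b" "hnorm H (q (\<lambda>_. e)) = nrm e"
    by (simp_all add: \<sigma>_q cauchy_const)
qed (simp add: q_in cauchy_const)

lemma gns_kernel:
  assumes "\<And>x. nrm (b * x) = 0" "x \<in> hcarrier H" shows "\<sigma> b x = hzero H"
  using assms(2)
  by (elim in_HE) (simp add: \<sigma>_q hzero_q q_eq_iff cauchy_mult cauchy_const null_def assms(1))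

end

text \<open>GNS for the functional that attains the quotient norm at \<open>x\<close>. The vector
  \<open>\<xi>\<close> is the class of \<open>e\<close>, so the squared norm of
  \<open>\<sigma> x \<xi>\<close> is the value at \<open>star x * x\<close>. An element
  \<open>i\<close> of \<open>N\<close> acts as zero since \<open>star (i * y) * (i * y)\<close> lies
  in \<open>N\<close>, where the functional vanishes.\<close>

theorem (in unital_cstar) exists_representation_attaining_ideal_norm:
  fixes w :: "'i \<Rightarrow> 'b" and u :: "('i \<Rightarrow> complex) \<Rightarrow> 'h" and N :: "'b set"
  assumes dense: "closed_cspan (range w) = UNIV" and u: "inj u"
    and N: "closed_ideal N" "N \<noteq> UNIV"
  obtains H :: "'h hilb" and \<sigma> \<xi> where "hilbert_space H" "nondegenerate_representation H \<sigma>"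
    "\<And>i x. i \<in> N \<Longrightarrow> x \<in> hcarrier H \<Longrightarrow> \<sigma> i x = hzero H"
    "\<xi> \<in> hcarrier H" "hnorm H \<xi> \<le> 1" "ideal_norm N x \<le> hnorm H (\<sigma> x \<xi>)"
proof -
  obtain \<phi> :: "'b \<Rightarrow> complex" where
    add: "\<And>y z. \<phi> (y + z) = \<phi> y + \<phi> z" and scale: "\<And>c y. \<phi> (c *\<^sub>C y) = c * \<phi> y" and
    star: "\<And>y. \<phi> (star y) = cnj (\<phi> y)" and pos: "\<And>y. Re (\<phi> (star y * y)) \<ge> 0" and
    zero: "\<And>i. i \<in> N \<Longrightarrow> \<phi> i = 0" and unit: "Re (\<phi> e) \<le> 1" and
    attain: "(ideal_norm N x)\<^sup>2 \<le> Re (\<phi> (star x * x))"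
    by (rule exists_functional_attaining_ideal_norm[OF N]) blast
  define form where "form x y = \<phi> (star y * x)" for x y
  interpret gns form e w u
  proof
    fix x y z b :: 'b and c :: complex
    show "form (x + y) z = form x z + form y z" by (simp add: form_def distrib_left add)
    show "form (c *\<^sub>C x) y = c * form x y" by (simp add: form_def mult_scaleC_right scale)
    show "form x y = cnj (form y x)" by (simp add: form_def star[symmetric] star_simps)
    show "form (b * x) y = form x (star b * y)" by (simp add: form_def star_simps mult.assoc)
  qed (simp_all add: form_def pos dense u)
  show thesis
  proof (rule that[OF hilbert_space_H gns_representation _ gns_cyclic_vector(1)])
    show "\<sigma> i x = hzero H" if "i \<in> N" "x \<in> hcarrier H" for i x
    proof (rule gns_kernel)
      show "nrm (i * x) = 0" for x
      proof -
        have "star (i * x) * (i * x) \<in> N" by (intro closed_ideal_mult N that)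
        then show ?thesis by (simp add: nrm_def form_def zero)
      qed
    qed fact
    have "sqrt (Re (\<phi> e)) \<le> 1" using unit by simp
    then show "hnorm H (q (\<lambda>_. e)) \<le> 1" by (simp add: gns_cyclic_vector nrm_def form_def)
    show "ideal_norm N x \<le> hnorm H (\<sigma> x (q (\<lambda>_. e)))"
      using attain by (simp add: gns_cyclic_vector nrm_def form_def real_le_rsqrt)
  qed
qed


section \<open>Representations of unital C*-algebras\<close>

lemma representationD:
  assumes "representation H \<sigma>"
  shows "\<sigma> b \<in> bounded_ops H"
    "x \<in> hcarrier H \<Longrightarrow> \<sigma> (b + c) x = hadd H (\<sigma> b x) (\<sigma> c x)"
    "x \<in> hcarrier H \<Longrightarrow> \<sigma> (z *\<^sub>C b) x = hscale H z (\<sigma> b x)"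
    "\<sigma> (b * c) = hcomp H (\<sigma> b) (\<sigma> c)"
    "x \<in> hcarrier H \<Longrightarrow> \<sigma> (b * c) x = \<sigma> b (\<sigma> c x)"
    "\<sigma> (star b) = hadjoint H (\<sigma> b)"
  using assms by (auto simp: representation_def compose_def)

text \<open>Over a unital algebra non-degeneracy amounts to \<open>\<sigma> e = hid H\<close>; the
  equivalence is \<open>unital_representationI\<close> together with
  \<open>nondegenerate_rep\<close>. The equation avoids closed spans.\<close>

locale unital_representation = hilbert_space H + unital_cstar e
  for H :: "'h hilb" and e :: "'b::cstar_algebra" +
  fixes \<sigma> :: "'b \<Rightarrow> 'h \<Rightarrow> 'h"
  assumes rep: "representation H \<sigma>" and rep_unit: "\<sigma> e = hid H"
begin

lemmas repD = representationD[OF rep]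

lemma rep_closed: "x \<in> C \<Longrightarrow> \<sigma> b x \<in> C"
  using bounded_opsD(1)[OF repD(1)] .

lemma rep_star: "x \<in> C \<Longrightarrow> y \<in> C \<Longrightarrow> ip (\<sigma> b x) y = ip x (\<sigma> (star b) y)"
  using hadjoint(2)[OF repD(1)] by (simp add: repD(6))

lemma rep_scaleR: "x \<in> C \<Longrightarrow> \<sigma> (r *\<^sub>R b) x = hscale H (complex_of_real r) (\<sigma> b x)"
  by (simp add: scaleR_eq_scaleC repD(3))

lemma rep_minus: "x \<in> C \<Longrightarrow> \<sigma> (- b) x = hscale H (- 1) (\<sigma> b x)"
  using repD(3)[of x "-1" b] by (simp add: complex_vector.scale_minus_left scaleC_one)

lemma hinner_rep_additive: "x \<in> C \<Longrightarrow> y \<in> C \<Longrightarrow> ip (\<sigma> (b + c) x) y = ip (\<sigma> b x) y + ip (\<sigma> c x) y"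
  by (simp add: repD(2) hinner_add_left rep_closed)

lemma hinner_rep_minus: "x \<in> C \<Longrightarrow> y \<in> C \<Longrightarrow> ip (\<sigma> (- b) x) y = - ip (\<sigma> b x) y"
  by (simp add: rep_minus hinner_scale_left rep_closed)

lemma hinner_rep_diff: "x \<in> C \<Longrightarrow> y \<in> C \<Longrightarrow> ip (\<sigma> (b - c) x) y = ip (\<sigma> b x) y - ip (\<sigma> c x) y"
  using hinner_rep_additive[of x y b "- c"] by (simp add: hinner_rep_minus)

lemma rep_contractive:
  assumes x: "x \<in> C" shows "hnorm H (\<sigma> b x) \<le> norm b * hnorm H x"
proof (rule power2_le_imp_le)
  obtain y where y: "star y = y" "y * y = (norm b * norm b) *\<^sub>R e - star b * b"
    using positive_sqrt[OF positive_norm_square] by metis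
  have "0 \<le> Re (ip (\<sigma> y x) (\<sigma> y x))" by (intro hinner_nonneg rep_closed x)
  also have "ip (\<sigma> y x) (\<sigma> y x) = cnj (ip (\<sigma> (y * y) x) x)"
    using rep_star[OF x rep_closed[OF x], of y y] hinner_commute[OF x rep_closed[OF x], of "y * y"]
    by (simp add: y(1) repD(5) x)
  also have "ip (\<sigma> (y * y) x) x
      = complex_of_real (norm b * norm b) * ip (\<sigma> e x) x - ip (\<sigma> (star b * b) x) x"
    using x unfolding y(2)
    by (simp add: hinner_rep_diff rep_scaleR hinner_scale_left rep_closed del: of_real_mult)
  also have "ip (\<sigma> (star b * b) x) x = ip (\<sigma> b x) (\<sigma> b x)"
    using rep_star[OF rep_closed[OF x] x, of "star b" b] by (simp add: repD(5) x star_star)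
  also have "\<sigma> e x = x" using x by (simp add: rep_unit hid_def)
  finally have "Re (ip (\<sigma> b x) (\<sigma> b x)) \<le> norm b * norm b * Re (ip x x)" by simp
  then show "(hnorm H (\<sigma> b x))\<^sup>2 \<le> (norm b * hnorm H x)\<^sup>2"
    unfolding power_mult_distrib hnorm_square[OF x] hnorm_square[OF rep_closed[OF x]]
    by (simp add: power2_eq_square)
qed (simp add: hnorm_nonneg x)

lemma bounded_linear_hinner_rep:
  assumes x: "x \<in> C" and y: "y \<in> C" shows "bounded_linear (\<lambda>b. ip (\<sigma> b x) y)"
proof (rule bounded_linear_intro[where K = "hnorm H x * hnorm H y"])
  show "ip (\<sigma> (r *\<^sub>R b) x) y = r *\<^sub>R ip (\<sigma> b x) y" for r b
    using assms by (simp add: rep_scaleR hinner_scale_left rep_closed scaleR_conv_of_real)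
  show "norm (ip (\<sigma> b x) y) \<le> norm b * (hnorm H x * hnorm H y)" for b
  proof -
    have "norm (ip (\<sigma> b x) y) \<le> hnorm H (\<sigma> b x) * hnorm H y"
      using assms by (intro Cauchy_Schwarz rep_closed)
    also have "\<dots> \<le> (norm b * hnorm H x) * hnorm H y"
      using assms by (intro mult_right_mono rep_contractive hnorm_nonneg)
    finally show ?thesis by (simp add: mult.assoc)
  qed
qed (use assms in \<open>simp add: hinner_rep_additive\<close>)

lemma rep_eqI:
  assumes "\<And>x y. x \<in> C \<Longrightarrow> y \<in> C \<Longrightarrow> ip (\<sigma> b x) y = ip (f x) y" "f \<in> bounded_ops H"
  shows "\<sigma> b = f"
  using assms bounded_opsD(1)[OF assms(2)]
  by (intro bounded_ops_eqI hinner_eqI repD(1)) (auto simp: rep_closed)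

text \<open>Matrix coefficients are bounded linear functionals of \<open>b\<close>, which makes
  closedness of the kernel immediate.\<close>

definition rep_kernel :: "'b set" where
  "rep_kernel = {b. \<forall>x\<in>C. \<forall>y\<in>C. ip (\<sigma> b x) y = 0}"

lemma rep_kernel_iff: "b \<in> rep_kernel \<longleftrightarrow> (\<forall>x\<in>C. \<sigma> b x = hzero H)"
proof
  show "\<forall>x\<in>C. \<sigma> b x = hzero H" if "b \<in> rep_kernel"
    using that by (auto simp: rep_kernel_def hinner_zero_left closed_intros rep_closed intro!: hinner_eqI)
qed (auto simp: rep_kernel_def hinner_zero_left)

lemma closed_ideal_rep_kernel: "closed_ideal rep_kernel"
  unfolding closed_ideal_def
proof (intro conjI ballI allI)
  show "csubspace rep_kernel"
    unfolding complex_vector.subspace_def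
  proof (intro conjI ballI allI)
    show "0 \<in> rep_kernel"
      using hinner_rep_diff[of _ _ 0 0] by (auto simp: rep_kernel_def)
  qed (auto simp: rep_kernel_def hinner_rep_additive repD(3) hinner_scale_left rep_closed)
  have "rep_kernel = (\<Inter>x\<in>C. \<Inter>y\<in>C. {b. ip (\<sigma> b x) y = 0})"
    by (auto simp: rep_kernel_def)
  moreover have "closed {b. ip (\<sigma> b x) y = 0}" if "x \<in> C" "y \<in> C" for x y
    using linear_continuous_on[OF bounded_linear_hinner_rep[OF that]]
    by (intro closed_Collect_eq) auto
  ultimately show "closed rep_kernel" by (auto intro!: closed_INT)
  show "b * c \<in> rep_kernel" if "b \<in> rep_kernel" for b c
    using that by (auto simp: rep_kernel_def repD(5) rep_closed)
  show "c * b \<in> rep_kernel" if "b \<in> rep_kernel" for b c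
    using that by (auto simp: rep_kernel_def repD(5) rep_closed rep_star[of _ _ c])
qed

lemma rep_kernel_star_mult_self: "star b * b \<in> rep_kernel \<Longrightarrow> b \<in> rep_kernel"
  unfolding rep_kernel_iff
proof
  fix x assume b: "\<forall>x\<in>C. \<sigma> (star b * b) x = hzero H" and x: "x \<in> C"
  have "ip (\<sigma> b x) (\<sigma> b x) = ip x (\<sigma> (star b * b) x)"
    using rep_star[OF x rep_closed[OF x], of b b] by (simp add: repD(5) x)
  with b x show "\<sigma> b x = hzero H" by (intro hinner_definite) (auto simp: hinner_zero_right rep_closed)
qed

lemma rep_norm_le_ideal_norm:
  assumes N: "0 \<in> N" "N \<subseteq> rep_kernel" and x: "x \<in> C" "hnorm H x \<le> 1"
  shows "hnorm H (\<sigma> b x) \<le> ideal_norm N b"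
  unfolding ideal_norm_def
proof (rule cINF_greatest)
  fix i assume "i \<in> N"
  then have "ip (\<sigma> i x) z = 0" if "z \<in> C" for z using N x that by (auto simp: rep_kernel_def)
  then have "\<sigma> b x = \<sigma> (b + i) x"
    using x by (intro hinner_eqI) (auto simp: hinner_rep_additive rep_closed)
  then have "hnorm H (\<sigma> b x) \<le> norm (b + i) * hnorm H x"
    using rep_contractive[OF x(1), of "b + i"] by simp
  also have "\<dots> \<le> norm (b + i) * 1" using x by (intro mult_left_mono) auto
  finally show "hnorm H (\<sigma> b x) \<le> norm (b + i)" by simp
qed (use N in auto)

lemma nondegenerate_rep: "nondegenerate_representation H \<sigma>"
proof -
  have "hclosed_subspace H C" by (auto simp: hclosed_subspace_def closed_intros)
  then have "hclosed_span H {\<sigma> b x | b x. x \<in> C} \<subseteq> C"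
    unfolding hclosed_span_def using rep_closed by blast
  moreover have "x \<in> {\<sigma> b x | b x. x \<in> C}" if "x \<in> C" for x
    using that rep_unit by (auto simp: hid_def intro!: exI[of _ e] exI[of _ x])
  then have "C \<subseteq> hclosed_span H {\<sigma> b x | b x. x \<in> C}"
    unfolding hclosed_span_def by blast
  ultimately show ?thesis using rep by (auto simp: nondegenerate_representation_def)
qed

text \<open>Over a unital algebra the defining equation at \<open>b = e\<close> already determines
  the operator, so the definite description disappears.\<close>

lemma multiplier_extension_unital:
  "multiplier_extension H \<sigma> m = \<sigma> (mult_left m e)"
  unfolding multiplier_extension_def
proof (rule the_equality)
  have "mult_left m b = mult_left m e * b" for b
  proof -
    have "mult_left m (x * y) = mult_left m x * y" for x y
      by transfer (auto simp: double_centraliser_def)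
    from this[of e b] show ?thesis by simp
  qed
  then show "\<sigma> (mult_left m e) \<in> bounded_ops H \<and>
      (\<forall>b. \<forall>x\<in>C. \<sigma> (mult_left m e) (\<sigma> b x) = \<sigma> (mult_left m b) x)"
    using repD(1) by (metis repD(5))
  fix f assume f: "f \<in> bounded_ops H \<and> (\<forall>b. \<forall>x\<in>C. f (\<sigma> b x) = \<sigma> (mult_left m b) x)"
  show "f = \<sigma> (mult_left m e)"
  proof (rule bounded_ops_eqI)
    fix x assume x: "x \<in> C"
    then have "f (\<sigma> e x) = \<sigma> (mult_left m e) x" using f by blast
    then show "f x = \<sigma> (mult_left m e) x" using x by (simp add: rep_unit hid_def)
  qed (use f repD(1) in auto)
qed

end

text \<open>The operator \<open>\<sigma> e\<close> fixes every vector of the form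
  \<open>\<sigma> b x\<close>, hence their closed span, which is the whole space.\<close>

lemma unital_representationI:
  assumes "hilbert_space H" "unital_cstar e" "nondegenerate_representation H \<sigma>"
  shows "unital_representation H e \<sigma>"
proof -
  interpret hilbert_space H by fact
  interpret unital_cstar e by fact
  have rep: "representation H \<sigma>" and span: "hclosed_span H {\<sigma> b x | b x. x \<in> C} = C"
    using assms(3) by (auto simp: nondegenerate_representation_def)
  have "hclosed_subspace H {x \<in> C. \<sigma> e x = hid H x}"
    by (rule hclosed_subspace_equalizer[OF assms(1) representationD(1)[OF rep] hid_bounded_ops])
  moreover have "{\<sigma> b x | b x. x \<in> C} \<subseteq> {x \<in> C. \<sigma> e x = hid H x}"
    using bounded_opsD(1)[OF representationD(1)[OF rep]]
    by (auto simp: hid_def representationD(5)[OF rep, symmetric])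
  ultimately have "hclosed_span H {\<sigma> b x | b x. x \<in> C} \<subseteq> {x \<in> C. \<sigma> e x = hid H x}"
    unfolding hclosed_span_def by blast
  then have "\<sigma> e = hid H"
    by (intro bounded_ops_eqI[OF representationD(1)[OF rep] hid_bounded_ops]) (auto simp: span)
  with rep show ?thesis by unfold_locales
qed


section \<open>The correspondence of covariant representations\<close>

lemma star_homD:
  assumes "star_hom f"
  shows "f (x + y) = f x + f y" "f (c *\<^sub>C x) = c *\<^sub>C f x" "f (x * y) = f x * f y"
    "f (star x) = star (f x)"
  using assms by (auto simp: star_hom_def)

lemma unital_cstar_one: "unital_cstar (1 :: 'a::{cstar_algebra, monoid_mult})"
  by unfold_locales auto

locale extendible_pair =
  fixes \<beta> L :: "'s::comm_monoid_add \<Rightarrow> 'a::{cstar_algebra, monoid_mult} \<Rightarrow> 'a"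
  assumes beta_action: "endomorphic_action \<beta>"
    and L_action: "endomorphic_action L"
    and beta_one: "\<beta> s 1 = 1"
    and L_transfer: "transfer_operator (\<beta> s) (L s)"
    and beta_L: "\<beta> s \<circ> L s = id"
begin

lemma beta_hom: "star_hom (\<beta> s)" and L_hom: "star_hom (L s)"
  using beta_action L_action by (auto simp: endomorphic_action_def)

lemma beta_L_apply: "\<beta> s (L s a) = a"
  using beta_L[of s] by (simp add: fun_eq_iff)

lemma L_beta_mult: "L s (\<beta> s a * b) = a * L s b"
  using L_transfer[of s] by (auto simp: transfer_operator_def)

lemma L_beta: "L s (\<beta> s a) = a * L s 1"
  using L_beta_mult[of s a 1] by simp

lemma L_factor: "L s 1 * L s a = L s a"
  using star_homD(3)[OF L_hom, of s 1 a] by simp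

text \<open>Continuity is no part of \<open>star_hom\<close>; it comes from contractivity of unital
  *-homomorphisms. The transfer identity is multiplicativity of \<open>\<beta> s\<close> combined
  with \<open>\<beta> s \<circ> L s = id\<close>.\<close>

lemma beta_transfer: "transfer_operator (L s) (\<beta> s)"
  unfolding transfer_operator_def bounded_clinear_def
proof (intro conjI allI impI)
  note hom = star_homD[OF beta_hom]
  show "bounded_linear (\<beta> s)"
  proof (rule bounded_linear_intro[where K = 1])
    show "norm (\<beta> s x) \<le> norm x * 1" for x
      using star_hom_contractive[OF unital_cstar_one unital_cstar_one beta_hom beta_one] by simp
  qed (simp_all add: hom scaleR_eq_scaleC)
  show "positive_elem (\<beta> s a)" if "positive_elem a" for a
    using that by (auto simp: positive_elem_def hom)
qed (simp_all add: star_homD[OF beta_hom] beta_L_apply)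

end

text \<open>Adjoints reverse products; commutativity of the semigroup restores the order.\<close>

lemma (in hilbert_space) semigroup_representation_hadjoint:
  assumes "semigroup_representation H V"
  shows "semigroup_representation H (\<lambda>s. hadjoint H (V s))"
  unfolding semigroup_representation_def
proof (intro conjI allI)
  have V: "V s \<in> bounded_ops H" "V (s + t) = hcomp H (V s) (V t)" "V 0 = hid H" for s t
    using assms by (auto simp: semigroup_representation_def)
  show "hadjoint H (V s) \<in> bounded_ops H" for s by (intro hadjoint V)
  show "hadjoint H (V (s + t)) = hcomp H (hadjoint H (V s)) (hadjoint H (V t))" for s t
    unfolding add.commute[of s t] V(2) by (intro hadjoint_hcomp V)
  show "hadjoint H (V 0) = hid H" by (simp add: V hadjoint_hid)
qed

lemma compose_apply: "x \<in> A \<Longrightarrow> compose A f g x = f (g x)"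
  by (simp add: compose_def)

context extendible_pair
begin

text \<open>(TC2) at \<open>a = 1\<close> makes \<open>V s\<close> an isometry, which is the extra
  relation on the right. For (TC1) of the adjoints, note that
  \<open>L s (\<beta> s a) = a * L s 1\<close> and that \<open>\<pi> (L s 1)\<close> fixes the range
  of \<open>V s\<close>; so \<open>V s\<close> intertwines \<open>\<pi> (\<beta> s a)\<close> with
  \<open>\<pi> a\<close>, and adjoints are taken. (TC2) is the extra relation on the left.\<close>

lemma adjoint_pair_left:
  assumes H: "hilbert_space H" and p: "p \<in> left_pairs H \<beta> L"
  shows "adjoint_pair H p \<in> right_pairs H \<beta> L"
proof -
  interpret hilbert_space H by fact
  obtain \<pi> V where pV: "p = (\<pi>, V)" by fastforce
  have cov: "toeplitz_covariant H L \<beta> \<pi> V"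
    and left: "hcomp H (V s) (hcomp H (\<pi> a) (hadjoint H (V s))) = \<pi> (L s a)" for s a
    using p by (auto simp: pV left_pairs_def)
  have V: "semigroup_representation H V" and nd: "nondegenerate_representation H \<pi>"
    and c1: "hcomp H (V s) (\<pi> a) = hcomp H (\<pi> (L s a)) (V s)"
    and c2: "hcomp H (hadjoint H (V s)) (hcomp H (\<pi> a) (V s)) = \<pi> (\<beta> s a)" for s a
    using cov by (auto simp: toeplitz_covariant_def)
  interpret unital_representation H 1 \<pi>
    by (rule unital_representationI[OF H unital_cstar_one nd])
  have Vb: "V s \<in> bounded_ops H" for s using V by (simp add: semigroup_representation_def)
  note Vc = bounded_opsD(1)[OF Vb] and Vadj = hadjoint[OF Vb]
  note Wc = bounded_opsD(1)[OF Vadj(1)]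
  have one: "\<pi> 1 x = x" if "x \<in> C" for x using that by (simp add: rep_unit hid_def)
  have 1: "V s (\<pi> a x) = \<pi> (L s a) (V s x)" if "x \<in> C" for s a x
    using fun_cong[OF c1[of s a], of x] that by (simp add: compose_apply)
  have 2: "hadjoint H (V s) (\<pi> a (V s x)) = \<pi> (\<beta> s a) x" if "x \<in> C" for s a x
    using fun_cong[OF c2[of s a], of x] that by (simp add: compose_apply)
  have W_V: "hadjoint H (V s) (V s x) = x" if "x \<in> C" for s x
    using 2[OF that, of s 1] that by (simp add: beta_one one Vc)
  have V_beta: "V s (\<pi> (\<beta> s a) x) = \<pi> a (V s x)" if x: "x \<in> C" for s a x
  proof -
    have "V s (\<pi> (\<beta> s a) x) = \<pi> a (\<pi> (L s 1) (V s x))"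
      using x by (simp add: 1 L_beta repD(5) Vc)
    also have "\<pi> (L s 1) (V s x) = V s x" using 1[OF x, of s 1] x by (simp add: one)
    finally show ?thesis .
  qed
  have W_pi: "hadjoint H (V s) (\<pi> a x) = \<pi> (\<beta> s a) (hadjoint H (V s) x)" if x: "x \<in> C" for s a x
  proof (rule hinner_eqI)
    fix z assume z: "z \<in> C"
    have "ip (hadjoint H (V s) (\<pi> a x)) z = ip x (\<pi> (star a) (V s z))"
      using x z by (simp add: Vadj(3)[symmetric] rep_closed Vc rep_star)
    also have "\<dots> = ip x (V s (\<pi> (star (\<beta> s a)) z))"
      using z by (simp add: V_beta[symmetric] star_homD(4)[OF beta_hom])
    also have "\<dots> = ip (\<pi> (\<beta> s a) (hadjoint H (V s) x)) z"
      using x z by (simp add: Vadj(3) rep_closed Wc rep_star)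
    finally show "ip (hadjoint H (V s) (\<pi> a x)) z = ip (\<pi> (\<beta> s a) (hadjoint H (V s) x)) z" .
  qed (use x in \<open>simp_all add: rep_closed Wc\<close>)
  show ?thesis
    unfolding pV adjoint_pair_def right_pairs_def toeplitz_covariant_def
  proof (simp only: prod.case mem_Collect_eq, intro conjI allI nd)
    show "semigroup_representation H (\<lambda>s. hadjoint H (V s))"
      by (rule semigroup_representation_hadjoint[OF V])
    show "hcomp H (hadjoint H (V s)) (\<pi> a) = hcomp H (\<pi> (\<beta> s a)) (hadjoint H (V s))" for s a
      by (intro bounded_ops_eqI bounded_ops_hcomp repD Vadj) (simp add: compose_apply W_pi)
    show "hcomp H (hadjoint H (hadjoint H (V s))) (hcomp H (\<pi> a) (hadjoint H (V s))) = \<pi> (L s a)"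
      for s a by (simp add: hadjoint_hadjoint[OF Vb] left)
    show "\<pi> a = hcomp H (\<pi> a) (hcomp H (hadjoint H (V s)) (hadjoint H (hadjoint H (V s))))" for s a
      by (intro bounded_ops_eqI bounded_ops_hcomp repD Vadj hadjoint)
        (simp add: compose_apply hadjoint_hadjoint[OF Vb] W_V)
  qed
qed

text \<open>The extra relation at \<open>a = 1\<close> says that \<open>W s\<close> is a coisometry.
  Inserting \<open>W s\<close> times its adjoint turns (TC2) into (TC1) for the adjoints and (TC1)
  into (TC2).\<close>

lemma adjoint_pair_right:
  assumes H: "hilbert_space H" and p: "p \<in> right_pairs H \<beta> L"
  shows "adjoint_pair H p \<in> left_pairs H \<beta> L"
proof -
  interpret hilbert_space H by fact
  obtain \<pi> W where pW: "p = (\<pi>, W)" by fastforce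
  have cov: "toeplitz_covariant H \<beta> L \<pi> W"
    and right: "\<pi> a = hcomp H (\<pi> a) (hcomp H (W s) (hadjoint H (W s)))" for s a
    using p by (auto simp: pW right_pairs_def)
  have W: "semigroup_representation H W" and nd: "nondegenerate_representation H \<pi>"
    and c1: "hcomp H (W s) (\<pi> a) = hcomp H (\<pi> (\<beta> s a)) (W s)"
    and c2: "hcomp H (hadjoint H (W s)) (hcomp H (\<pi> a) (W s)) = \<pi> (L s a)" for s a
    using cov by (auto simp: toeplitz_covariant_def)
  interpret unital_representation H 1 \<pi>
    by (rule unital_representationI[OF H unital_cstar_one nd])
  have Wb: "W s \<in> bounded_ops H" for s using W by (simp add: semigroup_representation_def)
  note Wc = bounded_opsD(1)[OF Wb] and Wadj = hadjoint[OF Wb]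
  note Vc = bounded_opsD(1)[OF Wadj(1)]
  have one: "\<pi> 1 x = x" if "x \<in> C" for x using that by (simp add: rep_unit hid_def)
  have 1: "W s (\<pi> a x) = \<pi> (\<beta> s a) (W s x)" if "x \<in> C" for s a x
    using fun_cong[OF c1[of s a], of x] that by (simp add: compose_apply)
  have 2: "hadjoint H (W s) (\<pi> a (W s x)) = \<pi> (L s a) x" if "x \<in> C" for s a x
    using fun_cong[OF c2[of s a], of x] that by (simp add: compose_apply)
  have W_V: "W s (hadjoint H (W s) x) = x" if "x \<in> C" for s x
    using fun_cong[OF right[of 1 s], of x] that by (simp add: compose_apply one Wc Vc)
  have V_pi: "hadjoint H (W s) (\<pi> a x) = \<pi> (L s a) (hadjoint H (W s) x)" if x: "x \<in> C" for s a x
    using 2[OF Vc[OF x], of s a s] x by (simp add: W_V)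
  have W_pi: "W s (\<pi> a (hadjoint H (W s) x)) = \<pi> (\<beta> s a) x" if x: "x \<in> C" for s a x
    using 1[OF Vc[OF x], of s a s] x by (simp add: W_V)
  show ?thesis
    unfolding pW adjoint_pair_def left_pairs_def toeplitz_covariant_def
  proof (simp only: prod.case mem_Collect_eq, intro conjI allI nd)
    show "semigroup_representation H (\<lambda>s. hadjoint H (W s))"
      by (rule semigroup_representation_hadjoint[OF W])
    show "hcomp H (hadjoint H (W s)) (\<pi> a) = hcomp H (\<pi> (L s a)) (hadjoint H (W s))" for s a
      by (intro bounded_ops_eqI bounded_ops_hcomp repD Wadj) (simp add: compose_apply V_pi)
    show "hcomp H (hadjoint H (hadjoint H (W s))) (hcomp H (\<pi> a) (hadjoint H (W s))) = \<pi> (\<beta> s a)"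
      for s a
      unfolding hadjoint_hadjoint[OF Wb]
      by (intro bounded_ops_eqI bounded_ops_hcomp repD Wadj Wb) (simp add: compose_apply W_pi)
    show "hcomp H (hadjoint H (W s)) (hcomp H (\<pi> a) (hadjoint H (hadjoint H (W s)))) = \<pi> (L s a)"
      for s a by (simp add: hadjoint_hadjoint[OF Wb] c2)
  qed
qed

lemma adjoint_pair_involutive:
  assumes "hilbert_space H" "semigroup_representation H (snd p)"
  shows "adjoint_pair H (adjoint_pair H p) = p"
  using assms hilbert_space.hadjoint_hadjoint[OF assms(1)]
  by (auto simp: adjoint_pair_def semigroup_representation_def split: prod.split)

lemma bij_betw_adjoint_pair:
  assumes H: "hilbert_space H"
  shows "bij_betw (adjoint_pair H) (left_pairs H \<beta> L) (right_pairs H \<beta> L)"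
proof (rule bij_betwI[where g = "adjoint_pair H"])
  show "adjoint_pair H (adjoint_pair H p) = p" if "p \<in> left_pairs H \<beta> L" for p
    using that by (intro adjoint_pair_involutive[OF H]) (auto simp: left_pairs_def toeplitz_covariant_def)
  show "adjoint_pair H (adjoint_pair H p) = p" if "p \<in> right_pairs H \<beta> L" for p
    using that by (intro adjoint_pair_involutive[OF H]) (auto simp: right_pairs_def toeplitz_covariant_def)
qed (auto simp: adjoint_pair_left[OF H] adjoint_pair_right[OF H])

end


section \<open>Isomorphisms of quotients from correspondences\<close>

lemma coset_eq_iff:
  assumes N: "closed_ideal N" shows "coset N x = coset N y \<longleftrightarrow> x - y \<in> N"
proof
  assume "coset N x = coset N y"
  moreover have "x + 0 \<in> coset N x" unfolding coset_def by (intro imageI closed_ideal_0 N)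
  ultimately obtain i where "i \<in> N" "x = y + i" by (auto simp: coset_def)
  then show "x - y \<in> N" by simp
next
  have *: "coset N x \<subseteq> coset N y" if "x - y \<in> N" for x y
  proof
    fix z assume "z \<in> coset N x"
    then obtain i where i: "i \<in> N" "z = y + ((x - y) + i)" by (auto simp: coset_def)
    then show "z \<in> coset N y" unfolding coset_def using closed_ideal_add[OF N that i(1)] by blast
  qed
  assume xy: "x - y \<in> N"
  then have "y - x \<in> N" using closed_ideal_minus[OF N xy] by simp
  with xy show "coset N x = coset N y" by (intro antisym *)
qed

lemma mem_coset_iff: "z \<in> coset N x \<longleftrightarrow> z - x \<in> N"
  by (force simp: coset_def image_iff algebra_simps)

lemma self_mem_coset: "closed_ideal N \<Longrightarrow> x \<in> coset N x"
  by (simp add: mem_coset_iff closed_ideal_0)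

text \<open>The operations of \<open>quotient_algebra\<close> are unions over representatives; once
  the result is independent of the representative, the union collapses.\<close>

lemma UN_coset_eq:
  assumes "closed_ideal N" "\<And>z. z - x \<in> N \<Longrightarrow> f z = f x"
  shows "(\<Union>z\<in>coset N x. f z) = f x"
proof -
  have "(\<Union>z\<in>coset N x. f z) = (\<Union>z\<in>coset N x. f x)"
    using assms(2) by (intro SUP_cong refl) (simp add: mem_coset_iff)
  also have "\<dots> = f x" using self_mem_coset[OF assms(1), of x] by auto
  finally show ?thesis .
qed

lemma quotient_algebra_simps:
  assumes N: "closed_ideal N"
  shows "sa_carrier (quotient_algebra N) = range (coset N)"
    "sa_add (quotient_algebra N) (coset N x) (coset N y) = coset N (x + y)"
    "sa_scale (quotient_algebra N) c (coset N x) = coset N (c *\<^sub>C x)"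
    "sa_mult (quotient_algebra N) (coset N x) (coset N y) = coset N (x * y)"
    "(\<And>z. z \<in> N \<Longrightarrow> star z \<in> N) \<Longrightarrow> sa_star (quotient_algebra N) (coset N x) = coset N (star x)"
    "sa_norm (quotient_algebra N) (coset N x) = ideal_norm N x"
proof -
  note eq = coset_eq_iff[OF N]
  show "sa_carrier (quotient_algebra N) = range (coset N)" by (simp add: quotient_algebra_def)
  have "(\<Union>y'\<in>coset N y. coset N (x' + y')) = coset N (x' + y)" for x'
    by (rule UN_coset_eq[OF N]) (simp add: eq)
  moreover have "(\<Union>x'\<in>coset N x. coset N (x' + y)) = coset N (x + y)"
    by (rule UN_coset_eq[OF N]) (simp add: eq)
  ultimately show "sa_add (quotient_algebra N) (coset N x) (coset N y) = coset N (x + y)"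
    by (simp add: quotient_algebra_def)
  have "(\<Union>x'\<in>coset N x. coset N (c *\<^sub>C x')) = coset N (c *\<^sub>C x)"
    using closed_ideal_scaleC[OF N]
    by (intro UN_coset_eq[OF N]) (simp add: eq complex_vector.scale_right_diff_distrib[symmetric])
  then show "sa_scale (quotient_algebra N) c (coset N x) = coset N (c *\<^sub>C x)"
    by (simp add: quotient_algebra_def)
  have "(\<Union>y'\<in>coset N y. coset N (x' * y')) = coset N (x' * y)" for x'
    by (rule UN_coset_eq[OF N])
      (simp add: eq right_diff_distrib[symmetric] closed_ideal_mult(2)[OF N])
  moreover have "(\<Union>x'\<in>coset N x. coset N (x' * y)) = coset N (x * y)"
    by (rule UN_coset_eq[OF N])
      (simp add: eq left_diff_distrib[symmetric] closed_ideal_mult(1)[OF N])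
  ultimately show "sa_mult (quotient_algebra N) (coset N x) (coset N y) = coset N (x * y)"
    by (simp add: quotient_algebra_def)
  show "sa_star (quotient_algebra N) (coset N x) = coset N (star x)"
    if "\<And>z. z \<in> N \<Longrightarrow> star z \<in> N"
  proof -
    have "(\<Union>x'\<in>coset N x. coset N (star x')) = coset N (star x)"
      by (rule UN_coset_eq[OF N]) (simp add: eq star_diff[symmetric] that)
    then show ?thesis by (simp add: quotient_algebra_def)
  qed
  show "sa_norm (quotient_algebra N) (coset N x) = ideal_norm N x"
    by (simp add: quotient_algebra_def ideal_norm_def coset_def image_image)
qed

lemma ideal_norm_add_ideal:
  assumes N: "closed_ideal N" and i: "i \<in> N" shows "ideal_norm N (x + i) = ideal_norm N x"
proof -
  have le: "ideal_norm N x \<le> ideal_norm N (x + i)" if i: "i \<in> N" for x i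
    unfolding ideal_norm_def[of N "x + i"]
  proof (rule cINF_greatest)
    fix j assume "j \<in> N"
    from ideal_norm_le[OF closed_ideal_add[OF N i this], of x]
    show "ideal_norm N x \<le> norm (x + i + j)" by (simp add: add.assoc)
  qed (use closed_ideal_0[OF N] in auto)
  from le[OF i, of x] le[OF closed_ideal_minus[OF N i], of "x + i"] show ?thesis by simp
qed

lemma ideal_norm_diff_le:
  assumes N: "closed_ideal N" shows "ideal_norm N x - ideal_norm N y \<le> norm (x - y)"
proof -
  have "ideal_norm N x - norm (x - y) \<le> ideal_norm N y"
    unfolding ideal_norm_def[of N y]
  proof (rule cINF_greatest)
    fix i assume "i \<in> N"
    from ideal_norm_le[OF this, of x] norm_triangle_ineq[of "x - y" "y + i"]
    show "ideal_norm N x - norm (x - y) \<le> norm (y + i)" by (simp add: algebra_simps)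
  qed (use closed_ideal_0[OF N] in auto)
  then show ?thesis by simp
qed

lemma ideal_norm_eq_0_iff:
  assumes N: "closed_ideal N" shows "ideal_norm N x = 0 \<longleftrightarrow> x \<in> N"
proof
  assume "x \<in> N"
  then have "ideal_norm N x \<le> norm (x + - x)"
    by (intro ideal_norm_le closed_ideal_minus N)
  moreover have "0 \<le> ideal_norm N x" using closed_ideal_0[OF N] by (intro ideal_norm_nonneg) auto
  ultimately show "ideal_norm N x = 0" by simp
qed (rule ideal_norm_zero_imp[OF N])

lemma ideal_norm_le_norm: "closed_ideal N \<Longrightarrow> ideal_norm N x \<le> norm x"
  using ideal_norm_le[OF closed_ideal_0, of N x] by simp

lemma tendsto_ideal_norm:
  assumes N: "closed_ideal N" and X: "X \<longlonglongrightarrow> x"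
  shows "(\<lambda>n. ideal_norm N (X n)) \<longlonglongrightarrow> ideal_norm N x"
proof -
  have "(\<lambda>n. ideal_norm N (X n) - ideal_norm N x) \<longlonglongrightarrow> 0"
  proof (rule Lim_null_comparison)
    show "\<forall>\<^sub>F n in sequentially. norm (ideal_norm N (X n) - ideal_norm N x) \<le> norm (X n - x)"
      using ideal_norm_diff_le[OF N, of "X _" x] ideal_norm_diff_le[OF N, of x "X _"]
      by (intro always_eventually) (auto simp: abs_le_iff norm_minus_commute)
    show "(\<lambda>n. norm (X n - x)) \<longlonglongrightarrow> 0"
      using X by (simp add: LIM_zero tendsto_norm_zero)
  qed
  then show ?thesis by (simp add: LIM_zero_iff)
qed

text \<open>A correspondence \<open>R\<close> that preserves the quotient norms and has dense projections is the graph
  of an isomorphism after passing to the closure modulo the two ideals.\<close>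

locale quotient_correspondence =
  fixes I :: "'b::cstar_algebra set" and J :: "'c::cstar_algebra set" and R :: "('b \<times> 'c) set"
  assumes I: "closed_ideal I" and J: "closed_ideal J"
    and I_star: "x \<in> I \<Longrightarrow> star x \<in> I" and J_star: "y \<in> J \<Longrightarrow> star y \<in> J"
    and R_zero: "(0, 0) \<in> R"
    and R_add: "(x, y) \<in> R \<Longrightarrow> (x', y') \<in> R \<Longrightarrow> (x + x', y + y') \<in> R"
    and R_scaleC: "(x, y) \<in> R \<Longrightarrow> (c *\<^sub>C x, c *\<^sub>C y) \<in> R"
    and R_mult: "(x, y) \<in> R \<Longrightarrow> (x', y') \<in> R \<Longrightarrow> (x * x', y * y') \<in> R"
    and R_star: "(x, y) \<in> R \<Longrightarrow> (star x, star y) \<in> R"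
    and R_norm: "(x, y) \<in> R \<Longrightarrow> ideal_norm I x = ideal_norm J y"
    and R_dense_left: "closure (fst ` R) = UNIV"
    and R_dense_right: "closure (snd ` R) = UNIV"
begin

lemma converse_correspondence: "quotient_correspondence J I (R\<inverse>)"
proof
  show "closure (fst ` R\<inverse>) = UNIV" "closure (snd ` R\<inverse>) = UNIV"
    using R_dense_left R_dense_right by (simp_all add: fst_eq_Domain snd_eq_Range)
qed (auto intro: I J I_star J_star R_zero R_add R_scaleC R_mult R_star R_norm[symmetric])

section \<open>The relation modulo the two ideals\<close>

definition R_mod :: "('b \<times> 'c) set" where
  "R_mod = {(x, y). \<exists>i\<in>I. \<exists>j\<in>J. (x - i, y - j) \<in> R}"

lemma R_subset: "R \<subseteq> R_mod"
  using closed_ideal_0[OF I] closed_ideal_0[OF J] by (force simp: R_mod_def)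

lemma R_mod_ideal: "i \<in> I \<Longrightarrow> j \<in> J \<Longrightarrow> (i, j) \<in> R_mod"
  using R_zero by (force simp: R_mod_def)

lemma R_mod_add: "(x, y) \<in> R_mod \<Longrightarrow> (x', y') \<in> R_mod \<Longrightarrow> (x + x', y + y') \<in> R_mod"
  unfolding R_mod_def
  by clarsimp (metis R_add add_diff_add closed_ideal_add[OF I] closed_ideal_add[OF J])

lemma R_mod_scaleC: "(x, y) \<in> R_mod \<Longrightarrow> (c *\<^sub>C x, c *\<^sub>C y) \<in> R_mod"
  unfolding R_mod_def
  by clarsimp (metis R_scaleC complex_vector.scale_right_diff_distrib closed_ideal_scaleC[OF I]
      closed_ideal_scaleC[OF J])

lemma R_mod_diff:
  assumes "(x, y) \<in> R_mod" "(x', y') \<in> R_mod" shows "(x - x', y - y') \<in> R_mod"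
  using R_mod_add[OF assms(1) R_mod_scaleC[OF assms(2), of "-1"]]
  by (simp add: complex_vector.scale_minus_left scaleC_one)

lemma R_mod_star: "(x, y) \<in> R_mod \<Longrightarrow> (star x, star y) \<in> R_mod"
  unfolding R_mod_def by clarsimp (metis R_star star_diff I_star J_star)

lemma R_mod_mult:
  assumes "(x, y) \<in> R_mod" "(x', y') \<in> R_mod" shows "(x * x', y * y') \<in> R_mod"
proof -
  obtain i j where ij: "i \<in> I" "j \<in> J" "(x - i, y - j) \<in> R" using assms by (auto simp: R_mod_def)
  obtain i' j' where ij': "i' \<in> I" "j' \<in> J" "(x' - i', y' - j') \<in> R"
    using assms by (auto simp: R_mod_def)
  have "x * x' - (i * x' + (x - i) * i') = (x - i) * (x' - i')"
    "y * y' - (j * y' + (y - j) * j') = (y - j) * (y' - j')"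
    by (simp_all add: algebra_simps)
  moreover have "i * x' + (x - i) * i' \<in> I" "j * y' + (y - j) * j' \<in> J"
    by (intro closed_ideal_add closed_ideal_mult I J ij ij')+
  ultimately show ?thesis
    using R_mult[OF ij(3) ij'(3)] unfolding R_mod_def by auto metis
qed

lemma R_mod_norm:
  assumes "(x, y) \<in> R_mod" shows "ideal_norm I x = ideal_norm J y"
proof -
  obtain i j where ij: "i \<in> I" "j \<in> J" "(x - i, y - j) \<in> R" using assms by (auto simp: R_mod_def)
  show ?thesis
    using R_norm[OF ij(3)] ideal_norm_add_ideal[OF I ij(1), of "x - i"]
      ideal_norm_add_ideal[OF J ij(2), of "y - j"] by simp
qed

lemma closure_R_mod_sequence:
  assumes "(x, y) \<in> closure R_mod"
  obtains X Y where "\<And>n::nat. (X n, Y n) \<in> R_mod" "X \<longlonglongrightarrow> x" "Y \<longlonglongrightarrow> y"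
proof -
  obtain Z where Z: "\<And>n. Z n \<in> R_mod" "Z \<longlonglongrightarrow> (x, y)"
    using assms by (auto simp: closure_sequential)
  show thesis
    using tendsto_fst[OF Z(2)] tendsto_snd[OF Z(2)] Z(1)
    by (intro that[of "\<lambda>n. fst (Z n)" "\<lambda>n. snd (Z n)"]) auto
qed

lemma closure_R_modI:
  assumes "\<And>n::nat. (X n, Y n) \<in> R_mod" "X \<longlonglongrightarrow> x" "Y \<longlonglongrightarrow> y" shows "(x, y) \<in> closure R_mod"
  unfolding closure_sequential using assms by (intro exI[of _ "\<lambda>n. (X n, Y n)"]) (auto intro: tendsto_Pair)

lemma closure_R_mod:
  assumes "(x, y) \<in> closure R_mod"
  shows "ideal_norm I x = ideal_norm J y"
    "(c *\<^sub>C x, c *\<^sub>C y) \<in> closure R_mod" "(star x, star y) \<in> closure R_mod"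
proof -
  obtain X Y where XY: "\<And>n::nat. (X n, Y n) \<in> R_mod" "X \<longlonglongrightarrow> x" "Y \<longlonglongrightarrow> y"
    by (rule closure_R_mod_sequence[OF assms]) blast
  show "ideal_norm I x = ideal_norm J y"
    using tendsto_ideal_norm[OF I XY(2)] tendsto_ideal_norm[OF J XY(3)]
    unfolding R_mod_norm[OF XY(1)] by (rule LIMSEQ_unique)
  show "(c *\<^sub>C x, c *\<^sub>C y) \<in> closure R_mod"
    by (rule closure_R_modI[OF _ bounded_linear.tendsto[OF scaleC_bounded_linear XY(2)]
          bounded_linear.tendsto[OF scaleC_bounded_linear XY(3)]]) (rule R_mod_scaleC[OF XY(1)])
  show "(star x, star y) \<in> closure R_mod"
    by (rule closure_R_modI[OF _ tendsto_star[OF XY(2)] tendsto_star[OF XY(3)]])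
      (rule R_mod_star[OF XY(1)])
qed

lemma closure_R_mod2:
  assumes "(x, y) \<in> closure R_mod" "(x', y') \<in> closure R_mod"
  shows "(x + x', y + y') \<in> closure R_mod" "(x - x', y - y') \<in> closure R_mod"
    "(x * x', y * y') \<in> closure R_mod"
proof -
  obtain X Y where XY: "\<And>n::nat. (X n, Y n) \<in> R_mod" "X \<longlonglongrightarrow> x" "Y \<longlonglongrightarrow> y"
    by (rule closure_R_mod_sequence[OF assms(1)]) blast
  obtain X' Y' where XY': "\<And>n::nat. (X' n, Y' n) \<in> R_mod" "X' \<longlonglongrightarrow> x'" "Y' \<longlonglongrightarrow> y'"
    by (rule closure_R_mod_sequence[OF assms(2)]) blast
  show "(x + x', y + y') \<in> closure R_mod"
    by (rule closure_R_modI[OF _ tendsto_add[OF XY(2) XY'(2)] tendsto_add[OF XY(3) XY'(3)]])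
      (rule R_mod_add[OF XY(1) XY'(1)])
  show "(x - x', y - y') \<in> closure R_mod"
    by (rule closure_R_modI[OF _ tendsto_diff[OF XY(2) XY'(2)] tendsto_diff[OF XY(3) XY'(3)]])
      (rule R_mod_diff[OF XY(1) XY'(1)])
  show "(x * x', y * y') \<in> closure R_mod"
    by (rule closure_R_modI[OF _ tendsto_mult[OF XY(2) XY'(2)] tendsto_mult[OF XY(3) XY'(3)]])
      (rule R_mod_mult[OF XY(1) XY'(1)])
qed

text \<open>Elements of \<open>R_mod\<close> whose first components converge to \<open>x\<close>
  have second components that are close only in the quotient norm of \<open>J\<close>. Each is
  corrected by an element of \<open>J\<close> to make it close in norm to its predecessor, so that
  the second components converge as well.\<close>

lemma exists_right_partner: "\<exists>y. (x, y) \<in> closure R_mod"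
proof -
  have approx: "\<exists>p\<in>R_mod. norm (x - fst p) < r" if "r > 0" for r
  proof -
    have "x \<in> closure (fst ` R)" using R_dense_left by simp
    then obtain p where "p \<in> R" "dist (fst p) x < r"
      using \<open>r > 0\<close> unfolding closure_approachable by blast
    then show ?thesis using R_subset by (intro bexI[of _ p]) (auto simp: dist_norm norm_minus_commute)
  qed
  have "\<exists>p. \<forall>n. (p n \<in> R_mod \<and> norm (x - fst (p n)) < (1/2) ^ n) \<and>
    norm (snd (p (Suc n)) - snd (p n)) < 2 * (1/2) ^ n"
  proof (rule dependent_nat_choice)
    show "\<exists>p. p \<in> R_mod \<and> norm (x - fst p) < (1/2) ^ 0" using approx[of 1] by auto
    fix p n assume p: "p \<in> R_mod \<and> norm (x - fst p) < (1/2) ^ n"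
    obtain p' where p': "p' \<in> R_mod" "norm (x - fst p') < (1/2) ^ Suc n"
      using approx[of "(1/2) ^ Suc n"] by auto
    have "(fst p' - fst p, snd p' - snd p) \<in> R_mod"
      using p p' by (intro R_mod_diff) auto
    then have "ideal_norm J (snd p' - snd p) = ideal_norm I (fst p' - fst p)"
      by (rule R_mod_norm[symmetric])
    also have "\<dots> \<le> norm (fst p' - fst p)" by (rule ideal_norm_le_norm[OF I])
    also have "\<dots> \<le> norm (x - fst p) + norm (x - fst p')"
      using norm_triangle_ineq4[of "x - fst p" "x - fst p'"] by simp
    \<comment> \<open>The two errors add up to at most
      \<open>(1/2)^n + (1/2)^(n + 1)\<close>.\<close>
    also have "\<dots> < 2 * (1/2) ^ n" using p p' by (simp add: field_simps)
    finally obtain j where j: "j \<in> J" "norm (snd p' - snd p + j) < 2 * (1/2) ^ n"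
      using closed_ideal_0[OF J] by (auto elim: ideal_norm_approx[rotated])
    \<comment> \<open>The pair \<open>(0, j)\<close> belongs to \<open>R_mod\<close>, so the second
      component may be shifted by \<open>j\<close> on its own.\<close>
    have "(fst p' + 0, snd p' + j) \<in> R_mod"
      by (intro R_mod_add[OF _ R_mod_ideal[OF closed_ideal_0[OF I] j(1)]]) (use p' in simp)
    then show "\<exists>q. (q \<in> R_mod \<and> norm (x - fst q) < (1/2) ^ Suc n) \<and>
        norm (snd q - snd p) < 2 * (1/2) ^ n"
      using p' j by (intro exI[of _ "(fst p', snd p' + j)"]) (auto simp: algebra_simps)
  qed
  then obtain p where p: "\<And>n. p n \<in> R_mod" "\<And>n. norm (x - fst (p n)) < (1/2) ^ n"
    "\<And>n. norm (snd (p (Suc n)) - snd (p n)) < 2 * (1/2) ^ n" by metis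
  have "summable (\<lambda>n. snd (p (Suc n)) - snd (p n))"
  proof (rule summable_comparison_test)
    show "\<exists>N. \<forall>n\<ge>N. norm (snd (p (Suc n)) - snd (p n)) \<le> 2 * (1/2) ^ n"
      using p(3) by (blast intro: less_imp_le)
    show "summable (\<lambda>n. 2 * (1/2) ^ n :: real)" by (intro summable_mult summable_geometric) simp
  qed
  then have "convergent (\<lambda>n. \<Sum>i<n. snd (p (Suc i)) - snd (p i))" by (simp add: summable_iff_convergent)
  then obtain l where "(\<lambda>n. snd (p n) - snd (p 0)) \<longlonglongrightarrow> l"
    unfolding sum_lessThan_telescope[of "\<lambda>i. snd (p i)"] convergent_def by blast
  then have "(\<lambda>n. snd (p n) - snd (p 0) + snd (p 0)) \<longlonglongrightarrow> l + snd (p 0)" by (intro tendsto_intros)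
  then have Y: "(\<lambda>n. snd (p n)) \<longlonglongrightarrow> l + snd (p 0)" by simp
  have "(\<lambda>n. x - fst (p n)) \<longlonglongrightarrow> 0"
    by (rule Lim_null_comparison[of _ "\<lambda>n. (1/2) ^ n"])
      (use p(2) in \<open>auto intro!: always_eventually less_imp_le LIMSEQ_realpow_zero\<close>)
  then have "(\<lambda>n. x - (x - fst (p n))) \<longlonglongrightarrow> x - 0" by (intro tendsto_intros)
  then have X: "(\<lambda>n. fst (p n)) \<longlonglongrightarrow> x" by simp
  show ?thesis using closure_R_modI[OF _ X Y] p(1) by auto
qed

lemma exists_left_partner: "\<exists>x. (x, y) \<in> closure R_mod"
proof -
  interpret conv: quotient_correspondence J I "R\<inverse>" by (rule converse_correspondence)
  obtain x where "(y, x) \<in> closure conv.R_mod" using conv.exists_right_partner by blast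
  then obtain Y X where YX: "\<And>n::nat. (Y n, X n) \<in> conv.R_mod" "Y \<longlonglongrightarrow> y" "X \<longlonglongrightarrow> x"
    by (rule conv.closure_R_mod_sequence) blast
  have "(X n, Y n) \<in> R_mod" for n
    using YX(1)[of n] by (auto simp: R_mod_def conv.R_mod_def)
  then show ?thesis using YX closure_R_modI by blast
qed

section \<open>The induced isomorphism of the quotients\<close>

definition \<Phi> :: "'b set \<Rightarrow> 'c set" where
  "\<Phi> X = coset J (SOME y. \<exists>x\<in>X. (x, y) \<in> closure R_mod)"

lemma partners_congruent:
  assumes "(x, y) \<in> closure R_mod" "(x', y') \<in> closure R_mod"
  shows "x - x' \<in> I \<longleftrightarrow> y - y' \<in> J"
proof -
  have "ideal_norm I (x - x') = ideal_norm J (y - y')"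
    using closure_R_mod2(2)[OF assms] by (rule closure_R_mod)
  then show ?thesis
    by (simp add: ideal_norm_eq_0_iff[OF I, symmetric] ideal_norm_eq_0_iff[OF J, symmetric])
qed

lemma \<Phi>_coset:
  assumes "(x, y) \<in> closure R_mod" shows "\<Phi> (coset I x) = coset J y"
proof -
  let ?y = "SOME y. \<exists>x'\<in>coset I x. (x', y) \<in> closure R_mod"
  have "\<exists>x'\<in>coset I x. (x', ?y) \<in> closure R_mod"
    by (rule someI[of "\<lambda>y. \<exists>x'\<in>coset I x. (x', y) \<in> closure R_mod" y])
      (intro bexI[of _ x] assms self_mem_coset I)
  then obtain x' where "x' - x \<in> I" "(x', ?y) \<in> closure R_mod" by (auto simp: mem_coset_iff)
  then show ?thesis
    using partners_congruent[OF _ assms] by (simp add: \<Phi>_def coset_eq_iff[OF J])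
qed

text \<open>Two partners of \<open>x\<close> differ by an element of \<open>J\<close>, and
  \<open>R_mod\<close> contains \<open>(0, j)\<close> for every \<open>j\<close> in
  \<open>J\<close>. This turns a statement about cosets back into one about elements, as the claim
  on integrated forms requires.\<close>

lemma \<Phi>_coset_iff: "\<Phi> (coset I x) = coset J y \<longleftrightarrow> (x, y) \<in> closure R_mod"
proof
  assume *: "\<Phi> (coset I x) = coset J y"
  obtain y' where y': "(x, y') \<in> closure R_mod" using exists_right_partner by blast
  with * have "y - y' \<in> J" by (metis \<Phi>_coset coset_eq_iff[OF J])
  then have "(0, y - y') \<in> closure R_mod"
    using R_mod_ideal[OF closed_ideal_0[OF I]] closure_subset by blast
  from closure_R_mod2(1)[OF y' this] show "(x, y) \<in> closure R_mod" by simp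
qed (rule \<Phi>_coset)

theorem star_algebra_iso_\<Phi>: "star_algebra_iso (quotient_algebra I) (quotient_algebra J) \<Phi>"
proof -
  note qI = quotient_algebra_simps[OF I] and qJ = quotient_algebra_simps[OF J]
  have star_I: "sa_star (quotient_algebra I) (coset I x) = coset I (star x)" for x
    by (rule qI(5)) (rule I_star)
  have star_J: "sa_star (quotient_algebra J) (coset J y) = coset J (star y)" for y
    by (rule qJ(5)) (rule J_star)
  have bij: "bij_betw \<Phi> (range (coset I)) (range (coset J))"
    unfolding bij_betw_def
  proof
    show "inj_on \<Phi> (range (coset I))"
    proof (rule inj_onI, clarify)
      fix x x' assume *: "\<Phi> (coset I x) = \<Phi> (coset I x')"
      obtain y y' where yy: "(x, y) \<in> closure R_mod" "(x', y') \<in> closure R_mod"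
        using exists_right_partner by metis
      with * show "coset I x = coset I x'"
        using partners_congruent[OF yy] by (simp add: \<Phi>_coset coset_eq_iff[OF I] coset_eq_iff[OF J])
    qed
    show "\<Phi> ` range (coset I) = range (coset J)"
    proof (intro antisym subsetI)
      show "Y \<in> range (coset J)" if "Y \<in> \<Phi> ` range (coset I)" for Y
        using that by (auto simp: \<Phi>_def)
      show "Y \<in> \<Phi> ` range (coset I)" if "Y \<in> range (coset J)" for Y
      proof -
        from that obtain y where y: "Y = coset J y" by auto
        obtain x where "(x, y) \<in> closure R_mod" using exists_left_partner by blast
        then have "Y = \<Phi> (coset I x)" by (simp add: \<Phi>_coset y)
        then show ?thesis by blast
      qed
    qed
  qed
  show ?thesis
    unfolding star_algebra_iso_def qI(1) qJ(1)
  proof (intro conjI bij ballI allI; clarify)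
    fix x x' :: 'b and c
    obtain y y' where yy: "(x, y) \<in> closure R_mod" "(x', y') \<in> closure R_mod"
      using exists_right_partner by metis
    note \<Phi> = \<Phi>_coset[OF yy(1)] \<Phi>_coset[OF yy(2)]
    show "\<Phi> (sa_add (quotient_algebra I) (coset I x) (coset I x'))
        = sa_add (quotient_algebra J) (\<Phi> (coset I x)) (\<Phi> (coset I x'))"
      unfolding \<Phi> qI qJ by (rule \<Phi>_coset[OF closure_R_mod2(1)[OF yy]])
    show "\<Phi> (sa_mult (quotient_algebra I) (coset I x) (coset I x'))
        = sa_mult (quotient_algebra J) (\<Phi> (coset I x)) (\<Phi> (coset I x'))"
      unfolding \<Phi> qI qJ by (rule \<Phi>_coset[OF closure_R_mod2(3)[OF yy]])
    show "\<Phi> (sa_scale (quotient_algebra I) c (coset I x))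
        = sa_scale (quotient_algebra J) c (\<Phi> (coset I x))"
      unfolding \<Phi> qI qJ by (rule \<Phi>_coset[OF closure_R_mod(2)[OF yy(1)]])
    show "\<Phi> (sa_star (quotient_algebra I) (coset I x)) = sa_star (quotient_algebra J) (\<Phi> (coset I x))"
      unfolding \<Phi> star_I star_J by (rule \<Phi>_coset[OF closure_R_mod(3)[OF yy(1)]])
    show "sa_norm (quotient_algebra J) (\<Phi> (coset I x)) = sa_norm (quotient_algebra I) (coset I x)"
      unfolding \<Phi> qI qJ by (rule closure_R_mod(1)[OF yy(1), symmetric])
  qed
qed

end


section \<open>Toeplitz crossed products\<close>

lemma csubspace_closure:
  fixes S :: "'b::cstar_algebra set"
  assumes S: "csubspace S" shows "csubspace (closure S)"
  unfolding complex_vector.subspace_def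
proof (intro conjI ballI allI)
  show "0 \<in> closure S" using complex_vector.subspace_0[OF S] closure_subset by blast
  show "x + y \<in> closure S" if "x \<in> closure S" "y \<in> closure S" for x y
  proof -
    from that obtain X Y where "\<And>n. X n \<in> S" "X \<longlonglongrightarrow> x" "\<And>n. Y n \<in> S" "Y \<longlonglongrightarrow> y"
      by (auto simp: closure_sequential)
    then show ?thesis
      unfolding closure_sequential using complex_vector.subspace_add[OF S]
      by (intro exI[of _ "\<lambda>n. X n + Y n"]) (auto intro: tendsto_add)
  qed
  show "c *\<^sub>C x \<in> closure S" if "x \<in> closure S" for c x
  proof -
    from that obtain X where "\<And>n. X n \<in> S" "X \<longlonglongrightarrow> x" by (auto simp: closure_sequential)
    then show ?thesis
      unfolding closure_sequential using complex_vector.subspace_scale[OF S]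
      by (intro exI[of _ "\<lambda>n. c *\<^sub>C X n"])
        (auto intro: bounded_linear.tendsto[OF scaleC_bounded_linear])
  qed
qed

lemma closed_cspan_minimal:
  assumes "X \<subseteq> Y" "csubspace Y" "closed Y" shows "closed_cspan X \<subseteq> Y"
  unfolding closed_cspan_def using assms
  by (intro closure_minimal complex_vector.span_minimal)

lemma closed_cspan_superset: "X \<subseteq> closed_cspan X"
  unfolding closed_cspan_def using complex_vector.span_superset closure_subset by blast

lemma csubspace_closed_cspan: "csubspace (closed_cspan X)"
  unfolding closed_cspan_def by (intro csubspace_closure complex_vector.subspace_span)

lemma closed_closed_cspan: "closed (closed_cspan X)"
  by (simp add: closed_cspan_def)

lemma closed_csubspace_mult_preimage:
  fixes M :: "'b::cstar_algebra set"
  assumes M: "csubspace M" "closed M"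
  shows "csubspace {y. x * y \<in> M}" "closed {y. x * y \<in> M}" "csubspace {y. y * x \<in> M}"
    "closed {y. y * x \<in> M}"
proof -
  show "csubspace {y. x * y \<in> M}" "csubspace {y. y * x \<in> M}"
    using M(1) unfolding complex_vector.subspace_def
    by (auto simp: distrib_left distrib_right mult_scaleC_right mult_scaleC_left)
  have "closed ((*) x -` M)" "closed ((\<lambda>y. y * x) -` M)"
    by (intro continuous_closed_vimage M continuous_intros)+
  then show "closed {y. x * y \<in> M}" "closed {y. y * x \<in> M}" by (simp_all add: vimage_def)
qed

lemma cstar_subalgebra_closure:
  assumes S: "csubspace S" and mult: "\<And>x y. x \<in> S \<Longrightarrow> y \<in> S \<Longrightarrow> x * y \<in> S"
    and star: "\<And>x. x \<in> S \<Longrightarrow> star x \<in> S"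
  shows "cstar_subalgebra (closure S)"
  unfolding cstar_subalgebra_def
proof (intro conjI ballI csubspace_closure S closed_closure)
  show "x * y \<in> closure S" if "x \<in> closure S" "y \<in> closure S" for x y
  proof -
    from that obtain X Y where "\<And>n. X n \<in> S" "X \<longlonglongrightarrow> x" "\<And>n. Y n \<in> S" "Y \<longlonglongrightarrow> y"
      by (auto simp: closure_sequential)
    then show ?thesis
      unfolding closure_sequential
      by (intro exI[of _ "\<lambda>n. X n * Y n"]) (auto intro: tendsto_mult mult)
  qed
  show "star x \<in> closure S" if "x \<in> closure S" for x
  proof -
    from that obtain X where "\<And>n. X n \<in> S" "X \<longlonglongrightarrow> x" by (auto simp: closure_sequential)
    then show ?thesis
      unfolding closure_sequential
      by (intro exI[of _ "\<lambda>n. star (X n)"]) (auto intro: tendsto_star star)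
  qed
qed

lemma generated_cstar_subalgebra_minimal:
  "cstar_subalgebra D \<Longrightarrow> X \<subseteq> D \<Longrightarrow> generated_cstar_subalgebra X \<subseteq> D"
  by (auto simp: generated_cstar_subalgebra_def)

lemma closed_ideal_generated: "closed_ideal (generated_closed_ideal X)"
  unfolding closed_ideal_def generated_closed_ideal_def
  by (intro conjI complex_vector.subspace_Inter closed_Inter) (auto simp: closed_ideal_def)

lemma generated_closed_ideal_minimal:
  "closed_ideal D \<Longrightarrow> X \<subseteq> D \<Longrightarrow> generated_closed_ideal X \<subseteq> D"
  and generated_closed_ideal_superset: "X \<subseteq> generated_closed_ideal X"
  by (auto simp: generated_closed_ideal_def)

context unital_cstar
begin

lemma mult_right_unital: "mult_right m x = x * mult_right m e"
proof -
  have "mult_right m (x * y) = x * mult_right m y" for y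
    by transfer (auto simp: double_centraliser_def)
  from this[of e] show ?thesis by simp
qed

lemma mult_left_unit: "mult_left m e = mult_right m e"
proof -
  have "mult_right m x * y = x * mult_left m y" for x y
    by transfer (auto simp: double_centraliser_def)
  from this[of e e] show ?thesis by simp
qed

lemma mult_right_times: "mult_right (m * n) e = mult_right m e * mult_right n e"
proof -
  have "mult_right (m * n) e = mult_right n (mult_right m e)" by transfer auto
  then show ?thesis using mult_right_unital[of n "mult_right m e"] by simp
qed

lemma mult_right_star: "mult_right (star m) e = star (mult_right m e)"
proof -
  have "mult_right (star m) e = star (mult_left m (star e))" by transfer auto
  then show ?thesis by (simp add: mult_left_unit)
qed

end

text \<open>Since \<open>A\<close> is unital, \<open>i\<^sub>A 1\<close> is a unit of \<open>B\<close> and a multiplier \<open>m\<close> of \<open>B\<close> is the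
  element \<open>m (i\<^sub>A 1)\<close>.\<close>

locale toeplitz_product =
  fixes \<alpha> T :: "'s::comm_monoid_add \<Rightarrow> 'a::{cstar_algebra, monoid_mult} \<Rightarrow> 'a"
    and iA :: "'a \<Rightarrow> 'b::cstar_algebra" and iS :: "'s \<Rightarrow> 'b multiplier" and universe :: "'h itself"
  assumes large: "large_universe TYPE('a) TYPE('s) universe"
    and toeplitz: "toeplitz_crossed_product universe \<alpha> T iA iS"
begin

lemma iA_hom: "star_hom iA" and iA_nondegenerate: "closed_cspan {iA a * b | a b. True} = UNIV"
  using toeplitz by (auto simp: toeplitz_crossed_product_def nondegenerate_hom_def)

lemmas iA = star_homD[OF iA_hom]

text \<open>\<open>iA 1\<close> is a left unit on the products \<open>iA a * b\<close>, whose closed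
  span is everything by non-degeneracy. The involution makes it a right unit.\<close>

sublocale unital_cstar "iA 1"
proof
  have left: "iA 1 * x = x" for x
  proof -
    have "closed_cspan {iA a * b | a b. True} \<subseteq> {x. iA 1 * x - x \<in> {0}}"
    proof (rule closed_cspan_minimal)
      show "{iA a * b | a b. True} \<subseteq> {x. iA 1 * x - x \<in> {0}}"
        by (auto simp: mult.assoc[symmetric] iA(3)[symmetric])
      show "csubspace {x. iA 1 * x - x \<in> {0}}"
        unfolding complex_vector.subspace_def
        by (auto simp: distrib_left mult_scaleC_right)
      have "closed ((\<lambda>x. iA 1 * x - x) -` {0})"
        by (intro continuous_closed_vimage continuous_intros)
      then show "closed {x. iA 1 * x - x \<in> {0}}" by (simp add: vimage_def)
    qed
    then show ?thesis using iA_nondegenerate by auto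
  qed
  have "star (iA 1) = iA 1" by (metis left star_mult star_star)
  then show "x * iA 1 = x" for x
    using left[of "star x"] by (metis star_mult star_star)
  show "iA 1 * x = x" for x by (rule left)
qed

definition u :: "'s \<Rightarrow> 'b" where "u s = mult_right (iS s) (iA 1)"

lemma mult_right_iS: "mult_right (iS s) x = x * u s"
  unfolding u_def by (rule mult_right_unital)

lemma mult_right_star_iS: "mult_right (star (iS s)) x = x * star (u s)"
  using mult_right_unital[of "star (iS s)" x] by (simp add: u_def mult_right_star)

lemma mult_right_iS_star: "mult_right (iS s * star (iS s)) x = x * (u s * star (u s))"
  using mult_right_unital[of "iS s * star (iS s)" x]
  by (simp add: u_def mult_right_times mult_right_star)

lemma generated: "cstar_subalgebra D \<Longrightarrow> (\<And>a s. iA a * u s \<in> D) \<Longrightarrow> D = UNIV"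
proof -
  assume "cstar_subalgebra D" "\<And>a s. iA a * u s \<in> D"
  then have "generated_cstar_subalgebra {mult_right (iS s) (iA a) | a s. True} \<subseteq> D"
    by (intro generated_cstar_subalgebra_minimal) (auto simp: mult_right_iS)
  then show "D = UNIV" using toeplitz by (auto simp: toeplitz_crossed_product_def)
qed

text \<open>Two successive letters from \<open>S\<close> encode the adjoint of the first.\<close>

fun word :: "('a + 's) list \<Rightarrow> 'b" where
  "word [] = iA 1"
| "word (Inl a # xs) = iA a * word xs"
| "word (Inr s # Inr t # xs) = star (u s) * word xs"
| "word (Inr s # xs) = u s * word xs"

text \<open>The closed span of the words is stable under left multiplication by the generators and
  their adjoints. The elements that preserve it together with their adjoints form a C*-subalgebra
  \<open>D\<close>, so \<open>D\<close> is everything; applying its elements to the empty word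
  recovers them.\<close>

lemma words_dense: "closed_cspan (range word) = UNIV"
proof -
  let ?M = "closed_cspan (range word)"
  note M = csubspace_closed_cspan[of "range word"] closed_closed_cspan[of "range word"]
  note word_in = subsetD[OF closed_cspan_superset rangeI, of word]
  have left: "x * y \<in> ?M" if x: "\<And>ws. \<exists>ws'. x * word ws = word ws'" and y: "y \<in> ?M" for x y
  proof -
    have "range word \<subseteq> {y. x * y \<in> ?M}" using x word_in by (metis (mono_tags, lifting) image_subsetI mem_Collect_eq)
    then have "?M \<subseteq> {y. x * y \<in> ?M}"
      by (rule closed_cspan_minimal) (intro closed_csubspace_mult_preimage M)+
    then show ?thesis using y by auto
  qed
  have iA_M: "iA a * y \<in> ?M" if "y \<in> ?M" for a y
    by (rule left[OF _ that]) (metis word.simps(2))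
  have u_M: "u s * y \<in> ?M" if "y \<in> ?M" for s y
  proof (rule left[OF _ that])
    show "\<exists>ws'. u s * word ws = word ws'" for ws
      \<comment> \<open>The neutral letter \<open>Inl 1\<close> prevents \<open>Inr s\<close> from
        being read together with a following letter of \<open>S\<close>.\<close>
      by (rule exI[of _ "Inr s # Inl 1 # ws"]) simp
  qed
  have su_M: "star (u s) * y \<in> ?M" if "y \<in> ?M" for s y
    by (rule left[OF _ that]) (metis word.simps(3))
  define D where "D = {x. (\<forall>y\<in>?M. x * y \<in> ?M) \<and> (\<forall>y\<in>?M. star x * y \<in> ?M)}"
  have "D = UNIV"
  proof (rule generated)
    have "closed D"
    proof -
      have "D = (\<Inter>y\<in>?M. {x. x * y \<in> ?M}) \<inter> (\<Inter>y\<in>?M. star -` {x. x * y \<in> ?M})"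
        by (auto simp: D_def)
      also have "closed \<dots>"
        by (intro closed_Int closed_INT ballI closed_csubspace_mult_preimage M
            continuous_closed_vimage linear_continuous_at bounded_linear_star)
      finally show ?thesis .
    qed
    then show "cstar_subalgebra D"
      unfolding cstar_subalgebra_def
      by (auto simp: complex_vector.subspace_def D_def star_simps distrib_right mult_scaleC_left
          mult.assoc complex_vector.subspace_0[OF M(1)] complex_vector.subspace_add[OF M(1)]
          complex_vector.subspace_scale[OF M(1)])
    show "iA a * u s \<in> D" for a s
      using iA_M u_M su_M by (simp add: D_def mult.assoc star_mult iA(4)[symmetric])
  qed
  have "x \<in> ?M" for x
  proof -
    have "x \<in> D" by (simp add: \<open>D = UNIV\<close>)
    then have "x * word [] \<in> ?M" unfolding D_def using word_in[of "[]"] by blast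
    then show ?thesis by simp
  qed
  then show ?thesis by auto
qed

lemma exists_representation:
  fixes N :: "'b set"
  assumes "closed_ideal N" "N \<noteq> UNIV"
  obtains H :: "'h hilb" and \<sigma> \<xi> where "hilbert_space H" "unital_representation H (iA 1) \<sigma>"
    "\<And>i x. i \<in> N \<Longrightarrow> x \<in> hcarrier H \<Longrightarrow> \<sigma> i x = hzero H"
    "\<xi> \<in> hcarrier H" "hnorm H \<xi> \<le> 1" "ideal_norm N x \<le> hnorm H (\<sigma> x \<xi>)"
proof -
  obtain f :: "(('a + 's) list \<Rightarrow> complex) \<Rightarrow> 'h" where "inj f"
    using large by (auto simp: large_universe_def)
  from exists_representation_attaining_ideal_norm[OF words_dense this assms, of x]
  obtain H :: "'h hilb" and \<sigma> \<xi> where *: "hilbert_space H" "nondegenerate_representation H \<sigma>"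
    "\<And>i x. i \<in> N \<Longrightarrow> x \<in> hcarrier H \<Longrightarrow> \<sigma> i x = hzero H"
    "\<xi> \<in> hcarrier H" "hnorm H \<xi> \<le> 1" "ideal_norm N x \<le> hnorm H (\<sigma> x \<xi>)"
    by metis
  show thesis
    by (rule that[OF *(1) unital_representationI[OF *(1) unital_cstar_axioms *(2)] *(3-6)])
qed

text \<open>Condition (i) gives covariance only inside representations on spaces in
  \<open>'h\<close>. That these separate points, the case \<open>N = {0}\<close> of the
  norm-attaining theorem, turns it into identities between elements.\<close>

lemma eq_if_eq_in_representations:
  assumes "\<And>(H :: 'h hilb) \<sigma>. unital_representation H (iA 1) \<sigma> \<Longrightarrow> \<sigma> x = \<sigma> y"
  shows "x = y"
proof (rule ccontr)
  assume "x \<noteq> y"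
  then have ne: "({0} :: 'b set) \<noteq> UNIV" by (metis UNIV_I singletonD)
  have ideal: "closed_ideal ({0} :: 'b set)"
    by (auto simp: closed_ideal_def complex_vector.subspace_def)
  obtain H :: "'h hilb" and \<sigma> \<xi> where H: "hilbert_space H" "unital_representation H (iA 1) \<sigma>"
    "\<xi> \<in> hcarrier H" "ideal_norm {0} (x - y) \<le> hnorm H (\<sigma> (x - y) \<xi>)"
    by (rule exists_representation[OF ideal ne, of "x - y"]) blast
  interpret unital_representation H "iA 1" \<sigma> by fact
  have "\<sigma> (x - y) \<xi> = hzero H"
    using H assms[OF H(2)]
    by (intro hinner_eqI) (auto simp: rep_closed closed_intros hinner_rep_diff hinner_zero_left)
  then have "norm (x - y) \<le> 0"
    using H(4) hnorm_eq_0[OF hzero_closed] by (simp add: ideal_norm_def)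
  with \<open>x \<noteq> y\<close> show False by simp
qed

lemma covariant_if_representation:
  fixes H :: "'h hilb"
  assumes "unital_representation H (iA 1) \<sigma>"
  shows "toeplitz_covariant H \<alpha> T (\<sigma> \<circ> iA) (\<sigma> \<circ> u)"
proof -
  interpret unital_representation H "iA 1" \<sigma> by fact
  have "multiplier_extension H \<sigma> \<circ> iS = \<sigma> \<circ> u"
    by (simp add: fun_eq_iff multiplier_extension_unital mult_left_unit u_def)
  moreover have "toeplitz_covariant H \<alpha> T (\<sigma> \<circ> iA) (multiplier_extension H \<sigma> \<circ> iS)"
    using toeplitz hilbert_space_axioms nondegenerate_rep by (auto simp: toeplitz_crossed_product_def)
  ultimately show ?thesis by simp
qed

lemma u_commute: "u s * iA a = iA (\<alpha> s a) * u s"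
proof (rule eq_if_eq_in_representations)
  fix H :: "'h hilb" and \<sigma> assume \<sigma>: "unital_representation H (iA 1) \<sigma>"
  then interpret unital_representation H "iA 1" \<sigma> .
  show "\<sigma> (u s * iA a) = \<sigma> (iA (\<alpha> s a) * u s)"
    using covariant_if_representation[OF \<sigma>] by (simp add: toeplitz_covariant_def repD(4))
qed

lemma star_u_conjugate: "star (u s) * iA a * u s = iA (T s a)"
proof (rule eq_if_eq_in_representations)
  fix H :: "'h hilb" and \<sigma> assume \<sigma>: "unital_representation H (iA 1) \<sigma>"
  then interpret unital_representation H "iA 1" \<sigma> .
  show "\<sigma> (star (u s) * iA a * u s) = \<sigma> (iA (T s a))"
    using covariant_if_representation[OF \<sigma>]
    by (simp add: toeplitz_covariant_def repD(4) repD(6) mult.assoc)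
qed

text \<open>The Hilbert space may live in any type here, because integrated forms on spaces outside
  \<open>'h\<close> are compared in the end.\<close>

lemma integrated_form_unital:
  assumes H: "hilbert_space H" and cov: "toeplitz_covariant H \<alpha> T \<pi> V"
    and form: "integrated_form H iA iS \<pi> V \<sigma>"
  shows "unital_representation H (iA 1) \<sigma>" "\<sigma> (iA a) = \<pi> a" "\<sigma> (u s) = V s"
proof -
  have \<sigma>: "representation H \<sigma>" "\<sigma> \<circ> iA = \<pi>" "multiplier_extension H \<sigma> \<circ> iS = V"
    using form by (auto simp: integrated_form_def)
  then show 1: "\<sigma> (iA a) = \<pi> a" for a by auto
  have "unital_representation H 1 \<pi>"
    using cov by (intro unital_representationI H unital_cstar_one) (simp add: toeplitz_covariant_def)
  then have "\<sigma> (iA 1) = hid H" by (simp add: 1 unital_representation.rep_unit)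
  then show rep: "unital_representation H (iA 1) \<sigma>"
    using H \<sigma>(1) unital_cstar_axioms
    by (simp add: unital_representation_def unital_representation_axioms_def)
  interpret unital_representation H "iA 1" \<sigma> by (rule rep)
  show "\<sigma> (u s) = V s"
    using \<sigma>(3) by (auto simp: multiplier_extension_unital mult_left_unit u_def)
qed

lemma exists_integrated_form:
  fixes H :: "'h hilb"
  assumes "hilbert_space H" "toeplitz_covariant H \<alpha> T \<pi> V"
  shows "\<exists>\<sigma>. integrated_form H iA iS \<pi> V \<sigma>"
  using assms toeplitz by (auto simp: toeplitz_crossed_product_def)

lemma redundancy_iff:
  "redundancy iA iS s a k \<longleftrightarrow> a \<in> range iA \<and>
    k \<in> closed_cspan {iA b * (u s * star (u s)) * iA c | b c. True} \<and>
    (\<forall>b. a * iA b * u s = k * iA b * u s)"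
  by (simp add: redundancy_def mult_right_iS mult_right_iS_star)

lemma redundancy_ideal_closed: "closed_ideal (redundancy_ideal \<alpha> iA iS)"
  unfolding redundancy_ideal_def by (rule closed_ideal_generated)

lemma diff_in_redundancy_ideal:
  assumes "\<And>b'. iA (b * \<alpha> s c * d) * iA b' * u s = k * iA b' * u s"
    and "k = iA b'' * (u s * star (u s)) * iA c''"
  shows "iA (b * \<alpha> s c * d) - k \<in> redundancy_ideal \<alpha> iA iS"
proof -
  have "redundancy iA iS s (iA (b * \<alpha> s c * d)) k"
    unfolding redundancy_iff
  proof (intro conjI allI assms(1) rangeI)
    show "k \<in> closed_cspan {iA b * (u s * star (u s)) * iA c | b c. True}"
      by (rule subsetD[OF closed_cspan_superset]) (use assms(2) in blast)
  qed
  moreover have "iA (b * \<alpha> s c * d) \<in> closed_cspan {iA (b * \<alpha> s c * d) | b c d. True}"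
    by (rule subsetD[OF closed_cspan_superset]) blast
  ultimately show ?thesis
    unfolding redundancy_ideal_def by (intro subsetD[OF generated_closed_ideal_superset]) blast
qed

lemma redundancy_ideal_subset:
  assumes D: "closed_ideal D" and diff: "\<And>s a k. \<lbrakk>k \<in> closed_cspan {iA b * (u s * star (u s)) * iA c | b c. True};
    a \<in> closed_cspan {iA (b * \<alpha> s c * d) | b c d. True}; \<And>b. a * iA b * u s = k * iA b * u s\<rbrakk>
    \<Longrightarrow> a - k \<in> D"
  shows "redundancy_ideal \<alpha> iA iS \<subseteq> D"
  unfolding redundancy_ideal_def
  by (rule generated_closed_ideal_minimal[OF D]) (auto simp: redundancy_iff intro!: diff)

end

section \<open>The redundancies of the two systems\<close>

locale crossed_product_pair = extendible_pair \<beta> L +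
  B: toeplitz_product L \<beta> iA iS universe + C: toeplitz_product \<beta> L jA jS universe
  for \<beta> L :: "'s::comm_monoid_add \<Rightarrow> 'a::{cstar_algebra, monoid_mult} \<Rightarrow> 'a"
    and iA :: "'a \<Rightarrow> 'b::cstar_algebra" and iS :: "'s \<Rightarrow> 'b multiplier"
    and jA :: "'a \<Rightarrow> 'c::cstar_algebra" and jS :: "'s \<Rightarrow> 'c multiplier"
    and universe :: "'h itself"
begin

abbreviation "I \<equiv> redundancy_ideal L iA iS"
abbreviation "J \<equiv> redundancy_ideal \<beta> jA jS"
abbreviation "u \<equiv> B.u"
abbreviation "v \<equiv> C.u"

text \<open>Since \<open>star (u s) * iA b * u s = iA (\<beta> s b)\<close>, multiplying
  \<open>u s * iA a * star (u s)\<close> by \<open>iA b * u s\<close> produces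
  \<open>u s * iA a * iA (\<beta> s b)\<close>. Moving \<open>u s\<close> to the right applies
  \<open>L s\<close>, and the factor \<open>L s 1\<close> in
  \<open>L s (\<beta> s b) = b * L s 1\<close> is absorbed by \<open>u s\<close>.\<close>

lemma left_redundancy: "iA (L s a) - u s * iA a * star (u s) \<in> I"
proof -
  have 1: "u s = iA (L s 1) * u s" using B.u_commute[of s 1] by simp
  have "iA (1 * L s a * 1) - u s * iA a * star (u s) \<in> I"
  proof (rule B.diff_in_redundancy_ideal)
    show "u s * iA a * star (u s) = iA (L s a) * (u s * star (u s)) * iA 1"
      by (simp add: B.u_commute mult.assoc)
    fix b
    have "u s * iA a * star (u s) * iA b * u s = iA (L s a) * (u s * iA (\<beta> s b))"
      using B.star_u_conjugate[of s b] by (simp add: B.u_commute mult.assoc)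
    also have "\<dots> = iA (L s a) * iA b * (iA (L s 1) * u s)"
      by (simp add: B.u_commute L_beta B.iA(3) mult.assoc)
    finally show "iA (1 * L s a * 1) * iA b * u s = u s * iA a * star (u s) * iA b * u s"
      by (simp add: 1[symmetric])
  qed
  then show ?thesis by simp
qed

text \<open>Here \<open>v s * (star (v s) * jA b * v s)\<close> is \<open>v s * jA (L s b)\<close>,
  and moving \<open>v s\<close> to the right applies \<open>\<beta> s\<close>, which undoes
  \<open>L s\<close>.\<close>

lemma right_redundancy: "jA 1 - v s * star (v s) \<in> J"
proof -
  have "jA (1 * \<beta> s 1 * 1) - v s * star (v s) \<in> J"
  proof (rule C.diff_in_redundancy_ideal)
    show "v s * star (v s) = jA 1 * (v s * star (v s)) * jA 1" by simp
    fix b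
    have "v s * star (v s) * jA b * v s = v s * jA (L s b)"
      using C.star_u_conjugate[of s b] by (simp add: mult.assoc)
    also have "\<dots> = jA b * v s" by (simp add: C.u_commute beta_L_apply)
    finally show "jA (1 * \<beta> s 1 * 1) * jA b * v s = v s * star (v s) * jA b * v s"
      by (simp add: beta_one)
  qed
  then show ?thesis by (simp add: beta_one)
qed

lemma left_pair_if_kills:
  fixes H :: "'h hilb"
  assumes \<sigma>: "unital_representation H (iA 1) \<sigma>" and kill: "\<And>i x. i \<in> I \<Longrightarrow> x \<in> hcarrier H \<Longrightarrow> \<sigma> i x = hzero H"
  shows "(\<sigma> \<circ> iA, \<sigma> \<circ> u) \<in> left_pairs H \<beta> L"
proof -
  interpret unital_representation H "iA 1" \<sigma> by fact
  have "hcomp H (\<sigma> (u s)) (hcomp H (\<sigma> (iA a)) (hadjoint H (\<sigma> (u s)))) = \<sigma> (iA (L s a))" for s a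
  proof -
    have "\<sigma> (iA (L s a)) = \<sigma> (u s * iA a * star (u s))"
    proof (rule rep_eqI[OF _ repD(1)])
      fix x y assume "x \<in> C" "y \<in> C"
      then show "ip (\<sigma> (iA (L s a)) x) y = ip (\<sigma> (u s * iA a * star (u s)) x) y"
        using hinner_rep_diff[of x y "iA (L s a)" "u s * iA a * star (u s)"] kill[OF left_redundancy]
        by (simp add: hinner_zero_left)
    qed
    then show ?thesis by (simp add: repD(4) repD(6) mult.assoc)
  qed
  then show ?thesis
    using B.covariant_if_representation[OF \<sigma>] by (simp add: left_pairs_def)
qed

lemma right_pair_if_kills:
  fixes H :: "'h hilb"
  assumes \<tau>: "unital_representation H (jA 1) \<tau>" and kill: "\<And>i x. i \<in> J \<Longrightarrow> x \<in> hcarrier H \<Longrightarrow> \<tau> i x = hzero H"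
  shows "(\<tau> \<circ> jA, \<tau> \<circ> v) \<in> right_pairs H \<beta> L"
proof -
  interpret unital_representation H "jA 1" \<tau> by fact
  have "\<tau> (jA a) = hcomp H (\<tau> (jA a)) (hcomp H (\<tau> (v s)) (hadjoint H (\<tau> (v s))))" for s a
  proof -
    have "\<tau> (jA 1) = \<tau> (v s * star (v s))"
    proof (rule rep_eqI[OF _ repD(1)])
      fix x y assume "x \<in> C" "y \<in> C"
      then show "ip (\<tau> (jA 1) x) y = ip (\<tau> (v s * star (v s)) x) y"
        using hinner_rep_diff[of x y "jA 1" "v s * star (v s)"] kill[OF right_redundancy]
        by (simp add: hinner_zero_left)
    qed
    then have "\<tau> (jA a * jA 1) = \<tau> (jA a * (v s * star (v s)))" by (simp only: repD(4))
    then show ?thesis by (simp add: repD(4) repD(6))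
  qed
  then show ?thesis
    using C.covariant_if_representation[OF \<tau>] by (simp add: right_pairs_def)
qed

text \<open>A difference \<open>d = a - k\<close> annihilates the ideal generated by \<open>L s 1\<close> in the representation,
  and lies in it; so \<open>d d\<^sup>*\<close> vanishes.\<close>

lemma left_pair_kills:
  assumes \<sigma>: "unital_representation H (iA 1) \<sigma>"
    and V: "\<And>s. hcomp H (\<sigma> (u s)) (hcomp H (\<sigma> (iA 1)) (hadjoint H (\<sigma> (u s)))) = \<sigma> (iA (L s 1))"
  shows "I \<subseteq> unital_representation.rep_kernel H \<sigma>"
proof -
  interpret unital_representation H "iA 1" \<sigma> by fact
  show ?thesis
  proof (rule B.redundancy_ideal_subset[OF closed_ideal_rep_kernel])
    fix s a k
    let ?K = "{iA b * (u s * star (u s)) * iA c | b c. True}"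
    let ?A = "{iA (b * L s c * d) | b c d. True}"
    assume k: "k \<in> closed_cspan ?K" and a: "a \<in> closed_cspan ?A"
      and ak: "\<And>b. a * iA b * u s = k * iA b * u s"
    define d where "d = a - k"
    \<comment> \<open>The clause with \<open>star z\<close> is the one used in the end:
      \<open>d\<close> itself belongs to \<open>Z\<close>, so \<open>d * star d\<close> is in the
      kernel.\<close>
    define Z where "Z = {z. d * z \<in> rep_kernel \<and> d * star z \<in> rep_kernel}"
    have Z: "csubspace Z" "closed Z"
    proof -
      note ann = closed_csubspace_mult_preimage(1,2)[OF closed_ideal_csubspace[OF closed_ideal_rep_kernel]
          closed_ideal_closed[OF closed_ideal_rep_kernel], of d]
      show "csubspace Z"
        using ann(1) unfolding Z_def complex_vector.subspace_def by (auto simp: star_simps)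
      have "Z = {z. d * z \<in> rep_kernel} \<inter> star -` {z. d * z \<in> rep_kernel}" by (auto simp: Z_def)
      also have "closed \<dots>"
        by (intro closed_Int ann continuous_closed_vimage linear_continuous_at bounded_linear_star)
      finally show "closed Z" .
    qed
    have d_u: "d * iA b * u s = 0" for b by (simp add: d_def left_diff_distrib ak)
    have d_K: "d * (iA b * (u s * star (u s)) * iA c) \<in> rep_kernel" for b c
    proof -
      have "d * (iA b * (u s * star (u s)) * iA c) = d * iA b * u s * star (u s) * iA c"
        by (simp only: mult.assoc)
      then show ?thesis by (simp add: d_u closed_ideal_0[OF closed_ideal_rep_kernel])
    qed
    have uu: "\<sigma> (u s * star (u s)) = \<sigma> (iA (L s 1))"
      using V[of s] by (metis B.unit_left repD(4) repD(6))
    have d_A: "d * iA (b * L s c * d') \<in> rep_kernel" for b c d'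
    proof -
      \<comment> \<open>Writing \<open>L s c\<close> as \<open>L s 1 * L s c\<close> exposes the
        factor \<open>L s 1\<close>, which the representation identifies with
        \<open>u s * star (u s)\<close>.\<close>
      have "d * iA (b * L s c * d') = d * (iA b * iA (L s 1) * iA (L s c * d'))"
        by (metis B.iA(3) L_factor mult.assoc)
      moreover have "\<sigma> (d * (iA b * iA (L s 1) * iA (L s c * d')))
          = \<sigma> (d * (iA b * (u s * star (u s)) * iA (L s c * d')))"
        by (simp only: repD(4) uu[symmetric])
      ultimately show ?thesis using d_K[of b "L s c * d'"] by (simp add: rep_kernel_def)
    qed
    have "?K \<subseteq> Z"
      using d_K by (auto simp: Z_def star_simps B.iA(4)[symmetric] mult.assoc)
    with Z k have "k \<in> Z" using closed_cspan_minimal by blast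
    moreover have "?A \<subseteq> Z"
    proof
      fix z assume "z \<in> ?A"
      then obtain b c d' where z: "z = iA (b * L s c * d')" by blast
      have "star z = iA (star d' * L s (star c) * star b)"
        by (simp add: z B.iA(4)[symmetric] star_mult star_homD(4)[OF L_hom] mult.assoc)
      then show "z \<in> Z" using d_A by (simp add: Z_def z)
    qed
    with Z a have "a \<in> Z" using closed_cspan_minimal by blast
    ultimately have "d \<in> Z" using complex_vector.subspace_diff[OF Z(1)] by (simp add: d_def)
    then have "star (star d) * star d \<in> rep_kernel" by (simp add: Z_def star_star)
    then have "star d \<in> rep_kernel" by (rule rep_kernel_star_mult_self)
    then show "a - k \<in> rep_kernel"
      using B.closed_ideal_star[OF closed_ideal_rep_kernel, of "star d"] by (simp add: star_star d_def)
  qed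
qed

text \<open>A redundancy tested at \<open>b = 1\<close> gives \<open>(a - k) * v s = 0\<close>.
  Multiplying by \<open>star (v s)\<close> finishes, since \<open>v s * star (v s)\<close> acts as
  the identity.\<close>

lemma right_pair_kills:
  assumes \<tau>: "unital_representation H (jA 1) \<tau>"
    and W: "\<And>s. \<tau> (jA 1) = hcomp H (\<tau> (jA 1)) (hcomp H (\<tau> (v s)) (hadjoint H (\<tau> (v s))))"
  shows "J \<subseteq> unital_representation.rep_kernel H \<tau>"
proof -
  interpret unital_representation H "jA 1" \<tau> by fact
  show ?thesis
  proof (rule C.redundancy_ideal_subset[OF closed_ideal_rep_kernel])
    fix s a k
    assume "\<And>b. a * jA b * v s = k * jA b * v s"
    from this[of 1] have "(a - k) * v s = 0" by (simp add: left_diff_distrib)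
    then have "(a - k) * (v s * star (v s)) = 0" by (simp add: mult.assoc[symmetric])
    moreover have "\<tau> (jA 1) = \<tau> (v s * star (v s))"
      using W[of s] by (metis C.unit_left repD(4) repD(6))
    then have "\<tau> ((a - k) * jA 1) = \<tau> ((a - k) * (v s * star (v s)))" by (simp only: repD(4))
    ultimately have "\<tau> (a - k) = \<tau> 0" by simp
    then show "a - k \<in> rep_kernel"
      using closed_ideal_0[OF closed_ideal_rep_kernel] by (simp add: rep_kernel_def)
  qed
qed

section \<open>The relation between the two Toeplitz algebras\<close>

text \<open>Each \<open>u s\<close> enters together with its adjoint, so that \<open>R_star\<close>
  follows by induction and the induction for representations has no case for
  \<open>star\<close>.\<close>

inductive_set R :: "('b \<times> 'c) set" where
  base: "(iA a, jA a) \<in> R"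
| isometry: "(u s, star (v s)) \<in> R"
| coisometry: "(star (u s), v s) \<in> R"
| add: "(x, y) \<in> R \<Longrightarrow> (x', y') \<in> R \<Longrightarrow> (x + x', y + y') \<in> R"
| scale: "(x, y) \<in> R \<Longrightarrow> (c *\<^sub>C x, c *\<^sub>C y) \<in> R"
| mult: "(x, y) \<in> R \<Longrightarrow> (x', y') \<in> R \<Longrightarrow> (x * x', y * y') \<in> R"

lemma representations_agree:
  assumes \<sigma>: "unital_representation H (iA 1) \<sigma>" and \<tau>: "unital_representation H (jA 1) \<tau>"
    and A: "\<And>a. \<sigma> (iA a) = \<tau> (jA a)" and S: "\<And>s. \<tau> (v s) = hadjoint H (\<sigma> (u s))"
    and xy: "(x, y) \<in> R"
  shows "\<sigma> x = \<tau> y"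
proof -
  interpret \<sigma>: unital_representation H "iA 1" \<sigma> by fact
  interpret \<tau>: unital_representation H "jA 1" \<tau> by fact
  show ?thesis
    using xy
  proof induction
    case (base a)
    show ?case by (rule A)
  next
    case (coisometry s)
    show ?case by (simp add: S \<sigma>.repD(6))
  next
    case (isometry s)
    show ?case by (simp add: S \<tau>.repD(6) \<sigma>.hadjoint_hadjoint[OF \<sigma>.repD(1)])
  next
    case (add x y x' y')
    then show ?case
      by (intro \<sigma>.bounded_ops_eqI \<sigma>.repD(1) \<tau>.repD(1)) (simp add: \<sigma>.repD(2) \<tau>.repD(2))
  next
    case (scale x y c)
    then show ?case
      by (intro \<sigma>.bounded_ops_eqI \<sigma>.repD(1) \<tau>.repD(1)) (simp add: \<sigma>.repD(3) \<tau>.repD(3))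
  next
    case (mult x y x' y')
    then show ?case by (simp add: \<sigma>.repD(4) \<tau>.repD(4))
  qed
qed

lemma integrated_forms_of_pair:
  assumes H: "hilbert_space H" and left: "(\<pi>, V) \<in> left_pairs H \<beta> L"
    and \<sigma>: "integrated_form H iA iS \<pi> V \<sigma>"
    and \<tau>: "integrated_form H jA jS \<pi> (\<lambda>s. hadjoint H (V s)) \<tau>"
  shows "unital_representation H (iA 1) \<sigma>" "unital_representation H (jA 1) \<tau>"
    "I \<subseteq> unital_representation.rep_kernel H \<sigma>" "J \<subseteq> unital_representation.rep_kernel H \<tau>"
    "(x, y) \<in> R \<Longrightarrow> \<sigma> x = \<tau> y"
proof -
  have right: "(\<pi>, \<lambda>s. hadjoint H (V s)) \<in> right_pairs H \<beta> L"
    using adjoint_pair_left[OF H left] by (simp add: adjoint_pair_def)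
  have "toeplitz_covariant H L \<beta> \<pi> V" "toeplitz_covariant H \<beta> L \<pi> (\<lambda>s. hadjoint H (V s))"
    using left right by (simp_all add: left_pairs_def right_pairs_def)
  note s = B.integrated_form_unital[OF H this(1) \<sigma>] and t = C.integrated_form_unital[OF H this(2) \<tau>]
  show "unital_representation H (iA 1) \<sigma>" "unital_representation H (jA 1) \<tau>" by (rule s, rule t)
  show "I \<subseteq> unital_representation.rep_kernel H \<sigma>"
    using left by (intro left_pair_kills s) (simp add: s left_pairs_def)
  show "J \<subseteq> unital_representation.rep_kernel H \<tau>"
    using right by (intro right_pair_kills t) (simp add: t right_pairs_def)
  show "\<sigma> x = \<tau> y" if "(x, y) \<in> R"
    by (rule representations_agree[OF s(1) t(1) _ _ that]) (simp_all add: s t)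
qed

lemma ideal_norm_le_right:
  assumes xy: "(x, y) \<in> R" shows "ideal_norm I x \<le> ideal_norm J y"
\<comment> \<open>A representation annihilating the ideal and attaining the norm is available only
  for a proper ideal; otherwise the left side is zero.\<close>
proof (cases "I = UNIV")
  case True
  then have "ideal_norm I x = 0"
    using ideal_norm_eq_0_iff[OF B.redundancy_ideal_closed, of x] by simp
  then show ?thesis
    using closed_ideal_0[OF C.redundancy_ideal_closed] ideal_norm_nonneg[of J y] by auto
next
  case False
  obtain H :: "'h hilb" and \<sigma> \<xi> where H: "hilbert_space H" and \<sigma>: "unital_representation H (iA 1) \<sigma>"
    and kill: "\<And>i x. i \<in> I \<Longrightarrow> x \<in> hcarrier H \<Longrightarrow> \<sigma> i x = hzero H"
    and \<xi>: "\<xi> \<in> hcarrier H" "hnorm H \<xi> \<le> 1" "ideal_norm I x \<le> hnorm H (\<sigma> x \<xi>)"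
    by (rule B.exists_representation[OF B.redundancy_ideal_closed False]) blast
  have left: "(\<sigma> \<circ> iA, \<sigma> \<circ> u) \<in> left_pairs H \<beta> L" by (rule left_pair_if_kills[OF \<sigma> kill])
  then have "adjoint_pair H (\<sigma> \<circ> iA, \<sigma> \<circ> u) \<in> right_pairs H \<beta> L" by (rule adjoint_pair_left[OF H])
  then have "toeplitz_covariant H \<beta> L (\<sigma> \<circ> iA) (\<lambda>s. hadjoint H ((\<sigma> \<circ> u) s))"
    by (simp add: adjoint_pair_def right_pairs_def)
  then obtain \<tau> where \<tau>: "integrated_form H jA jS (\<sigma> \<circ> iA) (\<lambda>s. hadjoint H ((\<sigma> \<circ> u) s)) \<tau>"
    using C.exists_integrated_form[OF H] by blast
  interpret \<sigma>: unital_representation H "iA 1" \<sigma> by fact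
  have "integrated_form H iA iS (\<sigma> \<circ> iA) (\<sigma> \<circ> u) \<sigma>"
    using \<sigma>.rep by (auto simp: integrated_form_def \<sigma>.multiplier_extension_unital
        B.mult_left_unit B.u_def fun_eq_iff)
  note forms = integrated_forms_of_pair[OF H left this \<tau>]
  interpret \<tau>: unital_representation H "jA 1" \<tau> by (rule forms)
  have "hnorm H (\<tau> y \<xi>) \<le> ideal_norm J y"
    by (intro \<tau>.rep_norm_le_ideal_norm closed_ideal_0 C.redundancy_ideal_closed forms \<xi>)
  with \<xi>(3) show ?thesis by (simp add: forms(5)[OF xy])
qed

lemma ideal_norm_le_left:
  assumes xy: "(x, y) \<in> R" shows "ideal_norm J y \<le> ideal_norm I x"
proof (cases "J = UNIV")
  case True
  then have "ideal_norm J y = 0"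
    using ideal_norm_eq_0_iff[OF C.redundancy_ideal_closed, of y] by simp
  then show ?thesis
    using closed_ideal_0[OF B.redundancy_ideal_closed] ideal_norm_nonneg[of I x] by auto
next
  case False
  obtain H :: "'h hilb" and \<tau> \<xi> where H: "hilbert_space H" and \<tau>: "unital_representation H (jA 1) \<tau>"
    and kill: "\<And>i x. i \<in> J \<Longrightarrow> x \<in> hcarrier H \<Longrightarrow> \<tau> i x = hzero H"
    and \<xi>: "\<xi> \<in> hcarrier H" "hnorm H \<xi> \<le> 1" "ideal_norm J y \<le> hnorm H (\<tau> y \<xi>)"
    by (rule C.exists_representation[OF C.redundancy_ideal_closed False]) blast
  interpret \<tau>: unital_representation H "jA 1" \<tau> by fact
  define V where "V s = hadjoint H (\<tau> (v s))" for s
  have right: "(\<tau> \<circ> jA, \<tau> \<circ> v) \<in> right_pairs H \<beta> L" by (rule right_pair_if_kills[OF \<tau> kill])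
  then have left: "(\<tau> \<circ> jA, V) \<in> left_pairs H \<beta> L"
    using adjoint_pair_right[OF H right] by (simp add: adjoint_pair_def V_def[abs_def])
  then have "toeplitz_covariant H L \<beta> (\<tau> \<circ> jA) V" by (simp add: left_pairs_def)
  then obtain \<sigma> where \<sigma>: "integrated_form H iA iS (\<tau> \<circ> jA) V \<sigma>"
    using B.exists_integrated_form[OF H] by blast
  have "(\<lambda>s. hadjoint H (V s)) = \<tau> \<circ> v"
    by (simp add: V_def \<tau>.hadjoint_hadjoint[OF \<tau>.repD(1)] comp_def)
  then have "integrated_form H jA jS (\<tau> \<circ> jA) (\<lambda>s. hadjoint H (V s)) \<tau>"
    using \<tau>.rep by (auto simp: integrated_form_def \<tau>.multiplier_extension_unital
        C.mult_left_unit C.u_def fun_eq_iff)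
  note forms = integrated_forms_of_pair[OF H left \<sigma> this]
  interpret \<sigma>: unital_representation H "iA 1" \<sigma> by (rule forms)
  have "hnorm H (\<sigma> x \<xi>) \<le> ideal_norm I x"
    by (intro \<sigma>.rep_norm_le_ideal_norm closed_ideal_0 B.redundancy_ideal_closed forms \<xi>)
  with \<xi>(3) show ?thesis by (simp add: forms(5)[OF xy])
qed

lemma R_zero: "(0, 0) \<in> R"
  using R.scale[OF R.base, of 0] by simp

lemma R_star: "(x, y) \<in> R \<Longrightarrow> (star x, star y) \<in> R"
proof (induction rule: R.induct)
  case (base a)
  show ?case using R.base[of "star a"] by (simp add: B.iA(4) C.iA(4))
qed (auto simp: star_simps intro: R.intros)

sublocale quotient_correspondence I J R
proof
  show "closure (fst ` R) = UNIV"
  proof (rule B.generated[OF cstar_subalgebra_closure])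
    show "csubspace (fst ` R)"
      unfolding complex_vector.subspace_def fst_eq_Domain by (blast intro: R_zero R.add R.scale)
    show "x * y \<in> fst ` R" if "x \<in> fst ` R" "y \<in> fst ` R" for x y
      using that unfolding fst_eq_Domain by (blast intro: R.mult)
    show "star x \<in> fst ` R" if "x \<in> fst ` R" for x
      using that unfolding fst_eq_Domain by (blast intro: R_star)
    show "iA a * u s \<in> closure (fst ` R)" for a s
      using R.mult[OF R.base R.isometry, of a s] closure_subset by force
  qed
  show "closure (snd ` R) = UNIV"
  proof (rule C.generated[OF cstar_subalgebra_closure])
    show "csubspace (snd ` R)"
      unfolding complex_vector.subspace_def snd_eq_Range by (blast intro: R_zero R.add R.scale)
    show "x * y \<in> snd ` R" if "x \<in> snd ` R" "y \<in> snd ` R" for x y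
      using that unfolding snd_eq_Range by (blast intro: R.mult)
    show "star x \<in> snd ` R" if "x \<in> snd ` R" for x
      using that unfolding snd_eq_Range by (blast intro: R_star)
    show "jA a * v s \<in> closure (snd ` R)" for a s
      using R.mult[OF R.base R.coisometry, of a s] closure_subset by force
  qed
qed (auto intro: R.intros R_zero R_star B.redundancy_ideal_closed C.redundancy_ideal_closed
    B.closed_ideal_star C.closed_ideal_star antisym ideal_norm_le_left ideal_norm_le_right)

text \<open>Matrix coefficients are continuous in the algebra element and vanish on the two ideals,
  so agreement on \<open>R\<close> extends first to \<open>R_mod\<close> and then to its
  closure.\<close>

lemma representations_agree_on_closure:
  assumes \<sigma>: "unital_representation H (iA 1) \<sigma>" and \<tau>: "unital_representation H (jA 1) \<tau>"
    and kill: "I \<subseteq> unital_representation.rep_kernel H \<sigma>" "J \<subseteq> unital_representation.rep_kernel H \<tau>"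
    and agree: "\<And>x y. (x, y) \<in> R \<Longrightarrow> \<sigma> x = \<tau> y" and xy: "(x, y) \<in> closure R_mod"
  shows "\<sigma> x = \<tau> y"
proof -
  interpret \<sigma>: unital_representation H "iA 1" \<sigma> by fact
  interpret \<tau>: unital_representation H "jA 1" \<tau> by fact
  obtain X Y where XY: "\<And>n::nat. (X n, Y n) \<in> R_mod" "X \<longlonglongrightarrow> x" "Y \<longlonglongrightarrow> y"
    by (rule closure_R_mod_sequence[OF xy]) blast
  show ?thesis
  proof (rule \<sigma>.rep_eqI[OF _ \<tau>.repD(1)])
    fix \<xi> \<eta> assume \<xi>\<eta>: "\<xi> \<in> hcarrier H" "\<eta> \<in> hcarrier H"
    have "hinner H (\<sigma> (X n) \<xi>) \<eta> = hinner H (\<tau> (Y n) \<xi>) \<eta>" for n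
    proof -
      obtain i j where ij: "i \<in> I" "j \<in> J" "(X n - i, Y n - j) \<in> R"
        using XY(1)[of n] by (auto simp: R_mod_def)
      have "hinner H (\<sigma> i \<xi>) \<eta> = 0" "hinner H (\<tau> j \<xi>) \<eta> = 0"
        using kill ij \<xi>\<eta> by (auto simp: \<sigma>.rep_kernel_def \<tau>.rep_kernel_def)
      then show ?thesis
        using \<sigma>.hinner_rep_diff[OF \<xi>\<eta>, of "X n" i] \<tau>.hinner_rep_diff[OF \<xi>\<eta>, of "Y n" j] agree[OF ij(3)]
        by simp
    qed
    moreover have "(\<lambda>n. hinner H (\<sigma> (X n) \<xi>) \<eta>) \<longlonglongrightarrow> hinner H (\<sigma> x \<xi>) \<eta>"
      by (rule bounded_linear.tendsto[OF \<sigma>.bounded_linear_hinner_rep[OF \<xi>\<eta>] XY(2)])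
    moreover have "(\<lambda>n. hinner H (\<tau> (Y n) \<xi>) \<eta>) \<longlonglongrightarrow> hinner H (\<tau> y \<xi>) \<eta>"
      by (rule bounded_linear.tendsto[OF \<tau>.bounded_linear_hinner_rep[OF \<xi>\<eta>] XY(3)])
    ultimately show "hinner H (\<sigma> x \<xi>) \<eta> = hinner H (\<tau> y \<xi>) \<eta>"
      by (simp add: LIMSEQ_unique)
  qed
qed

lemma Phi_on_R: "(x, y) \<in> R \<Longrightarrow> \<Phi> (coset I x) = coset J y"
  by (intro \<Phi>_coset subsetD[OF closure_subset] subsetD[OF R_subset])

text \<open>The clause on integrated forms expresses that the isomorphism is induced by passing to
  adjoints. The type \<open>'k\<close> is independent of the universe: the universe served to
  compare the quotient norms, and what remains holds for given integrated forms on any Hilbert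
  space.\<close>

lemma crossed_products_isomorphic:
  "\<exists>\<Phi>. star_algebra_iso (crossed_product L iA iS) (crossed_product \<beta> jA jS) \<Phi> \<and>
    (\<forall>a s. \<Phi> (coset I (iA a)) = coset J (jA a) \<and>
       \<Phi> (coset I (mult_right (iS s) (iA a))) = coset J (mult_right (star (jS s)) (jA a))) \<and>
    (\<forall>(H :: 'k hilb) \<pi> V \<sigma> \<tau> x y.
       hilbert_space H \<and> (\<pi>, V) \<in> left_pairs H \<beta> L \<and>
       integrated_form H iA iS \<pi> V \<sigma> \<and>
       integrated_form H jA jS \<pi> (\<lambda>s. hadjoint H (V s)) \<tau> \<and>
       \<Phi> (coset I x) = coset J y \<longrightarrow> \<sigma> x = \<tau> y)"
proof (rule exI[of _ \<Phi>], intro conjI allI impI)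
  show "star_algebra_iso (crossed_product L iA iS) (crossed_product \<beta> jA jS) \<Phi>"
    unfolding crossed_product_def by (rule star_algebra_iso_\<Phi>)
  show "\<Phi> (coset I (iA a)) = coset J (jA a)" for a by (intro Phi_on_R R.intros)
  show "\<Phi> (coset I (mult_right (iS s) (iA a))) = coset J (mult_right (star (jS s)) (jA a))" for a s
    unfolding B.mult_right_iS C.mult_right_star_iS by (intro Phi_on_R R.intros)
next
  fix H :: "'k hilb" and \<pi> V \<sigma> \<tau> x y
  assume *: "hilbert_space H \<and> (\<pi>, V) \<in> left_pairs H \<beta> L \<and> integrated_form H iA iS \<pi> V \<sigma> \<and>
    integrated_form H jA jS \<pi> (\<lambda>s. hadjoint H (V s)) \<tau> \<and> \<Phi> (coset I x) = coset J y"
  then have H: "hilbert_space H" "(\<pi>, V) \<in> left_pairs H \<beta> L" "integrated_form H iA iS \<pi> V \<sigma>"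
    "integrated_form H jA jS \<pi> (\<lambda>s. hadjoint H (V s)) \<tau>" and xy: "(x, y) \<in> closure R_mod"
    by (simp_all add: \<Phi>_coset_iff)
  note forms = integrated_forms_of_pair[OF H]
  show "\<sigma> x = \<tau> y" by (rule representations_agree_on_closure[OF forms(1-5) xy])
qed

end

theorem theorem4p7:
  fixes \<beta> L :: "'s::comm_monoid_add \<Rightarrow> 'a::{cstar_algebra, monoid_mult} \<Rightarrow> 'a"
  assumes "endomorphic_action \<beta>"
    and "endomorphic_action L"
    and "\<And>s. \<beta> s 1 = 1"
    and "\<And>s. transfer_operator (\<beta> s) (L s)"
    and "\<And>s. \<beta> s \<circ> L s = id"
  shows "(\<forall>s. transfer_operator (L s) (\<beta> s)) \<and>
    (\<forall>H :: 'k hilb. hilbert_space H \<longrightarrow>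
       bij_betw (adjoint_pair H) (left_pairs H \<beta> L) (right_pairs H \<beta> L)) \<and>
    (\<forall>(i\<^sub>A :: 'a \<Rightarrow> 'b::cstar_algebra) i\<^sub>S (j\<^sub>A :: 'a \<Rightarrow> 'c::cstar_algebra) j\<^sub>S.
       large_universe TYPE('a) TYPE('s) TYPE('h) \<and>
       toeplitz_crossed_product TYPE('h) L \<beta> i\<^sub>A i\<^sub>S \<and>
       toeplitz_crossed_product TYPE('h) \<beta> L j\<^sub>A j\<^sub>S \<longrightarrow>
       (let I = redundancy_ideal L i\<^sub>A i\<^sub>S; J = redundancy_ideal \<beta> j\<^sub>A j\<^sub>S in
        \<exists>\<Phi>. star_algebra_iso (crossed_product L i\<^sub>A i\<^sub>S) (crossed_product \<beta> j\<^sub>A j\<^sub>S) \<Phi> \<and>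
          (\<forall>a s. \<Phi> (coset I (i\<^sub>A a)) = coset J (j\<^sub>A a) \<and>
             \<Phi> (coset I (mult_right (i\<^sub>S s) (i\<^sub>A a))) =
               coset J (mult_right (star (j\<^sub>S s)) (j\<^sub>A a))) \<and>
          (\<forall>(H :: 'k hilb) \<pi> V \<sigma> \<tau> x y.
             hilbert_space H \<and> (\<pi>, V) \<in> left_pairs H \<beta> L \<and>
             integrated_form H i\<^sub>A i\<^sub>S \<pi> V \<sigma> \<and>
             integrated_form H j\<^sub>A j\<^sub>S \<pi> (\<lambda>s. hadjoint H (V s)) \<tau> \<and>
             \<Phi> (coset I x) = coset J y \<longrightarrow> \<sigma> x = \<tau> y)))"
proof -
  interpret extendible_pair \<beta> L by unfold_locales (use assms in auto)
  have pair: "crossed_product_pair \<beta> L i\<^sub>A i\<^sub>S j\<^sub>A j\<^sub>S TYPE('h)"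
    if "large_universe TYPE('a) TYPE('s) TYPE('h) \<and>
      toeplitz_crossed_product TYPE('h) L \<beta> i\<^sub>A i\<^sub>S \<and>
      toeplitz_crossed_product TYPE('h) \<beta> L j\<^sub>A j\<^sub>S"
    for i\<^sub>A :: "'a \<Rightarrow> 'b" and i\<^sub>S and j\<^sub>A :: "'a \<Rightarrow> 'c" and j\<^sub>S
    by unfold_locales (use that in auto)
  show ?thesis
    unfolding Let_def
    by (intro conjI allI impI beta_transfer bij_betw_adjoint_pair pair
        crossed_product_pair.crossed_products_isomorphic[where universe = "TYPE('h)"]) simp_all
qed

end
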